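(* Let $\sigma\ge3$. There exist $\varepsilon>0$ and a constant $C$ such that whenever $\|\{u_n(0)\}\|_{l^2(\mathbb Z)}\le\varepsilon$ and $\|\{\partial_tu_n(0)\}\|_{l^2(\mathbb Z)}\le\varepsilon$, there exists a unique global solution of the one-dimensional discrete nonlinear Klein-Gordon equation (with either choice of sign) $$\partial_t^2u_n(t)-(\Delta_d u)_n(t)+u_n(t)\pm|u_n(t)|^{2\sigma}u_n(t)=0,\qquad n\in\mathbb Z,$$ with this initial data, and it satisfies $$\|\{u_n(t)\}\|_{L^ql^r}\le C\varepsilon$$ for all Strichartz admissible pairs $(q,r)$. In particular, $\|\{u_n(t)\}\|_{l^r}\to0$ as $t\to\infty$ for every $r>2$.
   Context: The one-dimensional discrete Laplacian (lattice spacing $1$) is $(\Delta_d u)_n=u_{n+1}+u_{n-1}-2u_n$, $n\in\mathbb Z$. A pair $(q,r)$ is Strichartz admissible (in dimension one) if $q,r\in[2,\infty]$ and $\frac1q+\frac1{3r}\le\frac16$. The mixed norm is $\|u\|_{L^ql^r}=\big(\int_0^\infty\|\{u_n(t)\}\|_{l^r(\mathbb Z)}^q\,dt\big)^{1/q}$ (with the usual supremum modification if an exponent is infinite). Solutions are understood in the integral (Duhamel) sense. *)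

theory Defs
  imports "HOL-Analysis.Analysis"
begin

text \<open>Real powers on \<^typ>\<open>ennreal\<close>, used for strictly positive exponents only.\<close>

definition epowr :: "ennreal \<Rightarrow> real \<Rightarrow> ennreal" where
  "epowr x p = (if x = \<infinity> then \<infinity> else ennreal (enn2real x powr p))"

text \<open>
  The exponent ranges over the extended half-line. For \<open>p = \<infinity>\<close> the true supremum is used
  rather than the essential one; both agree for the counting measure and for continuous
  functions of time.
\<close>

definition Lp_norm :: "ennreal \<Rightarrow> 'a measure \<Rightarrow> ('a \<Rightarrow> ennreal) \<Rightarrow> ennreal" where
  "Lp_norm p M f =
     (if p = \<infinity> then (SUP x\<in>space M. f x)
      else epowr (\<integral>\<^sup>+x. epowr (f x) (enn2real p) \<partial>M) (1 / enn2real p))"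

definition lp_norm :: "ennreal \<Rightarrow> (int \<Rightarrow> complex) \<Rightarrow> ennreal" where
  "lp_norm r f = Lp_norm r (count_space UNIV) (\<lambda>n. ennreal (cmod (f n)))"

definition mixed_norm :: "ennreal \<Rightarrow> ennreal \<Rightarrow> (real \<Rightarrow> int \<Rightarrow> complex) \<Rightarrow> ennreal" where
  "mixed_norm q r u = Lp_norm q (restrict_space lborel {0..}) (\<lambda>t. lp_norm r (u t))"

text \<open>In \<^typ>\<open>ennreal\<close> we have \<open>1 / \<infinity> = 0\<close>, as required for infinite exponents.\<close>

definition strichartz_admissible :: "ennreal \<Rightarrow> ennreal \<Rightarrow> bool" where
  "strichartz_admissible q r \<longleftrightarrow> 2 \<le> q \<and> 2 \<le> r \<and> 1 / q + 1 / (3 * r) \<le> 1 / 6"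

definition discrete_laplacian :: "(int \<Rightarrow> complex) \<Rightarrow> int \<Rightarrow> complex" where
  "discrete_laplacian u n = u (n + 1) + u (n - 1) - 2 * u n"

definition plane_wave :: "real \<Rightarrow> int \<Rightarrow> complex" where
  "plane_wave k n = cis (k * of_int n)"

text \<open>
  The operator \<open>1 - \<Delta>\<close> is diagonalised by the plane waves, its eigenvalue at \<open>k\<close>
  being the value at the site \<open>0\<close> of its action on the plane wave. The frequency is the
  square root of this eigenvalue, i.e. the symbol of \<open>\<surd>(1 - \<Delta>)\<close>.
\<close>

definition kg_frequency :: "real \<Rightarrow> real" where
  "kg_frequency k = sqrt (Re (plane_wave k 0 - discrete_laplacian (plane_wave k) 0))"

lemma kg_frequency_eq: "kg_frequency k = sqrt (3 - 2 * cos k)"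
  by (simp add: kg_frequency_def discrete_laplacian_def plane_wave_def)

lemma plane_wave_eigenfunction:
  "plane_wave k n - discrete_laplacian (plane_wave k) n
     = of_real ((kg_frequency k)\<^sup>2) * plane_wave k n"
proof -
  have "0 \<le> 3 - 2 * cos k"
    using cos_le_one[of k] by linarith
  then have freq: "(kg_frequency k)\<^sup>2 = 3 - 2 * cos k"
    by (simp add: kg_frequency_eq)
  have plus: "plane_wave k (n + 1) = plane_wave k n * cis k"
    by (simp add: plane_wave_def cis_mult distrib_left)
  have minus: "plane_wave k (n - 1) = plane_wave k n * cis (- k)"
    by (simp add: plane_wave_def cis_mult right_diff_distrib)
  have "cis k + cis (- k) = of_real (2 * cos k)"
    by (simp add: complex_eq_iff)
  then have "plane_wave k (n + 1) + plane_wave k (n - 1) = of_real (2 * cos k) * plane_wave k n"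
    unfolding plus minus by (metis distrib_left mult.commute)
  then show ?thesis
    by (simp add: discrete_laplacian_def freq algebra_simps)
qed

text \<open>
  The operator on \<open>l\<^sup>2\<close> acting on the Fourier side as multiplication by the symbol \<open>m\<close>,
  written as convolution with the Fourier coefficients of \<open>m\<close>.
\<close>

definition fourier_kernel :: "(real \<Rightarrow> real) \<Rightarrow> int \<Rightarrow> complex" where
  "fourier_kernel m n =
     of_real (1 / (2 * pi)) * integral {-pi..pi} (\<lambda>k. of_real (m k) * plane_wave k n)"

definition fourier_multiplier :: "(real \<Rightarrow> real) \<Rightarrow> (int \<Rightarrow> complex) \<Rightarrow> int \<Rightarrow> complex" where
  "fourier_multiplier m f n = (\<Sum>\<^sub>\<infinity>j. fourier_kernel m (n - j) * f j)"

text \<open>\<open>cos (t \<surd>(1 - \<Delta>))\<close> and \<open>sin (t \<surd>(1 - \<Delta>)) / \<surd>(1 - \<Delta>)\<close>; note \<open>kg_frequency k \<ge> 1\<close>.\<close>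

definition kg_cos :: "real \<Rightarrow> (int \<Rightarrow> complex) \<Rightarrow> int \<Rightarrow> complex" where
  "kg_cos t = fourier_multiplier (\<lambda>k. cos (t * kg_frequency k))"

definition kg_sin :: "real \<Rightarrow> (int \<Rightarrow> complex) \<Rightarrow> int \<Rightarrow> complex" where
  "kg_sin t = fourier_multiplier (\<lambda>k. sin (t * kg_frequency k) / kg_frequency k)"

definition kg_nonlinearity :: "real \<Rightarrow> (int \<Rightarrow> complex) \<Rightarrow> int \<Rightarrow> complex" where
  "kg_nonlinearity \<sigma> f n = of_real (cmod (f n) powr (2 * \<sigma>)) * f n"

definition l2_continuous :: "(real \<Rightarrow> int \<Rightarrow> complex) \<Rightarrow> bool" where
  "l2_continuous u \<longleftrightarrow>
     (\<forall>t\<ge>0. lp_norm 2 (u t) < \<infinity> \<and>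
            ((\<lambda>s. lp_norm 2 (\<lambda>n. u s n - u t n)) \<longlongrightarrow> 0) (at t within {0..}))"

text \<open>
  Global solutions in \<open>C([0,\<infinity>); l\<^sup>2)\<close> of \<open>u'' - \<Delta> u + u + \<mu> |u|^(2\<sigma>) u = 0\<close> with
  \<open>u(0) = u0\<close> and \<open>u'(0) = u1\<close>, in the Duhamel sense
  \<open>u(t) = kg_cos t u0 + kg_sin t u1 - \<mu> \<integral>\<^sub>0\<^sup>t kg_sin (t - s) (|u(s)|^(2\<sigma>) u(s)) ds\<close>.
\<close>

definition kg_solution ::
  "real \<Rightarrow> real \<Rightarrow> (int \<Rightarrow> complex) \<Rightarrow> (int \<Rightarrow> complex) \<Rightarrow> (real \<Rightarrow> int \<Rightarrow> complex) \<Rightarrow> bool"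
where
  "kg_solution \<sigma> \<mu> u0 u1 u \<longleftrightarrow>
     l2_continuous u \<and>
     (\<forall>t\<ge>0. \<forall>n. \<exists>I.
        ((\<lambda>s. kg_sin (t - s) (kg_nonlinearity \<sigma> (u s)) n) has_integral I) {0..t} \<and>
        u t n = kg_cos t u0 n + kg_sin t u1 n - of_real \<mu> * I)"

end

theory Submission
  imports Defs
begin

text \<open>
  On the Fourier side the propagators multiply by \<open>cos (t \<omega>)\<close> and \<open>sin (t \<omega>) / \<omega>\<close>, where
  \<open>\<omega> k = sqrt (3 - 2 cos k)\<close>. Since \<open>\<omega>''\<close> has on \<open>[0, \<pi>]\<close> only one zero, a simple one, van der Corput's
  lemma gives a kernel decay of \<open>(1 + |t|) powr (-1/3)\<close>, and the \<open>T T*\<close> argument with the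
  Hardy-Littlewood-Sobolev inequality yields the endpoint Strichartz estimate from \<open>l\<^sup>2\<close> to
  \<open>L\<^sup>6 l\<^sup>\<infinity>\<close>. Time is sampled at \<open>\<theta>, \<theta> + 1, \<theta> + 2, \<dots>\<close>, uniformly in \<open>\<theta>\<close>, so that only finite sums
  occur in this step. As \<open>2\<sigma> \<ge> 6\<close>, the nonlinearity satisfies
  \<open>\<parallel>|u|\<^bsup>2\<sigma>\<^esup> u\<parallel> \<le> C M\<^bsup>2\<sigma>\<^esup> M\<close> in \<open>L\<^sup>1 l\<^sup>2\<close> on the ball of radius \<open>M\<close> of \<open>L\<^sup>\<infinity> l\<^sup>2 \<inter> L\<^sup>6 l\<^sup>\<infinity>\<close>, and the
  Duhamel map is a contraction of this ball for the metric of \<open>L\<^sup>\<infinity> l\<^sup>2\<close> alone. The other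
  admissible norms follow by interpolation. The sup norm tends to zero because it is Lipschitz in
  time and its sixth power is summable along every grid.
\<close>

section \<open>Discrete Hardy-Littlewood-Sobolev inequality\<close>

text \<open>On the lattice the group velocity \<open>\<omega>'\<close> has a maximum inside
  \<open>[0, \<pi>]\<close>, and near it the phase is cubic. This degrades the decay from |t|^(-1/2)
  to |t|^(-1/3), so 6 is the time exponent that pairs with the sup norm, and 6/5 is its dual:
  Hardy-Littlewood-Sobolev with kernel exponent 1/3 asks for 2 * 5/6 + 1/3 = 2. The compensation is
  that \<open>l\<^sup>2\<close> embeds into \<open>l\<^sup>\<infinity>\<close>, which raises 6 to
  every larger exponent, in particular to 2\<sigma>. The obstacle is that the sup norm is not
  linear, and a maximising site would have to be chosen as a function of time. Here this choice is a
  finite sequence of sites \<open>\<nu> j\<close> next to weights \<open>b j\<close>; a site enters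
  the oscillatory integral only as a linear phase, to which second-derivative estimates are blind.
  As the nonlinearity is measured in \<open>L\<^sup>1 l\<^sup>2\<close>, the Duhamel term is a
  superposition of free waves started at times s, and the homogeneous estimate covers each of them
  once the offset \<theta> may be negative.\<close>

lemma sum_antimono_le_sum_lessThan_card:
  fixes g :: "nat \<Rightarrow> real"
  assumes "finite D" and anti: "\<And>m n. m \<le> n \<Longrightarrow> g n \<le> g m"
  shows "sum g D \<le> sum g {..<card D}"
  using assms(1)
proof (induction D rule: finite_linorder_max_induct)
  case (insert b A)
  have "A \<subseteq> {..<b}" using insert by auto
  then have "card A \<le> b"
    using card_mono[of "{..<b}" A] by simp
  then show ?case
    using insert anti[of "card A" b] by (subst sum.insert) auto
qed simp

text \<open>Each term is at most 3/2 times an increment of \<open>x powr (2/3)\<close>, by the mean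
  value theorem, and the increments telescope. The step from 0 to 1 is checked directly because the
  primitive is not differentiable at 0.\<close>

lemma sum_powr_minus_third_le:
  "(\<Sum>d<A. real (Suc d) powr (-1/3)) \<le> 3/2 * real A powr (2/3)"
proof (induction A)
  case (Suc A)
  have "2/3 * real (Suc A) powr (-1/3) \<le> real (Suc A) powr (2/3) - real A powr (2/3)"
  proof (cases "A = 0")
    case False
    have "\<exists>z>real A. z < real (Suc A) \<and>
      real (Suc A) powr (2/3) - real A powr (2/3) = (real (Suc A) - real A) * (2/3 * z powr (-1/3))"
      using False by (intro MVT2) (auto intro!: derivative_eq_intros simp: powr_diff field_simps)
    then obtain z where z: "real A < z" "z < real (Suc A)"
      "real (Suc A) powr (2/3) - real A powr (2/3) = 2/3 * z powr (-1/3)"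
      by auto
    have "real (Suc A) powr (-1/3) \<le> z powr (-1/3)"
      using z False by (intro powr_mono2') auto
    then show ?thesis using z(3) by simp
  qed simp
  then show ?case using Suc by simp
qed simp

text \<open>The kernel decreases with the distance, so crowding the points of \<open>E\<close> next
  to \<open>j\<close> is the worst case. On either side of \<open>j\<close> the distances are
  distinct natural numbers, and the kernel sums to at most its first \<open>card E\<close> values;
  the two sides give twice 3/2.\<close>

lemma sum_kernel_le_card:
  fixes E :: "nat set"
  assumes "finite E"
  shows "(\<Sum>k\<in>E. (1 + \<bar>real j - real k\<bar>) powr (-1/3)) \<le> 3 * real (card E) powr (2/3)"
proof -
  define g where "g d = real (Suc d) powr (-1/3)" for d
  have anti: "g n \<le> g m" if "m \<le> n" for m n
    unfolding g_def using that by (intro powr_mono2') auto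
  have g0: "g d \<ge> 0" for d by (simp add: g_def)
  have one: "(\<Sum>k\<in>F. (1 + \<bar>real j - real k\<bar>) powr (-1/3)) \<le> 3/2 * real (card E) powr (2/3)"
    if F: "F \<subseteq> E" and inj: "inj_on d F" and d: "\<And>k. k \<in> F \<Longrightarrow> \<bar>real j - real k\<bar> = real (d k)"
    for F and d :: "nat \<Rightarrow> nat"
  proof -
    have fin: "finite F" using F assms finite_subset by auto
    have "(\<Sum>k\<in>F. (1 + \<bar>real j - real k\<bar>) powr (-1/3)) = (\<Sum>k\<in>F. g (d k))"
      by (intro sum.cong) (simp_all add: d g_def)
    also have "\<dots> = sum g (d ` F)" using inj by (simp add: sum.reindex)
    also have "\<dots> \<le> sum g {..<card (d ` F)}"
      by (intro sum_antimono_le_sum_lessThan_card anti) (auto simp: fin)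
    also have "\<dots> \<le> sum g {..<card E}"
      using card_mono[OF assms F] inj by (intro sum_mono2) (auto simp: card_image g0)
    also have "\<dots> \<le> 3/2 * real (card E) powr (2/3)"
      unfolding g_def by (rule sum_powr_minus_third_le)
    finally show ?thesis .
  qed
  have E: "E = {k\<in>E. k \<le> j} \<union> {k\<in>E. j < k}" by auto
  have "(\<Sum>k\<in>E. (1 + \<bar>real j - real k\<bar>) powr (-1/3)) =
    (\<Sum>k\<in>{k\<in>E. k \<le> j}. (1 + \<bar>real j - real k\<bar>) powr (-1/3)) +
    (\<Sum>k\<in>{k\<in>E. j < k}. (1 + \<bar>real j - real k\<bar>) powr (-1/3))"
    by (subst E, rule sum.union_disjoint) (use assms in auto)
  also have "\<dots> \<le> 3/2 * real (card E) powr (2/3) + 3/2 * real (card E) powr (2/3)"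
    by (intro add_mono one[where d = "\<lambda>k. j - k"] one[where d = "\<lambda>k. k - j"])
       (auto simp: inj_on_def of_nat_diff)
  finally show ?thesis by simp
qed

text \<open>A dyadic decomposition in the form of an induction. The values in the band
  \<open>(z/2, z]\<close> number at most \<open>(z/2) powr (-6/5)\<close> by Chebyshev, hence
  contribute at most \<open>6 * (z/2) powr (1/5)\<close>; those below are left to the induction
  hypothesis. The level is \<open>z\<close>, the largest value actually attained up to
  \<open>y\<close>, so that the index attaining it leaves the count on which the induction
  runs.\<close>

lemma fractional_sum_below_level_le:
  fixes a :: "nat \<Rightarrow> real"
  assumes K: "finite K" and a0: "\<And>k. k \<in> K \<Longrightarrow> 0 \<le> a k"
    and a1: "(\<Sum>k\<in>K. a k powr (6/5)) \<le> 1" and "0 \<le> y"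
  shows "(\<Sum>k\<in>{k\<in>K. a k \<le> y}. a k * (1 + \<bar>real j - real k\<bar>) powr (-1/3)) \<le> 60 * y powr (1/5)"
  using \<open>0 \<le> y\<close>
proof (induction "card {k\<in>K. 0 < a k \<and> a k \<le> y}" arbitrary: y rule: less_induct)
  case less
  define h where "h k = (1 + \<bar>real j - real k\<bar>) powr (-1/3)" for k
  have h0: "h k \<ge> 0" for k by (simp add: h_def)
  define P where "P = {k\<in>K. 0 < a k \<and> a k \<le> y}"
  have finP: "finite P" using K by (simp add: P_def)
  show ?case
  proof (cases "P = {}")
    case True
    then have "a k = 0" if "k \<in> K" "a k \<le> y" for k
      using that a0[OF that(1)] by (force simp: P_def)
    then have "(\<Sum>k\<in>{k\<in>K. a k \<le> y}. a k * h k) = 0"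
      by (intro sum.neutral) auto
    then show ?thesis by (simp add: h_def)
  next
    case False
    define z where "z = Max (a ` P)"
    have "z \<in> a ` P" unfolding z_def using finP False by (intro Max_in) auto
    then obtain i where i: "i \<in> P" "a i = z" by auto
    have z0: "z > 0" and zy: "z \<le> y" using i by (auto simp: P_def)
    have zmax: "a k \<le> z" if "k \<in> K" "a k \<le> y" for k
    proof (cases "a k > 0")
      case True
      then have "k \<in> P" using that by (simp add: P_def)
      then show ?thesis unfolding z_def using finP by simp
    qed (use z0 in simp)
    define E where "E = {k\<in>K. z/2 < a k \<and> a k \<le> y}"
    have finE: "finite E" using K by (simp add: E_def)
    have "card {k\<in>K. 0 < a k \<and> a k \<le> z/2} < card {k\<in>K. 0 < a k \<and> a k \<le> y}"
    proof (rule psubset_card_mono)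
      have "i \<in> {k\<in>K. 0 < a k \<and> a k \<le> y} - {k\<in>K. 0 < a k \<and> a k \<le> z/2}"
        using i z0 by (auto simp: P_def)
      moreover have "{k\<in>K. 0 < a k \<and> a k \<le> z/2} \<subseteq> {k\<in>K. 0 < a k \<and> a k \<le> y}"
        using zy z0 by auto
      ultimately show "{k\<in>K. 0 < a k \<and> a k \<le> z/2} \<subset> {k\<in>K. 0 < a k \<and> a k \<le> y}"
        by blast
    qed (use K in simp)
    then have IH: "(\<Sum>k\<in>{k\<in>K. a k \<le> z/2}. a k * h k) \<le> 60 * (z/2) powr (1/5)"
      unfolding h_def using z0 by (intro less.hyps) auto
    have "real (card E) * (z/2) powr (6/5) = (\<Sum>k\<in>E. (z/2) powr (6/5))" by simp
    also have "\<dots> \<le> (\<Sum>k\<in>E. a k powr (6/5))"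
      using z0 by (intro sum_mono powr_mono2) (auto simp: E_def)
    also have "\<dots> \<le> (\<Sum>k\<in>K. a k powr (6/5))"
      using K by (intro sum_mono2) (auto simp: E_def)
    finally have "real (card E) * (z/2) powr (6/5) \<le> 1" using a1 by simp
    then have cE: "real (card E) \<le> (z/2) powr (-6/5)"
      using z0 by (simp add: powr_minus field_simps)
    have "(\<Sum>k\<in>E. a k * h k) \<le> (\<Sum>k\<in>E. z * h k)"
      using zmax by (intro sum_mono mult_right_mono h0) (auto simp: E_def)
    also have "\<dots> = z * (\<Sum>k\<in>E. h k)" by (simp add: sum_distrib_left)
    also have "\<dots> \<le> z * (3 * real (card E) powr (2/3))"
      unfolding h_def using z0 by (intro mult_left_mono sum_kernel_le_card finE) auto
    also have "\<dots> \<le> z * (3 * ((z/2) powr (-6/5)) powr (2/3))"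
      using z0 cE by (intro mult_left_mono powr_mono2) auto
    also have "\<dots> = 6 * ((z/2) powr 1 * (z/2) powr (-4/5))"
      using z0 by (simp add: powr_powr)
    also have "\<dots> = 6 * (z/2) powr (1/5)"
      by (subst powr_add[symmetric]) simp
    finally have EE: "(\<Sum>k\<in>E. a k * h k) \<le> 6 * (z/2) powr (1/5)" .
    have split: "{k\<in>K. a k \<le> y} = {k\<in>K. a k \<le> z/2} \<union> E"
      using z0 zy by (auto simp: E_def)
    have "(\<Sum>k\<in>{k\<in>K. a k \<le> y}. a k * h k) = (\<Sum>k\<in>{k\<in>K. a k \<le> z/2}. a k * h k) + (\<Sum>k\<in>E. a k * h k)"
      unfolding split by (rule sum.union_disjoint) (use K finE in \<open>auto simp: E_def\<close>)
    also have "\<dots> \<le> 66 * (z/2) powr (1/5)" using IH EE by simp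
    also have "\<dots> = 66 * (1/2) powr (1/5) * z powr (1/5)"
      using z0 by (simp add: powr_divide)
    also have "\<dots> \<le> 60 * z powr (1/5)"
    proof (rule mult_right_mono)
      \<comment> \<open>Room for the induction: 60 + 6 = 66, and since
        \<open>(9/10)^5 > 1/2\<close>, halving the level brings a factor of at most 9/10; 66 * 9/10
        is below 60.\<close>
      have "(1/2::real) powr (1/5) \<le> ((9/10)^5) powr (1/5)"
        by (intro powr_mono2) (auto simp: power_divide)
      also have "\<dots> = ((9/10) powr real 5) powr (1/5)"
        by (subst powr_realpow) auto
      also have "\<dots> = 9/10" by (simp only: powr_powr) simp
      finally show "66 * (1/2::real) powr (1/5) \<le> 60" by simp
    qed simp
    also have "\<dots> \<le> 60 * y powr (1/5)" using z0 zy by (intro mult_left_mono powr_mono2) auto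
    finally show ?thesis by (simp add: h_def)
  qed
qed

text \<open>In each pair the larger value is taken outside: the inner sum then runs over values up
  to the level \<open>b j\<close> and is at most \<open>60 * b j powr (1/5)\<close>, which leaves an
  outer sum of \<open>b j powr (6/5)\<close>. Symmetry doubles 60, and homogeneity removes the
  normalisation.\<close>

theorem discrete_Hardy_Littlewood_Sobolev:
  fixes a :: "nat \<Rightarrow> real"
  assumes K: "finite K" and a0: "\<And>k. k \<in> K \<Longrightarrow> 0 \<le> a k"
  shows "(\<Sum>j\<in>K. \<Sum>k\<in>K. a j * a k * (1 + \<bar>real j - real k\<bar>) powr (-1/3))
           \<le> 120 * ((\<Sum>k\<in>K. a k powr (6/5)) powr (5/6))\<^sup>2"
proof -
  define h where "h j k = (1 + \<bar>real j - real k\<bar>) powr (-1/3)" for j k :: nat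
  have h0: "h j k \<ge> 0" and hsym: "h j k = h k j" for j k by (simp_all add: h_def abs_minus_commute)
  define S where "S = (\<Sum>k\<in>K. a k powr (6/5))"
  have S0: "S \<ge> 0" by (simp add: S_def sum_nonneg)
  have normalised: "(\<Sum>j\<in>K. \<Sum>k\<in>K. b j * b k * h j k) \<le> 120"
    if b0: "\<And>k. k \<in> K \<Longrightarrow> 0 \<le> b k" and b1: "(\<Sum>k\<in>K. b k powr (6/5)) \<le> 1" for b :: "nat \<Rightarrow> real"
  proof -
    define L where "L j k = (if b k \<le> b j then b j * b k * h j k else 0)" for j k
    have "(\<Sum>j\<in>K. \<Sum>k\<in>K. b j * b k * h j k) \<le> (\<Sum>j\<in>K. \<Sum>k\<in>K. L j k + L k j)"
      using b0 h0 by (intro sum_mono) (auto simp: L_def hsym mult_ac)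
    also have "\<dots> = (\<Sum>j\<in>K. \<Sum>k\<in>K. L j k) + (\<Sum>j\<in>K. \<Sum>k\<in>K. L k j)"
      by (simp add: sum.distrib)
    also have "(\<Sum>j\<in>K. \<Sum>k\<in>K. L k j) = (\<Sum>j\<in>K. \<Sum>k\<in>K. L j k)"
      by (rule sum.swap)
    finally have "(\<Sum>j\<in>K. \<Sum>k\<in>K. b j * b k * h j k) \<le> 2 * (\<Sum>j\<in>K. \<Sum>k\<in>K. L j k)" by simp
    also have "(\<Sum>j\<in>K. \<Sum>k\<in>K. L j k) \<le> (\<Sum>j\<in>K. 60 * b j powr (6/5))"
    proof (rule sum_mono)
      fix j assume j: "j \<in> K"
      have "(\<Sum>k\<in>K. L j k) = (\<Sum>k\<in>{k\<in>K. b k \<le> b j}. b j * b k * h j k)"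
        unfolding L_def using K by (simp add: sum.inter_filter)
      also have "\<dots> = b j * (\<Sum>k\<in>{k\<in>K. b k \<le> b j}. b k * h j k)"
        by (simp add: sum_distrib_left mult.assoc)
      also have "\<dots> \<le> b j * (60 * b j powr (1/5))"
        unfolding h_def using j b0 b1
        by (intro mult_left_mono fractional_sum_below_level_le K) auto
      also have "\<dots> = 60 * (b j powr 1 * b j powr (1/5))" using b0[OF j] by simp
      also have "\<dots> = 60 * b j powr (6/5)" by (subst powr_add[symmetric]) simp
      finally show "(\<Sum>k\<in>K. L j k) \<le> 60 * b j powr (6/5)" .
    qed
    also have "(\<Sum>j\<in>K. 60 * b j powr (6/5)) = 60 * (\<Sum>j\<in>K. b j powr (6/5))" by (simp add: sum_distrib_left)
    finally show ?thesis using b1 by simp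
  qed
  show ?thesis
  proof (cases "S = 0")
    case True
    then have "\<forall>k\<in>K. a k powr (6/5) = 0"
      unfolding S_def using K by (subst (asm) sum_nonneg_eq_0_iff) auto
    then have "\<And>k. k \<in> K \<Longrightarrow> a k = 0" by simp
    then show ?thesis by (simp add: sum.neutral)
  next
    case False
    define s where "s = S powr (5/6)"
    have s0: "s > 0" using False by (simp add: s_def)
    have s65: "s powr (6/5) = S" using S0 by (simp add: s_def powr_powr)
    have "(\<Sum>k\<in>K. (a k / s) powr (6/5)) = (\<Sum>k\<in>K. a k powr (6/5) / S)"
      using a0 s0 by (intro sum.cong) (auto simp: powr_divide s65)
    also have "\<dots> = 1" using False by (simp add: sum_divide_distrib[symmetric] S_def[symmetric])
    finally have "(\<Sum>j\<in>K. \<Sum>k\<in>K. a j / s * (a k / s) * h j k) \<le> 120"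
      using a0 s0 by (intro normalised) auto
    also have "(\<Sum>j\<in>K. \<Sum>k\<in>K. a j / s * (a k / s) * h j k) = (\<Sum>j\<in>K. \<Sum>k\<in>K. a j * a k * h j k) / s\<^sup>2"
      by (simp add: sum_divide_distrib power2_eq_square)
    finally show ?thesis
      using s0 by (simp add: field_simps h_def s_def S_def)
  qed
qed

section \<open>Oscillatory integrals and dispersive decay\<close>

text \<open>One integration by parts against \<open>1 / \<phi>'\<close>. The error term has modulus
  \<open>\<phi>'' / \<phi>'^2\<close>, the derivative of the monotone function
  \<open>- 1 / \<phi>'\<close>, so its integral is again a matter of the two endpoints; altogether
  there are four endpoint terms of size at most \<open>1 / \<delta>\<close>.\<close>

lemma van_der_Corput_first_derivative:
  fixes \<phi> \<phi>' \<phi>'' :: "real \<Rightarrow> real"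
  assumes ab: "a \<le> b" and lam: "\<delta> > 0"
    and d1: "\<And>x. x \<in> {a..b} \<Longrightarrow> (\<phi> has_real_derivative \<phi>' x) (at x)"
    and d2: "\<And>x. x \<in> {a..b} \<Longrightarrow> (\<phi>' has_real_derivative \<phi>'' x) (at x)"
    and convex: "\<And>x. x \<in> {a..b} \<Longrightarrow> 0 \<le> \<phi>'' x"
    and big: "(\<forall>x\<in>{a..b}. \<delta> \<le> \<phi>' x) \<or> (\<forall>x\<in>{a..b}. \<phi>' x \<le> -\<delta>)"
  shows "norm (integral {a..b} (\<lambda>x. cis (\<phi> x))) \<le> 4 / \<delta>"
proof -
  define g where "g x = cis (\<phi> x) / (\<i> * of_real (\<phi>' x))" for x
  define r where "r x = cis (\<phi> x) * of_real (\<phi>'' x / (\<phi>' x)\<^sup>2) / \<i>" for x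
  have nz: "\<delta> \<le> \<bar>\<phi>' x\<bar>" if "x \<in> {a..b}" for x using big that lam by force
  then have nz': "\<phi>' x \<noteq> 0" if "x \<in> {a..b}" for x using that lam by force
  have "((\<lambda>x. \<phi>'' x / (\<phi>' x)\<^sup>2) has_integral (- (1 / \<phi>' b) - - (1 / \<phi>' a))) {a..b}"
  proof (rule fundamental_theorem_of_calculus[OF ab])
    fix x assume x: "x \<in> {a..b}"
    have "((\<lambda>x. - (1 / \<phi>' x)) has_real_derivative \<phi>'' x / (\<phi>' x)\<^sup>2) (at x)"
      using d2[OF x] nz'[OF x] by (auto intro!: derivative_eq_intros simp: power2_eq_square)
    then show "((\<lambda>x. - (1 / \<phi>' x)) has_vector_derivative \<phi>'' x / (\<phi>' x)\<^sup>2) (at x within {a..b})"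
      by (auto simp: has_real_derivative_iff_has_vector_derivative intro: has_vector_derivative_at_within)
  qed
  then have int1: "((\<lambda>x. \<phi>'' x / (\<phi>' x)\<^sup>2) has_integral (1 / \<phi>' a - 1 / \<phi>' b)) {a..b}" by simp
  have "((\<lambda>x. cis (\<phi> x) - r x) has_integral (g b - g a)) {a..b}"
  proof (rule fundamental_theorem_of_calculus[OF ab])
    fix x assume x: "x \<in> {a..b}"
    have "((\<lambda>x. cis (\<phi> x)) has_vector_derivative (\<phi>' x *\<^sub>R (\<i> * cis (\<phi> x)))) (at x)"
      using d1[OF x] unfolding has_real_derivative_iff_has_vector_derivative has_vector_derivative_def
      by (auto intro!: derivative_eq_intros simp: scaleR_conv_of_real)
    moreover have "((\<lambda>x. 1 / (\<phi>' x)) has_vector_derivative (- \<phi>'' x / (\<phi>' x)\<^sup>2)) (at x)"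
      using d2[OF x] nz'[OF x] unfolding has_real_derivative_iff_has_vector_derivative[symmetric]
      by (auto intro!: derivative_eq_intros simp: power2_eq_square)
    ultimately have "((\<lambda>x. (1 / \<phi>' x) *\<^sub>R cis (\<phi> x)) has_vector_derivative
        ((1 / \<phi>' x) *\<^sub>R (\<phi>' x *\<^sub>R (\<i> * cis (\<phi> x))) + (- \<phi>'' x / (\<phi>' x)\<^sup>2) *\<^sub>R cis (\<phi> x))) (at x)"
      by (rule has_vector_derivative_scaleR[rotated, unfolded has_real_derivative_iff_has_vector_derivative])
    then have "((\<lambda>x. (1 / \<phi>' x) *\<^sub>R cis (\<phi> x) / \<i>) has_vector_derivative
        ((1 / \<phi>' x) *\<^sub>R (\<phi>' x *\<^sub>R (\<i> * cis (\<phi> x))) + (- \<phi>'' x / (\<phi>' x)\<^sup>2) *\<^sub>R cis (\<phi> x)) / \<i>) (at x)"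
      by (rule has_vector_derivative_divide)
    moreover have "(\<lambda>x. (1 / \<phi>' x) *\<^sub>R cis (\<phi> x) / \<i>) = g"
      by (simp add: g_def scaleR_conv_of_real fun_eq_iff divide_inverse mult_ac)
    moreover have "((1 / \<phi>' x) *\<^sub>R (\<phi>' x *\<^sub>R (\<i> * cis (\<phi> x))) + (- \<phi>'' x / (\<phi>' x)\<^sup>2) *\<^sub>R cis (\<phi> x)) / \<i>
       = cis (\<phi> x) - r x"
      using nz'[OF x] by (simp add: r_def scaleR_conv_of_real algebra_simps)
    ultimately show "(g has_vector_derivative cis (\<phi> x) - r x) (at x within {a..b})"
      by (auto intro: has_vector_derivative_at_within)
  qed
  then have int2: "(\<lambda>x. cis (\<phi> x) - r x) integrable_on {a..b}"
    "integral {a..b} (\<lambda>x. cis (\<phi> x) - r x) = g b - g a" by (auto simp: has_integral_iff)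
  have contphi: "continuous_on {a..b} \<phi>" by (rule DERIV_atLeastAtMost_imp_continuous_on) (use d1 in auto)
  have intcis: "(\<lambda>x. cis (\<phi> x)) integrable_on {a..b}"
    by (intro integrable_continuous_real continuous_intros contphi)
  have intr: "r integrable_on {a..b}"
    using integrable_diff[OF intcis int2(1)] by simp
  have "norm (integral {a..b} r) \<le> integral {a..b} (\<lambda>x. \<phi>'' x / (\<phi>' x)\<^sup>2)"
    using int1 convex by (intro Henstock_Kurzweil_Integration.integral_norm_bound_integral intr)
      (auto simp: r_def norm_mult norm_divide norm_power has_integral_iff)
  also have "\<dots> = 1 / \<phi>' a - 1 / \<phi>' b" using int1 by (simp add: has_integral_iff)
  also have "\<dots> \<le> \<bar>1 / \<phi>' a\<bar> + \<bar>1 / \<phi>' b\<bar>" by linarith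
  finally have R: "norm (integral {a..b} r) \<le> \<bar>1 / \<phi>' a\<bar> + \<bar>1 / \<phi>' b\<bar>" .
  have inv: "\<bar>1 / \<phi>' x\<bar> \<le> 1 / \<delta>" if "x \<in> {a..b}" for x
    using nz[OF that] lam by (simp add: frac_le)
  have gn: "norm (g x) = \<bar>1 / \<phi>' x\<bar>" for x by (simp add: g_def norm_divide norm_mult)
  have "integral {a..b} (\<lambda>x. cis (\<phi> x)) = (g b - g a) + integral {a..b} r"
    using Henstock_Kurzweil_Integration.integral_diff[OF intcis intr] int2(2) by simp
  then have "norm (integral {a..b} (\<lambda>x. cis (\<phi> x))) \<le> norm (g b) + norm (g a) + norm (integral {a..b} r)"
    by (metis norm_triangle_ineq norm_triangle_ineq4 add_right_mono order_trans)
  also have "\<dots> \<le> (1/\<delta> + 1/\<delta>) + (1/\<delta> + 1/\<delta>)"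
    unfolding gn using inv[of a] inv[of b] R ab by (intro add_mono order_trans[OF R]) auto
  finally show ?thesis by simp
qed

lemma norm_integral_cis_le: "a \<le> b \<Longrightarrow> continuous_on {a..b} \<phi> \<Longrightarrow>
    norm (integral {a..b} (\<lambda>x. cis (\<phi> x))) \<le> b - a"
  using integral_bound[of a b "\<lambda>x. cis (\<phi> x)" 1] by (auto intro!: continuous_intros)

lemma norm_integral_split3:
  fixes f :: "real \<Rightarrow> 'a::banach"
  assumes "a \<le> c" "c \<le> d" "d \<le> b" "continuous_on {a..b} f"
  shows "norm (integral {a..b} f) \<le>
    norm (integral {a..c} f) + norm (integral {c..d} f) + norm (integral {d..b} f)"
proof -
  have "integral {a..b} f = integral {a..c} f + integral {c..b} f"
    using assms by (intro Henstock_Kurzweil_Integration.integral_combine[symmetric] integrable_continuous_real) auto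
  also have "integral {c..b} f = integral {c..d} f + integral {d..b} f"
    using assms by (intro Henstock_Kurzweil_Integration.integral_combine[symmetric] integrable_continuous_real)
      (auto intro: continuous_on_subset)
  finally show ?thesis
    using norm_triangle_ineq[of "integral {a..c} f" "integral {c..d} f + integral {d..b} f"]
      norm_triangle_ineq[of "integral {c..d} f" "integral {d..b} f"] by simp
qed

text \<open>As \<phi>' grows at rate at least \<mu>, some point \<open>p\<close> (its zero, or the
  end of the interval where it comes closest to zero) satisfies
  \<open>\<bar>\<phi>' x\<bar> \<ge> \<mu> * \<bar>x - p\<bar>\<close>. Outside the radius
  \<open>1 / sqrt \<mu>\<close> around \<open>p\<close> the first-derivative bound applies with
  \<open>\<delta> = sqrt \<mu>\<close>; the three pieces give 4 + 2 + 4 = 10.\<close>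

lemma van_der_Corput_second_derivative:
  fixes \<phi> \<phi>' \<phi>'' :: "real \<Rightarrow> real"
  assumes ab: "a \<le> b" and mu: "\<mu> > 0"
    and d1: "\<And>x. x \<in> {a..b} \<Longrightarrow> (\<phi> has_real_derivative \<phi>' x) (at x)"
    and d2: "\<And>x. x \<in> {a..b} \<Longrightarrow> (\<phi>' has_real_derivative \<phi>'' x) (at x)"
    and big: "\<And>x. x \<in> {a..b} \<Longrightarrow> \<mu> \<le> \<phi>'' x"
  shows "norm (integral {a..b} (\<lambda>x. cis (\<phi> x))) \<le> 10 / sqrt \<mu>"
proof -
  have growth: "\<mu> * (y - x) \<le> \<phi>' y - \<phi>' x" if "x \<in> {a..b}" "y \<in> {a..b}" "x \<le> y" for x y
  proof (cases "x = y")
    case False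
    then have "\<exists>z>x. z < y \<and> \<phi>' y - \<phi>' x = (y - x) * \<phi>'' z"
      using that by (intro MVT2) (auto intro: d2)
    then obtain z where z: "z > x" "z < y" "\<phi>' y - \<phi>' x = (y - x) * \<phi>'' z" by auto
    then show ?thesis using big[of z] that False by (simp add: mult.commute mult_right_mono)
  qed simp
  have contphi: "continuous_on {a..b} \<phi>" by (rule DERIV_atLeastAtMost_imp_continuous_on) (use d1 in auto)
  have contphi': "continuous_on {a..b} \<phi>'" by (rule DERIV_atLeastAtMost_imp_continuous_on) (use d2 in auto)
  obtain p where p: "p \<in> {a..b}"
    "\<And>x. x \<in> {a..b} \<Longrightarrow> p < x \<Longrightarrow> \<mu> * (x - p) \<le> \<phi>' x"
    "\<And>x. x \<in> {a..b} \<Longrightarrow> x < p \<Longrightarrow> \<phi>' x \<le> - (\<mu> * (p - x))"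
  proof (cases "0 \<le> \<phi>' a")
    case True
    show ?thesis
    proof (rule that[of a])
      fix x assume "x \<in> {a..b}" "a < x"
      then show "\<mu> * (x - a) \<le> \<phi>' x" using growth[of a x] True ab by auto
    qed (use ab in auto)
  next
    case na: False
    show ?thesis
    proof (cases "\<phi>' b \<le> 0")
      case True
      show ?thesis
      proof (rule that[of b])
        fix x assume "x \<in> {a..b}" "x < b"
        then show "\<phi>' x \<le> - (\<mu> * (b - x))" using growth[of x b] True ab by auto
      qed (use ab in auto)
    next
      case False
      then obtain p where p: "p \<in> {a..b}" "\<phi>' p = 0"
        using IVT'[of \<phi>' a 0 b] na ab contphi' by auto
      show ?thesis
      proof (rule that[of p])
        show "\<mu> * (x - p) \<le> \<phi>' x" if "x \<in> {a..b}" "p < x" for x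
          using growth[of p x] that p by auto
        show "\<phi>' x \<le> - (\<mu> * (p - x))" if "x \<in> {a..b}" "x < p" for x
          using growth[of x p] that p by auto
      qed (use p in auto)
    qed
  qed
  define r where "r = 1 / sqrt \<mu>"
  have r0: "r > 0" and mur: "\<mu> * r = sqrt \<mu>" using mu by (simp_all add: r_def real_div_sqrt)
  define c where "c = max a (p - r)"
  define d where "d = min b (p + r)"
  have order: "a \<le> c" "c \<le> d" "d \<le> b" using p(1) r0 by (auto simp: c_def d_def)
  have nonneg: "0 \<le> \<phi>'' x" if "x \<in> {a..b}" for x using big[OF that] mu by linarith
  have small: "4 / sqrt \<mu> \<ge> 0" using mu by simp
  have left: "norm (integral {a..c} (\<lambda>x. cis (\<phi> x))) \<le> 4 / sqrt \<mu>"
  proof (cases "a = c")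
    case False
    then have c: "c = p - r" by (auto simp: c_def max_def split: if_splits)
    have "\<phi>' x \<le> - sqrt \<mu>" if "x \<in> {a..c}" for x
    proof -
      have "\<mu> * r \<le> \<mu> * (p - x)" using that c mu by (intro mult_left_mono) auto
      moreover have "\<phi>' x \<le> - (\<mu> * (p - x))" using that c order r0 by (intro p(3)) auto
      ultimately show ?thesis using mur by linarith
    qed
    then show ?thesis
      using order mu d1 d2 nonneg
      by (intro van_der_Corput_first_derivative[where \<phi>' = \<phi>' and \<phi>'' = \<phi>'']) auto
  qed (use small in simp)
  have right: "norm (integral {d..b} (\<lambda>x. cis (\<phi> x))) \<le> 4 / sqrt \<mu>"
  proof (cases "d = b")
    case False
    then have d: "d = p + r" by (auto simp: d_def min_def split: if_splits)
    have "sqrt \<mu> \<le> \<phi>' x" if "x \<in> {d..b}" for x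
    proof -
      have "\<mu> * r \<le> \<mu> * (x - p)" using that d mu by (intro mult_left_mono) auto
      moreover have "\<mu> * (x - p) \<le> \<phi>' x" using that d order r0 by (intro p(2)) auto
      ultimately show ?thesis using mur by linarith
    qed
    then show ?thesis
      using order mu d1 d2 nonneg
      by (intro van_der_Corput_first_derivative[where \<phi>' = \<phi>' and \<phi>'' = \<phi>'']) auto
  qed (use small in simp)
  have "norm (integral {c..d} (\<lambda>x. cis (\<phi> x))) \<le> d - c"
    using order by (intro norm_integral_cis_le continuous_on_subset[OF contphi]) auto
  also have "\<dots> \<le> 2 / sqrt \<mu>" using r0 by (auto simp: c_def d_def r_def)
  finally have "norm (integral {a..b} (\<lambda>x. cis (\<phi> x))) \<le> 4 / sqrt \<mu> + 2 / sqrt \<mu> + 4 / sqrt \<mu>"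
    using norm_integral_split3[OF order continuous_on_cis[OF contphi]] left right by linarith
  then show ?thesis by simp
qed

lemma van_der_Corput_second_derivative_neg:
  fixes \<phi> \<phi>' \<phi>'' :: "real \<Rightarrow> real"
  assumes ab: "a \<le> b" and mu: "\<mu> > 0"
    and d1: "\<And>x. x \<in> {a..b} \<Longrightarrow> (\<phi> has_real_derivative \<phi>' x) (at x)"
    and d2: "\<And>x. x \<in> {a..b} \<Longrightarrow> (\<phi>' has_real_derivative \<phi>'' x) (at x)"
    and big: "\<And>x. x \<in> {a..b} \<Longrightarrow> \<phi>'' x \<le> -\<mu>"
  shows "norm (integral {a..b} (\<lambda>x. cis (\<phi> x))) \<le> 10 / sqrt \<mu>"
proof -
  have "norm (integral {a..b} (\<lambda>x. cis (- \<phi> x))) \<le> 10 / sqrt \<mu>"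
    using ab mu d1 d2 big
    by (intro van_der_Corput_second_derivative[where \<phi>' = "\<lambda>x. - \<phi>' x" and \<phi>'' = "\<lambda>x. - \<phi>'' x"])
       (auto intro!: DERIV_minus simp: minus_le_iff[of \<mu>] le_minus_iff)
  also have "(\<lambda>x. cis (- \<phi> x)) = (\<lambda>x. cnj (cis (\<phi> x)))" by (simp add: cis_cnj)
  finally show ?thesis by (simp flip: integral_cnj)
qed

text \<open>The interval of radius \<open>\<nu> powr (-1/3)\<close> around \<open>p\<close> is cut out and estimated trivially.\<close>

lemma van_der_Corput_inflection:
  fixes \<phi> \<phi>' \<phi>'' :: "real \<Rightarrow> real"
  assumes p: "a \<le> p" "p \<le> b" and nu: "\<nu> > 0"
    and d1: "\<And>x. x \<in> {a..b} \<Longrightarrow> (\<phi> has_real_derivative \<phi>' x) (at x)"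
    and d2: "\<And>x. x \<in> {a..b} \<Longrightarrow> (\<phi>' has_real_derivative \<phi>'' x) (at x)"
    and left: "\<And>x. x \<in> {a..p} \<Longrightarrow> \<nu> * (p - x) \<le> \<phi>'' x"
    and right: "\<And>x. x \<in> {p..b} \<Longrightarrow> \<phi>'' x \<le> - (\<nu> * (x - p))"
  shows "norm (integral {a..b} (\<lambda>x. cis (\<phi> x))) \<le> 22 * \<nu> powr (-1/3)"
proof -
  define r where "r = \<nu> powr (-1/3)"
  have r0: "r > 0" using nu by (simp add: r_def)
  \<comment> \<open>The radius balances the two estimates: outside it
    \<open>\<bar>\<phi>'' x\<bar>\<close> is at least \<open>\<nu> * r\<close>, for which the
    second-derivative bound is \<open>10 * r\<close>, comparable with the length
    \<open>2 * r\<close> cut out.\<close>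
  have "\<nu> * r = \<nu> powr (1 + (-1/3))" unfolding powr_add r_def using nu by simp
  then have nur: "\<nu> * r = \<nu> powr (2/3)" by simp
  have "sqrt (\<nu> powr (2/3)) = \<nu> powr (1/3)" using nu by (simp add: powr_half_sqrt[symmetric] powr_powr)
  then have sq: "10 / sqrt (\<nu> powr (2/3)) = 10 * r" using nu by (simp add: r_def powr_minus field_simps)
  have contphi: "continuous_on {a..b} \<phi>" by (rule DERIV_atLeastAtMost_imp_continuous_on) (use d1 in auto)
  define c where "c = max a (p - r)"
  define d where "d = min b (p + r)"
  have order: "a \<le> c" "c \<le> d" "d \<le> b" using p r0 by (auto simp: c_def d_def)
  have L: "norm (integral {a..c} (\<lambda>x. cis (\<phi> x))) \<le> 10 * r"
  proof (cases "a = c")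
    case False
    then have c: "c = p - r" by (auto simp: c_def max_def split: if_splits)
    have "\<nu> powr (2/3) \<le> \<phi>'' x" if "x \<in> {a..c}" for x
    proof -
      have "\<nu> * r \<le> \<nu> * (p - x)" using that c nu by (intro mult_left_mono) auto
      moreover have "\<nu> * (p - x) \<le> \<phi>'' x" using that c r0 by (intro left) auto
      ultimately show ?thesis using nur by linarith
    qed
    then show ?thesis unfolding sq[symmetric] using order nu d1 d2
      by (intro van_der_Corput_second_derivative[where \<phi>' = \<phi>' and \<phi>'' = \<phi>'']) auto
  qed (use r0 in simp)
  have R: "norm (integral {d..b} (\<lambda>x. cis (\<phi> x))) \<le> 10 * r"
  proof (cases "d = b")
    case False
    then have d: "d = p + r" by (auto simp: d_def min_def split: if_splits)
    have "\<phi>'' x \<le> - (\<nu> powr (2/3))" if "x \<in> {d..b}" for x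
    proof -
      have "\<nu> * r \<le> \<nu> * (x - p)" using that d nu by (intro mult_left_mono) auto
      moreover have "\<phi>'' x \<le> - (\<nu> * (x - p))" using that d r0 by (intro right) auto
      ultimately show ?thesis using nur by linarith
    qed
    then show ?thesis unfolding sq[symmetric] using order nu d1 d2
      by (intro van_der_Corput_second_derivative_neg[where \<phi>' = \<phi>' and \<phi>'' = \<phi>'']) auto
  qed (use r0 in simp)
  have "norm (integral {c..d} (\<lambda>x. cis (\<phi> x))) \<le> d - c"
    using order by (intro norm_integral_cis_le continuous_on_subset[OF contphi]) auto
  also have "\<dots> \<le> 2 * r" using r0 by (auto simp: c_def d_def)
  finally have "norm (integral {a..b} (\<lambda>x. cis (\<phi> x))) \<le> 10 * r + 2 * r + 10 * r"
    using norm_integral_split3[OF order continuous_on_cis[OF contphi]] L R by linarith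
  then show ?thesis by (simp add: r_def)
qed

section \<open>The dispersion relation and its inflection point\<close>

lemma kg_frequency_ge_1: "1 \<le> kg_frequency k"
  by (simp add: kg_frequency_eq)

lemma kg_frequency_bounds: "0 < kg_frequency k" "kg_frequency k \<noteq> 0" "kg_frequency k \<le> 3"
    "(kg_frequency k)\<^sup>2 = 3 - 2 * cos k"
proof -
  show "0 < kg_frequency k" "kg_frequency k \<noteq> 0" using kg_frequency_ge_1[of k] by auto
  have c: "-1 \<le> cos k" "cos k \<le> 1" by auto
  have "0 \<le> 3 - 2 * cos k" using c(2) by linarith
  then show "(kg_frequency k)\<^sup>2 = 3 - 2 * cos k" by (simp add: kg_frequency_eq)
  show "kg_frequency k \<le> 3"
  proof -
    have "3 - 2 * cos k \<le> 9" using c(1) by linarith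
    then show ?thesis unfolding kg_frequency_eq by (intro real_le_lsqrt) auto
  qed
qed

lemma continuous_on_kg_frequency [continuous_intros]:
  fixes f :: "'a::t2_space \<Rightarrow> real"
  shows "continuous_on S f \<Longrightarrow> continuous_on S (\<lambda>x. kg_frequency (f x))"
  unfolding kg_frequency_eq by (intro continuous_intros) auto

lemma kg_frequency_deriv:
  "(kg_frequency has_real_derivative sin k / kg_frequency k) (at k)"
proof -
  have "3 - 2 * cos k > 0" using cos_le_one[of k] by linarith
  then have "((\<lambda>k. sqrt (3 - 2 * cos k)) has_real_derivative
     sin k / sqrt (3 - 2 * cos k)) (at k)"
    by (auto intro!: derivative_eq_intros simp: field_simps)
  then show ?thesis by (simp add: kg_frequency_eq[abs_def])
qed

lemma kg_frequency_deriv2: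
  "((\<lambda>k. sin k / kg_frequency k) has_real_derivative
     (3 * cos k - 1 - (cos k)\<^sup>2) / kg_frequency k ^ 3) (at k)"
proof -
  have w: "kg_frequency k \<noteq> 0" "(kg_frequency k)\<^sup>2 = 3 - 2 * cos k" by (rule kg_frequency_bounds)+
  have "((\<lambda>k. sin k / kg_frequency k) has_real_derivative
     (cos k * kg_frequency k - sin k * (sin k / kg_frequency k)) / (kg_frequency k * kg_frequency k)) (at k)"
    by (intro DERIV_divide DERIV_sin kg_frequency_deriv w)
  also have "(cos k * kg_frequency k - sin k * (sin k / kg_frequency k)) / (kg_frequency k * kg_frequency k)
     = (cos k * (kg_frequency k)\<^sup>2 - (sin k)\<^sup>2) / kg_frequency k ^ 3"
    using w(1) by (simp add: field_simps power2_eq_square power3_eq_cube)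
  also have "cos k * (kg_frequency k)\<^sup>2 - (sin k)\<^sup>2 = 3 * cos k - 1 - (cos k)\<^sup>2"
    unfolding w(2) sin_squared_eq by (simp add: algebra_simps power2_eq_square)
  finally show ?thesis .
qed

lemma sin_ge_quarter:
  assumes "0 \<le> y" "y \<le> pi/2"
  shows "y / 4 \<le> sin y"
proof (cases "y \<le> pi/3")
  case True
  show ?thesis
  proof (cases "y = 0")
    case False
    then have "\<exists>z>0. z < y \<and> sin y - sin 0 = (y - 0) * cos z"
      using assms by (intro MVT2) (auto intro!: derivative_eq_intros)
    then obtain z where z: "z > 0" "z < y" "sin y = y * cos z" by auto
    have "1/2 \<le> cos z"
      using cos_monotone_0_pi_le[of z "pi/3"] z True by (simp add: cos_60)
    then have "y * (1/2) \<le> sin y" unfolding z(3) using assms by (intro mult_left_mono) auto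
    then show ?thesis using assms by simp
  qed simp
next
  case False
  have "1/2 \<le> sin y"
    using sin_monotone_2pi_le[of "pi/6" y] False assms by (simp add: sin_30)
  then show ?thesis using assms pi_less_4 by simp
qed

lemma sin_ge_half:
  assumes "pi/6 \<le> x" "x \<le> 5*pi/6"
  shows "1/2 \<le> sin x"
proof (cases "x \<le> pi/2")
  case True
  then show ?thesis using sin_monotone_2pi_le[of "pi/6" x] assms by (simp add: sin_30)
next
  case False
  then have "sin (pi/6) \<le> sin (pi - x)" using assms by (intro sin_monotone_2pi_le) auto
  then show ?thesis by (simp add: sin_30)
qed

text \<open>Product formula for a difference of cosines. The bounds on \<open>x + y\<close> hold
  when one of the points is the inflection point and the other lies in [0, \<pi>]; they keep the
  midpoint in [\<pi>/6, 5\<pi>/6], where the sine is at least 1/2, so that only the half-difference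
  can make the product small.\<close>

lemma cos_diff_ge:
  assumes "0 \<le> x" "x \<le> y" "y \<le> pi" "pi/3 \<le> x + y" "x + y \<le> 3*pi/2"
  shows "(y - x) / 8 \<le> cos x - cos y"
proof -
  have "1/2 * ((y - x) / 2 / 4) \<le> sin ((x + y) / 2) * sin ((y - x) / 2)"
    using assms by (intro mult_mono sin_ge_half sin_ge_quarter) (auto intro!: sin_ge_zero)
  then show ?thesis unfolding cos_diff_cos by simp
qed

text \<open>The cosine of the inflection point is the root in \<open>[-1, 1]\<close> of \<open>3 * c - 1 - c\<^sup>2\<close>, the numerator
  of \<open>\<omega>''\<close>.\<close>

definition kg_inflection :: real where
  "kg_inflection = arccos ((3 - sqrt 5) / 2)"

lemma kg_inflection:
  shows "pi/3 \<le> kg_inflection" "kg_inflection \<le> pi/2" "cos kg_inflection = (3 - sqrt 5) / 2"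
proof -
  have s: "2 \<le> sqrt (5::real)" "sqrt (5::real) \<le> 3"
    by (auto intro: real_le_rsqrt real_le_lsqrt)
  have r: "0 \<le> (3 - sqrt 5) / 2" "(3 - sqrt 5) / 2 \<le> 1/2" using s by auto
  show "cos kg_inflection = (3 - sqrt 5) / 2" unfolding kg_inflection_def
    using r by (intro cos_arccos) linarith+
  show "kg_inflection \<le> pi/2" unfolding kg_inflection_def
    using arccos_le_pi2[OF r(1)] r by linarith
  have "arccos (cos (pi/3)) \<le> kg_inflection"
    unfolding kg_inflection_def cos_60 using r by (intro arccos_le_arccos) auto
  then show "pi/3 \<le> kg_inflection" by (simp add: arccos_cos)
qed

text \<open>The numerator of \<open>\<omega>''\<close> factors as
  \<open>(cos k - c0) * (3 - c0 - cos k)\<close>, \<open>c0\<close> being the cosine of the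
  inflection point, and the second factor is at least 1. Hence \<open>\<omega>''\<close> leaves zero
  at a linear rate; 216 = 8 * 27, with 8 from the difference of cosines and 27 from
  \<open>\<omega> \<le> 3\<close>.\<close>

lemma kg_frequency_deriv2_bounds:
  assumes "0 \<le> k" "k \<le> pi"
  shows "k \<le> kg_inflection \<Longrightarrow>
      (kg_inflection - k) / 216 \<le> (3 * cos k - 1 - (cos k)\<^sup>2) / kg_frequency k ^ 3"
    and "kg_inflection \<le> k \<Longrightarrow>
      (3 * cos k - 1 - (cos k)\<^sup>2) / kg_frequency k ^ 3 \<le> - ((k - kg_inflection) / 216)"
proof -
  define c0 :: real where "c0 = (3 - sqrt 5) / 2"
  have c0: "3 * c0 - 1 - c0\<^sup>2 = 0"
    by (simp add: c0_def power2_eq_square field_simps)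
  have "2 \<le> sqrt (5::real)" by (auto intro: real_le_rsqrt)
  then have c1: "c0 \<le> 1" by (simp add: c0_def)
  have fac: "3 * cos k - 1 - (cos k)\<^sup>2 = (cos k - c0) * (3 - c0 - cos k)"
    using c0 by (simp add: algebra_simps power2_eq_square)
  have ge1: "1 \<le> 3 - c0 - cos k" using c1 cos_le_one[of k] by linarith
  have w: "0 < kg_frequency k" "kg_frequency k \<le> 3" by (rule kg_frequency_bounds)+
  then have w3: "0 < kg_frequency k ^ 3" "kg_frequency k ^ 3 \<le> 27"
    using power_mono[of "kg_frequency k" 3 3] by auto
  have cos0: "cos kg_inflection = c0" by (simp add: kg_inflection c0_def)
  have lower: "(y / 8) / 27 \<le> (x * (3 - c0 - cos k)) / kg_frequency k ^ 3"
    if "y / 8 \<le> x" "0 \<le> y" for x y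
  proof (rule frac_le)
    have "x * 1 \<le> x * (3 - c0 - cos k)" using that ge1 by (intro mult_left_mono) auto
    then show "y / 8 \<le> x * (3 - c0 - cos k)" using that by linarith
    show "0 \<le> x * (3 - c0 - cos k)" using that ge1 by auto
  qed (use w3 in auto)
  show "(kg_inflection - k) / 216 \<le> (3 * cos k - 1 - (cos k)\<^sup>2) / kg_frequency k ^ 3"
    if "k \<le> kg_inflection"
    using lower[of "kg_inflection - k" "cos k - c0"] cos_diff_ge[of k kg_inflection] that assms kg_inflection
    by (simp add: fac cos0)
  show "(3 * cos k - 1 - (cos k)\<^sup>2) / kg_frequency k ^ 3 \<le> - ((k - kg_inflection) / 216)"
    if "kg_inflection \<le> k"
  proof -
    have "(k - kg_inflection) / 8 / 27 \<le> ((c0 - cos k) * (3 - c0 - cos k)) / kg_frequency k ^ 3"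
      using cos_diff_ge[of kg_inflection k] that assms kg_inflection
      by (intro lower) (auto simp: cos0)
    moreover have "(c0 - cos k) * (3 - c0 - cos k) = - (3 * cos k - 1 - (cos k)\<^sup>2)"
      unfolding fac by (simp add: algebra_simps)
    ultimately have "(k - kg_inflection) / 216 \<le> - ((3 * cos k - 1 - (cos k)\<^sup>2) / kg_frequency k ^ 3)"
      by (simp only: minus_divide_left)
    then show ?thesis by linarith
  qed
qed

text \<open>The linear term \<open>x * k\<close> disappears from the second derivative, so the bound
  is uniform in \<open>x\<close>. This is what will allow the site to change from one time to the
  next.\<close>

lemma kg_half_period_decay:
  assumes "t > 0"
  shows "norm (integral {0..pi} (\<lambda>k. cis (t * kg_frequency k + x * k))) \<le> 22 * (t / 216) powr (-1/3)"
proof (rule van_der_Corput_inflection[where p = kg_inflection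
      and \<phi>' = "\<lambda>k. t * (sin k / kg_frequency k) + x"
      and \<phi>'' = "\<lambda>k. t * ((3 * cos k - 1 - (cos k)\<^sup>2) / kg_frequency k ^ 3)"])
  show "0 \<le> kg_inflection" "kg_inflection \<le> pi"
    using kg_inflection(1,2) pi_gt_zero by linarith+
  show "t / 216 * (kg_inflection - k) \<le> t * ((3 * cos k - 1 - (cos k)\<^sup>2) / kg_frequency k ^ 3)"
    if "k \<in> {0..kg_inflection}" for k
  proof -
    have "t * ((kg_inflection - k) / 216) \<le> t * ((3 * cos k - 1 - (cos k)\<^sup>2) / kg_frequency k ^ 3)"
      using that assms \<open>kg_inflection \<le> pi\<close>
      by (intro mult_left_mono kg_frequency_deriv2_bounds) auto
    then show ?thesis by simp
  qed
  show "t * ((3 * cos k - 1 - (cos k)\<^sup>2) / kg_frequency k ^ 3) \<le> - (t / 216 * (k - kg_inflection))"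
    if "k \<in> {kg_inflection..pi}" for k
  proof -
    have "t * ((3 * cos k - 1 - (cos k)\<^sup>2) / kg_frequency k ^ 3) \<le> t * (- ((k - kg_inflection) / 216))"
      using that assms \<open>0 \<le> kg_inflection\<close>
      by (intro mult_left_mono kg_frequency_deriv2_bounds) auto
    then show ?thesis by simp
  qed
  show "((\<lambda>k. t * kg_frequency k + x * k) has_real_derivative t * (sin k / kg_frequency k) + x) (at k)" for k
    using DERIV_add[OF DERIV_cmult[OF kg_frequency_deriv, of t k] DERIV_cmult[OF DERIV_ident, of x]] by simp
  show "((\<lambda>k. t * (sin k / kg_frequency k) + x) has_real_derivative
      t * ((3 * cos k - 1 - (cos k)\<^sup>2) / kg_frequency k ^ 3)) (at k)" for k
    using DERIV_add[OF DERIV_cmult[OF kg_frequency_deriv2, of t k] DERIV_const[of x]] by simp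
qed (use assms in simp)

lemma kg_full_period_decay:
  assumes "t > 0"
  shows "norm (integral {-pi..pi} (\<lambda>k. cis (t * kg_frequency k + x * k))) \<le> 44 * (t / 216) powr (-1/3)"
proof -
  define f where "f k = cis (t * kg_frequency k + x * k)" for k
  have cont: "continuous_on S f" for S unfolding f_def by (intro continuous_intros)
  have "integral {-pi..pi} f = integral {-pi..0} f + integral {0..pi} f"
    using cont by (intro Henstock_Kurzweil_Integration.integral_combine[symmetric] integrable_continuous_real) auto
  also have "integral {-pi..0} f = integral {0..pi} (\<lambda>k. f (- k))"
    using Henstock_Kurzweil_Integration.integral_reflect_real[of pi 0 "\<lambda>k. f (- k)"] by simp
  also have "(\<lambda>k. f (- k)) = (\<lambda>k. cis (t * kg_frequency k + (- x) * k))"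
    by (simp add: f_def kg_frequency_eq)
  finally show ?thesis
    using kg_half_period_decay[OF assms, of x] kg_half_period_decay[OF assms, of "-x"]
      norm_triangle_ineq[of "integral {0..pi} (\<lambda>k. cis (t * kg_frequency k + (- x) * k))" "integral {0..pi} f"]
    by (simp add: f_def[abs_def])
qed

lemma kg_dispersive_decay:
  "norm (integral {-pi..pi} (\<lambda>k. cis (t * kg_frequency k + x * k)))
     \<le> 400 * (1 + \<bar>t\<bar>) powr (-1/3)"
proof -
  have pos: "norm (integral {-pi..pi} (\<lambda>k. cis (t * kg_frequency k + x * k)))
     \<le> 400 * (1 + \<bar>t\<bar>) powr (-1/3)" if "t \<ge> 0" for t x
  proof (cases "t \<ge> 1")
    case True
    \<comment> \<open>For \<open>t \<ge> 1\<close> one has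
      \<open>t / 216 \<ge> (1 + t) / 512\<close>, and 512 = 8^3 turns the constant into 44 * 8 =
      352.\<close>
    have "44 * (t / 216) powr (-1/3) \<le> 44 * ((1 + t) / (8 powr 3)) powr (-1/3)"
      using True by (intro mult_left_mono powr_mono2') auto
    also have "\<dots> = 44 * ((1 + t) powr (-1/3) / 8 powr (-1))"
      using that by (simp only: powr_divide powr_powr) simp
    also have "\<dots> \<le> 400 * (1 + \<bar>t\<bar>) powr (-1/3)" using that by (simp add: powr_minus)
    finally show ?thesis using kg_full_period_decay[of t x] True by simp
  next
    case False
    have "norm (integral {-pi..pi} (\<lambda>k. cis (t * kg_frequency k + x * k))) \<le> pi - - pi"
      by (intro norm_integral_cis_le continuous_intros) auto
    also have "\<dots> \<le> 8" using pi_less_4 by simp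
    also have "\<dots> \<le> 400 * 2 powr (-1)" by (simp add: powr_minus)
    also have "\<dots> \<le> 400 * 2 powr (-1/3)" by (intro mult_left_mono powr_mono) auto
    also have "\<dots> \<le> 400 * (1 + \<bar>t\<bar>) powr (-1/3)"
      using False that by (intro mult_left_mono powr_mono2') auto
    finally show ?thesis .
  qed
  show ?thesis
  proof (cases "t \<ge> 0")
    case False
    have "(\<lambda>k. cis (t * kg_frequency k + x * k)) = (\<lambda>k. cnj (cis ((-t) * kg_frequency k + (-x) * k)))"
      by (simp add: cis_cnj fun_eq_iff add.commute)
    then show ?thesis using pos[of "-t" "-x"] False by (simp flip: integral_cnj)
  qed (rule pos)
qed

section \<open>The Hilbert space of square-summable sequences\<close>

text \<open>Made a type so that it can carry a Banach space instance; integrals of curves in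
  \<open>l\<^sup>2\<close>, bounded continuous curves and the fixed point theorem are then at hand.
  Its inner product will be the real one, that is, the real part of the Hermitian product.\<close>

typedef ell2 = "{f :: int \<Rightarrow> complex. (\<lambda>n. (cmod (f n))\<^sup>2) summable_on UNIV}"
  morphisms coord Abs_ell2
  by (rule exI[of _ "\<lambda>_. 0"]) simp

setup_lifting type_definition_ell2

lemma cmod_add_square_le: "(cmod (x + y))\<^sup>2 \<le> 2 * (cmod x)\<^sup>2 + 2 * (cmod y)\<^sup>2"
proof -
  have "(cmod (x + y))\<^sup>2 \<le> (cmod x + cmod y)\<^sup>2"
    by (intro power_mono norm_triangle_ineq) auto
  also have "\<dots> \<le> 2 * (cmod x)\<^sup>2 + 2 * (cmod y)\<^sup>2"
    using sum_squares_bound[of "cmod x" "cmod y"] by (simp add: power2_sum)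
  finally show ?thesis .
qed

lemma square_summable_add:
  assumes "(\<lambda>n. (cmod (f n))\<^sup>2) summable_on A" "(\<lambda>n. (cmod (g n))\<^sup>2) summable_on A"
  shows "(\<lambda>n. (cmod (f n + g n))\<^sup>2) summable_on A"
  by (rule summable_on_comparison_test[where f = "\<lambda>n. 2 * (cmod (f n))\<^sup>2 + 2 * (cmod (g n))\<^sup>2"])
     (use assms in \<open>auto intro!: summable_on_add summable_on_cmult_right cmod_add_square_le\<close>)

lemma summable_on_inner_of_square_summable:
  fixes f g :: "'a \<Rightarrow> complex"
  assumes "(\<lambda>n. (cmod (f n))\<^sup>2) summable_on A" "(\<lambda>n. (cmod (g n))\<^sup>2) summable_on A"
  shows "(\<lambda>n. f n \<bullet> g n) summable_on A"
proof -
  have "(\<lambda>n. \<bar>f n \<bullet> g n\<bar>) summable_on A"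
  proof (rule summable_on_comparison_test[where f = "\<lambda>n. (cmod (f n))\<^sup>2 + (cmod (g n))\<^sup>2"])
    fix n
    have "\<bar>f n \<bullet> g n\<bar> \<le> cmod (f n) * cmod (g n)" by (rule Cauchy_Schwarz_ineq2)
    then show "\<bar>f n \<bullet> g n\<bar> \<le> (cmod (f n))\<^sup>2 + (cmod (g n))\<^sup>2"
      using sum_squares_bound[of "cmod (f n)" "cmod (g n)"] mult_nonneg_nonneg[of "cmod (f n)" "cmod (g n)"]
      by simp
  qed (use assms in \<open>auto intro: summable_on_add\<close>)
  then show ?thesis
    by (subst summable_on_iff_abs_summable_on_real) (simp only: real_norm_def)
qed

instantiation ell2 :: real_vector
begin

lift_definition zero_ell2 :: ell2 is "\<lambda>_. 0" by simp
lift_definition plus_ell2 :: "ell2 \<Rightarrow> ell2 \<Rightarrow> ell2" is "\<lambda>f g n. f n + g n" by (rule square_summable_add)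
lift_definition uminus_ell2 :: "ell2 \<Rightarrow> ell2" is "\<lambda>f n. - f n" by simp
lift_definition minus_ell2 :: "ell2 \<Rightarrow> ell2 \<Rightarrow> ell2" is "\<lambda>f g n. f n - g n"
  subgoal for f g using square_summable_add[of f UNIV "\<lambda>n. - g n"] by simp
  done
lift_definition scaleR_ell2 :: "real \<Rightarrow> ell2 \<Rightarrow> ell2" is "\<lambda>c f n. c *\<^sub>R f n"
  by (auto simp: power_mult_distrib intro: summable_on_cmult_right)

instance by standard (transfer; simp add: fun_eq_iff algebra_simps)+

end

instantiation ell2 :: real_inner
begin

lift_definition inner_ell2 :: "ell2 \<Rightarrow> ell2 \<Rightarrow> real" is "\<lambda>f g. \<Sum>\<^sub>\<infinity>n. f n \<bullet> g n" .

definition "norm (f :: ell2) = sqrt (f \<bullet> f)"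
definition "sgn (f :: ell2) = f /\<^sub>R norm f"
definition "dist (f :: ell2) g = norm (f - g)"
definition "(uniformity :: (ell2 \<times> ell2) filter) = (INF e\<in>{0<..}. principal {(x, y). dist x y < e})"
definition "open (U :: ell2 set) \<longleftrightarrow> (\<forall>x\<in>U. eventually (\<lambda>(x', y). x' = x \<longrightarrow> y \<in> U) uniformity)"

instance
proof
  fix x y z :: ell2 and r :: real
  show "x \<bullet> y = y \<bullet> x" by transfer (simp add: inner_commute)
  show "(x + y) \<bullet> z = x \<bullet> z + y \<bullet> z"
    by transfer (simp add: inner_add_left infsum_add summable_on_inner_of_square_summable)
  show "(r *\<^sub>R x) \<bullet> y = r * (x \<bullet> y)"
    by transfer (simp add: infsum_cmult_right')
  show "0 \<le> x \<bullet> x" by transfer (auto intro: infsum_nonneg)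
  show "x \<bullet> x = 0 \<longleftrightarrow> x = 0"
  proof transfer
    fix f :: "int \<Rightarrow> complex" assume f: "(\<lambda>n. (cmod (f n))\<^sup>2) summable_on UNIV"
    have "(\<lambda>n. f n \<bullet> f n) summable_on UNIV"
      using f by (intro summable_on_inner_of_square_summable) auto
    then have "(\<Sum>\<^sub>\<infinity>n. f n \<bullet> f n) = 0 \<longrightarrow> f n = 0" for n
      using nonneg_infsum_le_0D[of "\<lambda>n. f n \<bullet> f n" UNIV n] by auto
    moreover have "(\<Sum>\<^sub>\<infinity>n. f n \<bullet> f n) = 0" if "f = (\<lambda>_. 0)" using that by simp
    ultimately show "((\<Sum>\<^sub>\<infinity>n. f n \<bullet> f n) = 0) = (f = (\<lambda>_. 0))" by blast
  qed
qed (rule norm_ell2_def sgn_ell2_def dist_ell2_def uniformity_ell2_def open_ell2_def)+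

end

lemma coord_simps [simp]:
  "coord 0 n = 0" "coord (f + g) n = coord f n + coord g n" "coord (f - g) n = coord f n - coord g n"
  "coord (- f) n = - coord f n" "coord (c *\<^sub>R f) n = c *\<^sub>R coord f n"
  by (transfer; simp)+

lemma ell2_eqI: "(\<And>n. coord f n = coord g n) \<Longrightarrow> f = g"
  by (transfer; auto)

lemma coord_square_has_sum: "((\<lambda>n. (cmod (coord f n))\<^sup>2) has_sum (norm f)\<^sup>2) UNIV"
proof -
  have "(\<lambda>n. (cmod (coord f n))\<^sup>2) summable_on UNIV" using coord[of f] by simp
  then have "((\<lambda>n. (cmod (coord f n))\<^sup>2) has_sum (\<Sum>\<^sub>\<infinity>n. (cmod (coord f n))\<^sup>2)) UNIV" by simp
  also have "(\<Sum>\<^sub>\<infinity>n. (cmod (coord f n))\<^sup>2) = (norm f)\<^sup>2"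
    by (simp only: power2_norm_eq_inner inner_ell2.rep_eq)
  finally show ?thesis .
qed

lemma sum_coord_square_le: "finite F \<Longrightarrow> (\<Sum>n\<in>F. (cmod (coord f n))\<^sup>2) \<le> (norm f)\<^sup>2"
  by (rule finite_sum_le_has_sum[OF coord_square_has_sum]) auto

lemma norm_coord_le: "cmod (coord f n) \<le> norm f"
  using sum_coord_square_le[of "{n}" f] by (simp add: power2_le_iff_abs_le)

text \<open>The common entrance to \<open>ell2\<close>: limits, multipliers, the nonlinearity and
  data with a bounded \<open>lp_norm\<close> are all recognised as elements through a bound on
  finite sections.\<close>

lemma ell2_of_bounded_sums:
  assumes "\<And>F. finite F \<Longrightarrow> (\<Sum>n\<in>F. (cmod (f n))\<^sup>2) \<le> B\<^sup>2" "0 \<le> B"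
  obtains g where "coord g = f" "norm g \<le> B"
proof -
  have s: "(\<lambda>n. (cmod (f n))\<^sup>2) summable_on UNIV"
    by (rule nonneg_bdd_above_summable_on) (use assms(1) in \<open>auto intro!: bdd_aboveI\<close>)
  define g where "g = Abs_ell2 f"
  have g: "coord g = f" using s by (simp add: g_def Abs_ell2_inverse)
  have "(norm g)\<^sup>2 \<le> B\<^sup>2"
    using coord_square_has_sum[of g] unfolding g by (rule has_sum_le_finite_sums) (use assms in auto)
  then show ?thesis using g assms(2) that power2_le_imp_le by blast
qed

lemma bounded_linear_coord: "bounded_linear (\<lambda>f. coord f n)"
  by (rule bounded_linear_intro[where K = 1]) (simp_all add: norm_coord_le)

lemmas continuous_on_coord [continuous_intros] = bounded_linear.continuous_on[OF bounded_linear_coord]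

text \<open>The coordinatewise limit \<open>f\<close> is not bounded directly but compared with
  \<open>X i\<close>: the Cauchy bound holds on each finite section of \<open>X i - X j\<close> and
  survives the limit in \<open>j\<close>. This yields at once the square summability of
  \<open>X i - f\<close>, hence of \<open>f\<close>, and the convergence.\<close>

instance ell2 :: banach
proof
  fix X :: "nat \<Rightarrow> ell2" assume X: "Cauchy X"
  have "convergent (\<lambda>i. coord (X i) n)" for n
    by (intro Cauchy_convergent bounded_linear.Cauchy[OF bounded_linear_coord] X)
  then obtain f where f: "\<And>n. (\<lambda>i. coord (X i) n) \<longlonglongrightarrow> f n"
    unfolding convergent_def by metis
  have approx: "\<exists>N. \<forall>i\<ge>N. \<exists>g. coord g = (\<lambda>n. coord (X i) n - f n) \<and> norm g \<le> e" if "e > 0" for e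
  proof -
    obtain N where N: "\<And>i j. i \<ge> N \<Longrightarrow> j \<ge> N \<Longrightarrow> norm (X i - X j) < e"
      using CauchyD[OF X \<open>e > 0\<close>] by blast
    have "\<exists>g. coord g = (\<lambda>n. coord (X i) n - f n) \<and> norm g \<le> e" if "i \<ge> N" for i
    proof -
      have "(\<Sum>n\<in>F. (cmod (coord (X i) n - f n))\<^sup>2) \<le> e\<^sup>2" if F: "finite F" for F
      proof (rule tendsto_upperbound)
        show "(\<lambda>j. \<Sum>n\<in>F. (cmod (coord (X i) n - coord (X j) n))\<^sup>2)
            \<longlonglongrightarrow> (\<Sum>n\<in>F. (cmod (coord (X i) n - f n))\<^sup>2)"
          by (intro tendsto_intros f)
        show "\<forall>\<^sub>F j in sequentially. (\<Sum>n\<in>F. (cmod (coord (X i) n - coord (X j) n))\<^sup>2) \<le> e\<^sup>2"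
        proof (rule eventually_sequentiallyI[of N])
          fix j assume "N \<le> j"
          have "(\<Sum>n\<in>F. (cmod (coord (X i) n - coord (X j) n))\<^sup>2) \<le> (norm (X i - X j))\<^sup>2"
            using sum_coord_square_le[OF F, of "X i - X j"] by simp
          also have "\<dots> \<le> e\<^sup>2" using N[OF \<open>i \<ge> N\<close> \<open>N \<le> j\<close>] by (intro power_mono) auto
          finally show "(\<Sum>n\<in>F. (cmod (coord (X i) n - coord (X j) n))\<^sup>2) \<le> e\<^sup>2" .
        qed
      qed simp
      then show ?thesis using \<open>e > 0\<close> by (elim ell2_of_bounded_sums[where B = e]) auto
    qed
    then show ?thesis by blast
  qed
  obtain i g where g: "coord g = (\<lambda>n. coord (X i) n - f n)" using approx[of 1] by auto
  define L where "L = X i - g"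
  have L: "coord L n = f n" for n by (simp add: L_def g)
  have "X \<longlonglongrightarrow> L"
  proof (rule LIMSEQ_I)
    fix e :: real assume "e > 0"
    then obtain N where N: "\<And>i. i \<ge> N \<Longrightarrow> \<exists>g. coord g = (\<lambda>n. coord (X i) n - f n) \<and> norm g \<le> e/2"
      using approx[of "e/2"] by auto
    have "norm (X i - L) < e" if i: "i \<ge> N" for i
    proof -
      obtain g where g: "coord g = (\<lambda>n. coord (X i) n - f n)" "norm g \<le> e/2" using N[OF i] by auto
      have "X i - L = g" by (rule ell2_eqI) (simp add: g L)
      then show ?thesis using g \<open>e > 0\<close> by simp
    qed
    then show "\<exists>N. \<forall>i\<ge>N. norm (X i - L) < e" by blast
  qed
  then show "convergent X" by (auto simp: convergent_def)
qed

section \<open>The sup norm on square-summable sequences\<close>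

definition sup_norm :: "ell2 \<Rightarrow> real" where
  "sup_norm f = (SUP n. cmod (coord f n))"

lemma bdd_above_coord: "bdd_above (range (\<lambda>n. cmod (coord f n)))"
  by (rule bdd_aboveI[of _ "norm f"]) (auto simp: norm_coord_le)

lemma norm_coord_le_sup_norm: "cmod (coord f n) \<le> sup_norm f"
  unfolding sup_norm_def by (rule cSUP_upper[OF _ bdd_above_coord]) simp

lemma sup_norm_le: "(\<And>n. cmod (coord f n) \<le> B) \<Longrightarrow> sup_norm f \<le> B"
  unfolding sup_norm_def by (rule cSUP_least) auto

lemma sup_norm_nonneg [simp]: "0 \<le> sup_norm f"
  by (rule order_trans[OF norm_ge_zero norm_coord_le_sup_norm[of f 0]])

text \<open>The embedding of \<open>l\<^sup>2\<close> into \<open>l\<^sup>\<infinity>\<close>, a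
  feature of the lattice; through it a time integral of the sixth power of the sup norm controls
  every higher power.\<close>

lemma sup_norm_le_norm: "sup_norm f \<le> norm f"
  by (rule sup_norm_le) (rule norm_coord_le)

lemma sup_norm_approx: "c < sup_norm f \<Longrightarrow> \<exists>n. c < cmod (coord f n)"
  unfolding sup_norm_def using less_cSUP_iff[OF _ bdd_above_coord, of c f] by auto

lemma sup_norm_triangle: "sup_norm f \<le> sup_norm g + norm (f - g)"
proof (rule sup_norm_le)
  fix n
  have "cmod (coord f n) \<le> cmod (coord g n) + cmod (coord (f - g) n)"
    using norm_triangle_ineq[of "coord g n" "coord f n - coord g n"] by simp
  then show "cmod (coord f n) \<le> sup_norm g + norm (f - g)"
    using norm_coord_le_sup_norm[of g n] norm_coord_le[of "f - g" n] by linarith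
qed

lemma sup_norm_lipschitz: "\<bar>sup_norm f - sup_norm g\<bar> \<le> norm (f - g)"
  using sup_norm_triangle[of f g] sup_norm_triangle[of g f] by (simp add: norm_minus_commute)

lemma continuous_on_sup_norm [continuous_intros]:
  assumes "continuous_on S u"
  shows "continuous_on S (\<lambda>t. sup_norm (u t))"
proof -
  have "continuous_on UNIV sup_norm"
    unfolding continuous_on_iff dist_norm real_norm_def
    by (blast intro: le_less_trans[OF sup_norm_lipschitz])
  then show ?thesis using assms by (rule continuous_on_compose2) auto
qed

section \<open>Fourier integrals over a period\<close>

text \<open>Normalised so that the plane waves are orthonormal.\<close>

definition L2_norm_period :: "(real \<Rightarrow> complex) \<Rightarrow> real" where
  "L2_norm_period F = sqrt (integral {-pi..pi} (\<lambda>k. (cmod (F k))\<^sup>2) / (2 * pi))"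

lemma L2_norm_period_nonneg [simp]: "0 \<le> L2_norm_period F"
proof -
  have "0 \<le> integral {-pi..pi} (\<lambda>k. (cmod (F k))\<^sup>2)"
    by (cases "(\<lambda>k. (cmod (F k))\<^sup>2) integrable_on {-pi..pi}")
       (auto intro: Henstock_Kurzweil_Integration.integral_nonneg simp: not_integrable_integral)
  then show ?thesis by (simp add: L2_norm_period_def)
qed

lemma L2_norm_period_power2:
  assumes "continuous_on {-pi..pi} F"
  shows "(L2_norm_period F)\<^sup>2 = integral {-pi..pi} (\<lambda>k. (cmod (F k))\<^sup>2) / (2 * pi)"
  unfolding L2_norm_period_def
  by (intro real_sqrt_pow2 divide_nonneg_pos Henstock_Kurzweil_Integration.integral_nonneg
      integrable_continuous_real continuous_intros assms) auto

lemma Cauchy_Schwarz_period: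
  assumes F: "continuous_on {-pi..pi} F" and G: "continuous_on {-pi..pi} G"
  shows "cmod (integral {-pi..pi} (\<lambda>k. F k * G k)) / (2 * pi) \<le> L2_norm_period F * L2_norm_period G"
proof -
  define I where "I f = integral {-pi..pi} f / (2 * pi)" for f :: "real \<Rightarrow> real"
  define a where "a = I (\<lambda>k. (cmod (F k))\<^sup>2)"
  define b where "b = I (\<lambda>k. (cmod (G k))\<^sup>2)"
  define c where "c = I (\<lambda>k. cmod (F k) * cmod (G k))"
  have a: "a = (L2_norm_period F)\<^sup>2" and b: "b = (L2_norm_period G)\<^sup>2"
    using F G by (simp_all add: a_def b_def I_def L2_norm_period_power2)
  have int: "(\<lambda>k. cmod (F k) * cmod (G k)) integrable_on {-pi..pi}"
    "(\<lambda>k. (cmod (F k))\<^sup>2) integrable_on {-pi..pi}" "(\<lambda>k. (cmod (G k))\<^sup>2) integrable_on {-pi..pi}"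
    by (intro integrable_continuous_real continuous_intros F G)+
  have c0: "0 \<le> c"
    unfolding c_def I_def
    by (intro divide_nonneg_pos Henstock_Kurzweil_Integration.integral_nonneg int) auto
  have quad: "0 \<le> a * s\<^sup>2 - 2 * c * s + b" for s
  proof -
    have "0 \<le> I (\<lambda>k. s\<^sup>2 * (cmod (F k))\<^sup>2 - 2 * s * (cmod (F k) * cmod (G k)) + (cmod (G k))\<^sup>2)"
      unfolding I_def
    proof (intro divide_nonneg_pos Henstock_Kurzweil_Integration.integral_nonneg)
      fix k
      have "0 \<le> (s * cmod (F k) - cmod (G k))\<^sup>2" by simp
      then show "0 \<le> s\<^sup>2 * (cmod (F k))\<^sup>2 - 2 * s * (cmod (F k) * cmod (G k)) + (cmod (G k))\<^sup>2"
        by (simp add: power2_eq_square algebra_simps)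
    qed (intro integrable_continuous_real continuous_intros F G | simp)+
    also have "\<dots> = s\<^sup>2 * a - 2 * s * c + b"
      unfolding I_def a_def b_def c_def
      by (subst Henstock_Kurzweil_Integration.integral_add
               Henstock_Kurzweil_Integration.integral_diff
               Henstock_Kurzweil_Integration.integral_mult_right;
          (intro integrable_diff integrable_on_mult_right int)?)+
         (simp add: add_divide_distrib diff_divide_distrib)
    finally show ?thesis by (simp add: algebra_simps)
  qed
  have "c\<^sup>2 \<le> a * b"
  proof (cases "a = 0")
    case True
    have "c = 0"
    proof (rule ccontr)
      assume "c \<noteq> 0"
      \<comment> \<open>With \<open>a = 0\<close> the polynomial is affine in \<open>s\<close>, and
        at this point its value is -1.\<close>
      then show False using quad[of "(b + 1) / (2 * c)"] True by simp
    qed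
    then show ?thesis using True by simp
  next
    case False
    then have "a > 0" using a by (simp add: less_le)
    then show ?thesis using quad[of "c / a"] by (simp add: power2_eq_square field_simps)
  qed
  then have "c \<le> L2_norm_period F * L2_norm_period G"
    unfolding a b power_mult_distrib[symmetric] by (rule power2_le_imp_le) simp
  moreover have "cmod (integral {-pi..pi} (\<lambda>k. F k * G k)) \<le> integral {-pi..pi} (\<lambda>k. cmod (F k) * cmod (G k))"
    by (intro Henstock_Kurzweil_Integration.integral_norm_bound_integral int
        integrable_continuous_real continuous_intros F G) (simp add: norm_mult)
  then have "cmod (integral {-pi..pi} (\<lambda>k. F k * G k)) / (2 * pi) \<le> c"
    unfolding c_def I_def by (intro divide_right_mono) auto
  ultimately show ?thesis by linarith
qed

lemma L2_norm_period_le: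
  assumes F: "continuous_on {-pi..pi} F" and G: "continuous_on {-pi..pi} G" and "0 \<le> M"
    and le: "\<And>k. k \<in> {-pi..pi} \<Longrightarrow> cmod (F k) \<le> M * cmod (G k)"
  shows "L2_norm_period F \<le> M * L2_norm_period G"
proof -
  have "integral {-pi..pi} (\<lambda>k. (cmod (F k))\<^sup>2) \<le> integral {-pi..pi} (\<lambda>k. M\<^sup>2 * (cmod (G k))\<^sup>2)"
  proof (intro integral_le integrable_continuous_real continuous_intros F G)
    fix k :: real assume "k \<in> {-pi..pi}"
    then have "(cmod (F k))\<^sup>2 \<le> (M * cmod (G k))\<^sup>2" by (intro power_mono le) auto
    then show "(cmod (F k))\<^sup>2 \<le> M\<^sup>2 * (cmod (G k))\<^sup>2" by (simp add: power_mult_distrib)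
  qed
  then have "(L2_norm_period F)\<^sup>2 \<le> (M * L2_norm_period G)\<^sup>2"
    using F G by (simp add: L2_norm_period_power2 power_mult_distrib divide_right_mono)
  then show ?thesis by (rule power2_le_imp_le) (use assms in simp)
qed

text \<open>Convexity of the square. \<open>G\<close> and \<open>H\<close> will be sums of the two
  half-waves with phases \<open>t * \<omega>\<close> and \<open>- t * \<omega>\<close>, from which
  cosine and sine are recovered.\<close>

lemma L2_norm_period_average_le:
  assumes F: "continuous_on {-pi..pi} F" and G: "continuous_on {-pi..pi} G" and H: "continuous_on {-pi..pi} H"
    and le: "\<And>k. k \<in> {-pi..pi} \<Longrightarrow> cmod (F k) \<le> (cmod (G k) + cmod (H k)) / 2"
    and B: "L2_norm_period G \<le> B" "L2_norm_period H \<le> B"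
  shows "L2_norm_period F \<le> B"
proof -
  have B0: "0 \<le> B" using B(1) L2_norm_period_nonneg order_trans by blast
  have "integral {-pi..pi} (\<lambda>k. (cmod (F k))\<^sup>2)
      \<le> integral {-pi..pi} (\<lambda>k. ((cmod (G k))\<^sup>2 + (cmod (H k))\<^sup>2) / 2)"
  proof (intro integral_le integrable_continuous_real continuous_intros F G H)
    fix k :: real assume "k \<in> {-pi..pi}"
    then have "(cmod (F k))\<^sup>2 \<le> ((cmod (G k) + cmod (H k)) / 2)\<^sup>2" by (intro power_mono le) auto
    then show "(cmod (F k))\<^sup>2 \<le> ((cmod (G k))\<^sup>2 + (cmod (H k))\<^sup>2) / 2"
      using sum_squares_bound[of "cmod (G k)" "cmod (H k)"] by (simp add: power_divide power2_sum)
  qed simp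
  also have "\<dots> = (integral {-pi..pi} (\<lambda>k. (cmod (G k))\<^sup>2) + integral {-pi..pi} (\<lambda>k. (cmod (H k))\<^sup>2)) / 2"
    by (subst Henstock_Kurzweil_Integration.integral_divide, subst Henstock_Kurzweil_Integration.integral_add)
       (intro integrable_continuous_real continuous_intros G H refl)+
  finally have "(L2_norm_period F)\<^sup>2 \<le> ((L2_norm_period G)\<^sup>2 + (L2_norm_period H)\<^sup>2) / 2"
    using F G H by (simp add: L2_norm_period_power2 field_simps)
  also have "\<dots> \<le> (B\<^sup>2 + B\<^sup>2) / 2"
    using B by (intro divide_right_mono add_mono power_mono) auto
  finally show ?thesis using B0 by (auto intro: power2_le_imp_le)
qed

lemma integral_sum_sum:
  fixes f :: "'i \<Rightarrow> 'j \<Rightarrow> real \<Rightarrow> 'a::banach"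
  assumes "finite I" "finite J" "\<And>i j. i \<in> I \<Longrightarrow> j \<in> J \<Longrightarrow> continuous_on {a..b} (f i j)"
  shows "integral {a..b} (\<lambda>k. \<Sum>i\<in>I. \<Sum>j\<in>J. f i j k) = (\<Sum>i\<in>I. \<Sum>j\<in>J. integral {a..b} (f i j))"
proof -
  have "integral {a..b} (\<lambda>k. \<Sum>i\<in>I. \<Sum>j\<in>J. f i j k) = (\<Sum>i\<in>I. integral {a..b} (\<lambda>k. \<Sum>j\<in>J. f i j k))"
    by (intro Henstock_Kurzweil_Integration.integral_sum integrable_continuous_real continuous_on_sum assms)
  also have "\<dots> = (\<Sum>i\<in>I. \<Sum>j\<in>J. integral {a..b} (f i j))"
    by (intro sum.cong refl Henstock_Kurzweil_Integration.integral_sum integrable_continuous_real assms)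
  finally show ?thesis .
qed

text \<open>Expanding the square is the passage from T to T T*: the entries of the matrix are
  oscillatory integrals of phase differences. For plane waves they express orthogonality, for
  propagating waves they carry the dispersive decay.\<close>

lemma L2_norm_period_cis_sum:
  assumes I: "finite I" and \<phi>: "\<And>i. i \<in> I \<Longrightarrow> continuous_on {-pi..pi} (\<phi> i)"
  shows "of_real (2 * pi * (L2_norm_period (\<lambda>k. \<Sum>i\<in>I. b i * cis (\<phi> i k)))\<^sup>2) =
    (\<Sum>i\<in>I. \<Sum>j\<in>I. b i * cnj (b j) * integral {-pi..pi} (\<lambda>k. cis (\<phi> i k - \<phi> j k)))"
proof -
  define H where "H k = (\<Sum>i\<in>I. b i * cis (\<phi> i k))" for k
  have H: "continuous_on {-pi..pi} H" unfolding H_def by (intro continuous_intros \<phi>)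
  have "of_real (2 * pi * (L2_norm_period H)\<^sup>2) = of_real (integral {-pi..pi} (\<lambda>k. (cmod (H k))\<^sup>2))"
    using H by (simp add: L2_norm_period_power2)
  also have "\<dots> = integral {-pi..pi} (\<lambda>k. of_real ((cmod (H k))\<^sup>2))"
    by (rule integral_linear[unfolded o_def, symmetric])
       (auto intro!: integrable_continuous_real continuous_intros H bounded_linear_of_real)
  also have "\<dots> = integral {-pi..pi} (\<lambda>k. \<Sum>i\<in>I. \<Sum>j\<in>I. b i * cnj (b j) * cis (\<phi> i k - \<phi> j k))"
  proof (intro integral_cong)
    fix k
    have "of_real ((cmod (H k))\<^sup>2) = H k * cnj (H k)" by (rule complex_norm_square)
    also have "\<dots> = (\<Sum>i\<in>I. \<Sum>j\<in>I. (b i * cis (\<phi> i k)) * cnj (b j * cis (\<phi> j k)))"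
      by (simp only: H_def cnj_sum sum_product)
    also have "\<dots> = (\<Sum>i\<in>I. \<Sum>j\<in>I. b i * cnj (b j) * cis (\<phi> i k - \<phi> j k))"
    proof (intro sum.cong refl)
      fix i j
      have "cis (\<phi> i k) * cis (- \<phi> j k) = cis (\<phi> i k - \<phi> j k)" by (simp add: cis_mult)
      then show "(b i * cis (\<phi> i k)) * cnj (b j * cis (\<phi> j k)) = b i * cnj (b j) * cis (\<phi> i k - \<phi> j k)"
        by (simp add: cis_cnj[symmetric] mult_ac)
    qed
    finally show "of_real ((cmod (H k))\<^sup>2) = (\<Sum>i\<in>I. \<Sum>j\<in>I. b i * cnj (b j) * cis (\<phi> i k - \<phi> j k))" .
  qed
  also have "\<dots> = (\<Sum>i\<in>I. \<Sum>j\<in>I. integral {-pi..pi} (\<lambda>k. b i * cnj (b j) * cis (\<phi> i k - \<phi> j k)))"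
    by (intro integral_sum_sum I continuous_intros \<phi>)
  finally show ?thesis unfolding H_def by simp
qed

lemma integral_cis_int:
  "integral {-pi..pi} (\<lambda>k. cis (of_int n * k)) = (if n = 0 then of_real (2 * pi) else 0)"
proof (cases "n = 0")
  case True
  then show ?thesis by (simp add: scaleR_conv_of_real)
next
  case False
  have "((\<lambda>k. cis (of_int n * k)) has_integral
      cis (of_int n * pi) / (\<i> * of_int n) - cis (of_int n * (-pi)) / (\<i> * of_int n)) {-pi..pi}"
  proof (rule fundamental_theorem_of_calculus)
    fix x :: real
    have "((\<lambda>k. cis (of_int n * k)) has_vector_derivative of_int n *\<^sub>R (\<i> * cis (of_int n * x))) (at x within {-pi..pi})"
      unfolding has_vector_derivative_def
      by (auto intro!: derivative_eq_intros simp: scaleR_conv_of_real)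
    then have "((\<lambda>k. cis (of_int n * k) / (\<i> * of_int n)) has_vector_derivative
        (of_int n *\<^sub>R (\<i> * cis (of_int n * x))) / (\<i> * of_int n)) (at x within {-pi..pi})"
      by (rule has_vector_derivative_divide)
    then show "((\<lambda>k. cis (of_int n * k) / (\<i> * of_int n)) has_vector_derivative cis (of_int n * x)) (at x within {-pi..pi})"
      using False by (simp add: scaleR_conv_of_real)
  qed simp
  moreover have "cis (of_int n * pi) = cis (of_int n * (-pi))"
    by (simp add: complex_eq_iff sin_int_times_real mult.commute[of _ pi])
  ultimately show ?thesis using False by (simp add: integral_unique)
qed

lemma continuous_on_plane_wave [continuous_intros]: "continuous_on S (\<lambda>k. plane_wave k n)"
  unfolding plane_wave_def by (intro continuous_intros)

lemma L2_norm_period_trig_sum: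
  assumes "finite I" "inj_on \<nu> I"
  shows "(L2_norm_period (\<lambda>k. \<Sum>i\<in>I. b i * plane_wave k (\<nu> i)))\<^sup>2 = (\<Sum>i\<in>I. (cmod (b i))\<^sup>2)"
proof -
  have "complex_of_real (2 * pi * (L2_norm_period (\<lambda>k. \<Sum>i\<in>I. b i * plane_wave k (\<nu> i)))\<^sup>2) =
    (\<Sum>i\<in>I. \<Sum>j\<in>I. b i * cnj (b j) * integral {-pi..pi} (\<lambda>k. cis (k * of_int (\<nu> i) - k * of_int (\<nu> j))))"
    unfolding plane_wave_def by (intro L2_norm_period_cis_sum assms continuous_intros)
  also have "\<dots> = (\<Sum>i\<in>I. \<Sum>j\<in>I. if j = i then b i * cnj (b j) * of_real (2 * pi) else 0)"
  proof (intro sum.cong refl)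
    fix i j assume "i \<in> I" "j \<in> I"
    then have eq: "\<nu> i - \<nu> j = 0 \<longleftrightarrow> j = i" using assms(2) by (auto dest: inj_onD)
    have "(\<lambda>k. cis (k * of_int (\<nu> i) - k * of_int (\<nu> j))) = (\<lambda>k. cis (of_int (\<nu> i - \<nu> j) * k))"
      by (simp add: algebra_simps)
    then show "b i * cnj (b j) * integral {-pi..pi} (\<lambda>k. cis (k * of_int (\<nu> i) - k * of_int (\<nu> j)))
        = (if j = i then b i * cnj (b j) * of_real (2 * pi) else 0)"
      using eq by (simp only: integral_cis_int) simp
  qed
  also have "\<dots> = (\<Sum>i\<in>I. of_real (2 * pi * (cmod (b i))\<^sup>2))"
    using assms(1) by (auto intro!: sum.cong simp flip: complex_norm_square)
  also have "\<dots> = of_real (2 * pi * (\<Sum>i\<in>I. (cmod (b i))\<^sup>2))"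
    by (simp add: sum_distrib_left)
  finally show ?thesis unfolding of_real_eq_iff by simp
qed

section \<open>Fourier multipliers\<close>

lemma fourier_kernel_sum_eq:
  assumes I: "finite I" and J: "finite J"
    and m: "\<And>i. i \<in> I \<Longrightarrow> continuous_on {-pi..pi} (m i)"
  shows "(\<Sum>i\<in>I. b i * (\<Sum>j\<in>J. fourier_kernel (m i) (\<nu> i - j) * f j)) =
    of_real (1 / (2 * pi)) * integral {-pi..pi} (\<lambda>k. (\<Sum>j\<in>J. f j * plane_wave k (- j)) *
      (\<Sum>i\<in>I. b i * of_real (m i k) * plane_wave k (\<nu> i)))"
proof -
  have cont: "continuous_on {-pi..pi} (\<lambda>k. f j * plane_wave k (- j) * (b i * of_real (m i k) * plane_wave k (\<nu> i)))"
    if "i \<in> I" for i j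
    by (intro continuous_intros m that)
  have pw: "plane_wave k (\<nu> i - j) = plane_wave k (- j) * plane_wave k (\<nu> i)" for k i j
    by (simp add: plane_wave_def cis_mult algebra_simps)
  have termwise: "integral {-pi..pi} (\<lambda>k. f j * plane_wave k (- j) * (b i * of_real (m i k) * plane_wave k (\<nu> i)))
      = b i * f j * integral {-pi..pi} (\<lambda>k. of_real (m i k) * plane_wave k (\<nu> i - j))" for i j
  proof -
    have "(\<lambda>k. f j * plane_wave k (- j) * (b i * of_real (m i k) * plane_wave k (\<nu> i)))
      = (\<lambda>k. (b i * f j) * (of_real (m i k) * plane_wave k (\<nu> i - j)))"
      by (simp add: pw mult_ac)
    then show ?thesis by simp
  qed
  have "integral {-pi..pi} (\<lambda>k. (\<Sum>j\<in>J. f j * plane_wave k (- j)) *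
      (\<Sum>i\<in>I. b i * of_real (m i k) * plane_wave k (\<nu> i))) =
    integral {-pi..pi} (\<lambda>k. \<Sum>j\<in>J. \<Sum>i\<in>I. f j * plane_wave k (- j) * (b i * of_real (m i k) * plane_wave k (\<nu> i)))"
    by (simp only: sum_product)
  also have "\<dots> = (\<Sum>j\<in>J. \<Sum>i\<in>I. b i * f j * integral {-pi..pi} (\<lambda>k. of_real (m i k) * plane_wave k (\<nu> i - j)))"
    by (subst integral_sum_sum[OF J I]) (simp_all add: cont termwise)
  also have "\<dots> = (\<Sum>i\<in>I. \<Sum>j\<in>J. b i * f j * integral {-pi..pi} (\<lambda>k. of_real (m i k) * plane_wave k (\<nu> i - j)))"
    by (rule sum.swap)
  finally show ?thesis
    by (simp add: fourier_kernel_def sum_distrib_left mult_ac)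
qed

text \<open>By duality, symbols, sites and weights are collected in one trigonometric sum that does
  not involve \<open>f\<close>. Cauchy-Schwarz separates it from the data, whose norm is returned by
  Parseval.\<close>

lemma fourier_kernel_sum_le:
  assumes I: "finite I" and J: "finite J"
    and m: "\<And>i. i \<in> I \<Longrightarrow> continuous_on {-pi..pi} (m i)"
  shows "cmod (\<Sum>i\<in>I. b i * (\<Sum>j\<in>J. fourier_kernel (m i) (\<nu> i - j) * f j))
    \<le> sqrt (\<Sum>j\<in>J. (cmod (f j))\<^sup>2) * L2_norm_period (\<lambda>k. \<Sum>i\<in>I. b i * of_real (m i k) * plane_wave k (\<nu> i))"
proof -
  have "cmod (\<Sum>i\<in>I. b i * (\<Sum>j\<in>J. fourier_kernel (m i) (\<nu> i - j) * f j)) =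
    cmod (integral {-pi..pi} (\<lambda>k. (\<Sum>j\<in>J. f j * plane_wave k (- j)) *
      (\<Sum>i\<in>I. b i * of_real (m i k) * plane_wave k (\<nu> i)))) / (2 * pi)"
    by (subst fourier_kernel_sum_eq[OF assms]) (auto simp: norm_mult norm_divide)
  also have "\<dots> \<le> L2_norm_period (\<lambda>k. \<Sum>j\<in>J. f j * plane_wave k (- j)) *
      L2_norm_period (\<lambda>k. \<Sum>i\<in>I. b i * of_real (m i k) * plane_wave k (\<nu> i))"
    by (intro Cauchy_Schwarz_period continuous_intros m)
  also have "L2_norm_period (\<lambda>k. \<Sum>j\<in>J. f j * plane_wave k (- j)) = sqrt (\<Sum>j\<in>J. (cmod (f j))\<^sup>2)"
    using L2_norm_period_trig_sum[OF J, of uminus f] by (intro real_sqrt_unique[symmetric]) auto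
  finally show ?thesis .
qed

text \<open>Convergence has to be secured, since an infinite sum that does not converge takes the
  value 0. Absolute convergence comes from the finite bound at the single site
  \<open>n\<close>.\<close>

lemma fourier_multiplier_summable:
  assumes m: "continuous_on {-pi..pi} m"
  shows "(\<lambda>j. fourier_kernel m (n - j) * coord f j) summable_on UNIV"
proof -
  have "(\<lambda>j. cmod (fourier_kernel m (n - j) * coord f j)) summable_on UNIV"
  proof (rule nonneg_bdd_above_summable_on)
    define B where "B = norm f * L2_norm_period (\<lambda>k. \<Sum>i\<in>{()}. 1 * of_real (m k) * plane_wave k n)"
    have "(\<Sum>j\<in>J. cmod (fourier_kernel m (n - j) * coord f j)) \<le> B" if J: "finite J" for J
    proof -
      \<comment> \<open>These phases turn every term of the sum into its modulus and do not increase
        the moduli of the data.\<close>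
      define g where "g j = coord f j * cnj (sgn (fourier_kernel m (n - j) * coord f j))" for j
      have g: "cmod (g j) \<le> cmod (coord f j)" for j
        by (auto simp: g_def norm_mult norm_sgn)
      have "fourier_kernel m (n - j) * g j = cmod (fourier_kernel m (n - j) * coord f j)" for j
      proof -
        have "z * cnj (sgn z) = cmod z" for z
          by (cases "z = 0") (simp_all add: sgn_eq complex_norm_square[symmetric] power2_eq_square)
        from this[of "fourier_kernel m (n - j) * coord f j"] show ?thesis
          unfolding g_def by (simp only: mult.assoc)
      qed
      then have "complex_of_real (\<Sum>j\<in>J. cmod (fourier_kernel m (n - j) * coord f j)) =
         (\<Sum>i\<in>{()}. 1 * (\<Sum>j\<in>J. fourier_kernel m (n - j) * g j))" by simp
      also have "cmod \<dots> \<le> sqrt (\<Sum>j\<in>J. (cmod (g j))\<^sup>2) *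
          L2_norm_period (\<lambda>k. \<Sum>i\<in>{()}. 1 * of_real (m k) * plane_wave k n)"
        by (rule fourier_kernel_sum_le) (use J m in auto)
      also have "\<dots> \<le> B"
        unfolding B_def
      proof (rule mult_right_mono)
        have "(\<Sum>j\<in>J. (cmod (g j))\<^sup>2) \<le> (\<Sum>j\<in>J. (cmod (coord f j))\<^sup>2)"
          by (intro sum_mono power_mono g) auto
        also have "\<dots> \<le> (norm f)\<^sup>2" by (rule sum_coord_square_le[OF J])
        finally show "sqrt (\<Sum>j\<in>J. (cmod (g j))\<^sup>2) \<le> norm f" by (rule real_le_lsqrt[rotated 2, rotated]) auto
      qed simp
      finally show ?thesis unfolding norm_of_real by linarith
    qed
    then show "bdd_above (sum (\<lambda>j. cmod (fourier_kernel m (n - j) * coord f j)) ` {F. F \<subseteq> UNIV \<and> finite F})"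
      by (auto intro!: bdd_aboveI)
  qed simp
  then show ?thesis by (rule Infinite_Sum.abs_summable_summable)
qed

lemma has_sum_finite_sum:
  fixes f :: "'i \<Rightarrow> 'a \<Rightarrow> 'b::topological_comm_monoid_add"
  assumes "finite I" "\<And>i. i \<in> I \<Longrightarrow> (f i has_sum s i) A"
  shows "((\<lambda>x. \<Sum>i\<in>I. f i x) has_sum (\<Sum>i\<in>I. s i)) A"
  using assms by (induction I rule: finite_induct) (auto intro: has_sum_add)

text \<open>All linear estimates come from this bilinear bound, by a suitable choice of the
  symbols \<open>m i\<close>, sites \<open>\<nu> i\<close> and weights \<open>b i\<close>.\<close>

lemma fourier_multiplier_sum_le:
  assumes I: "finite I" and m: "\<And>i. i \<in> I \<Longrightarrow> continuous_on {-pi..pi} (m i)"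
  shows "cmod (\<Sum>i\<in>I. b i * fourier_multiplier (m i) (coord f) (\<nu> i))
    \<le> norm f * L2_norm_period (\<lambda>k. \<Sum>i\<in>I. b i * of_real (m i k) * plane_wave k (\<nu> i))"
    (is "_ \<le> ?B")
proof -
  have "((\<lambda>j. \<Sum>i\<in>I. b i * (fourier_kernel (m i) (\<nu> i - j) * coord f j)) has_sum
      (\<Sum>i\<in>I. b i * fourier_multiplier (m i) (coord f) (\<nu> i))) UNIV"
    unfolding fourier_multiplier_def
    by (intro has_sum_finite_sum I has_sum_cmult_right has_sum_infsum fourier_multiplier_summable m)
  then have lim: "((\<lambda>J. \<Sum>j\<in>J. \<Sum>i\<in>I. b i * (fourier_kernel (m i) (\<nu> i - j) * coord f j)) \<longlongrightarrow>
      (\<Sum>i\<in>I. b i * fourier_multiplier (m i) (coord f) (\<nu> i))) (finite_subsets_at_top UNIV)"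
    by (simp add: has_sum_def)
  show ?thesis
  proof (rule tendsto_upperbound[OF tendsto_norm[OF lim]])
    have "cmod (\<Sum>j\<in>J. \<Sum>i\<in>I. b i * (fourier_kernel (m i) (\<nu> i - j) * coord f j)) \<le> ?B" if J: "finite J" for J
    proof -
      have "(\<Sum>j\<in>J. \<Sum>i\<in>I. b i * (fourier_kernel (m i) (\<nu> i - j) * coord f j)) =
          (\<Sum>i\<in>I. b i * (\<Sum>j\<in>J. fourier_kernel (m i) (\<nu> i - j) * coord f j))"
        by (subst sum.swap) (simp add: sum_distrib_left)
      also have "cmod \<dots> \<le> sqrt (\<Sum>j\<in>J. (cmod (coord f j))\<^sup>2) *
          L2_norm_period (\<lambda>k. \<Sum>i\<in>I. b i * of_real (m i k) * plane_wave k (\<nu> i))"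
        by (rule fourier_kernel_sum_le[OF I J m])
      also have "\<dots> \<le> ?B"
        using sum_coord_square_le[OF J, of f]
        by (intro mult_right_mono real_le_lsqrt) auto
      finally show ?thesis .
    qed
    then show "\<forall>\<^sub>F J in finite_subsets_at_top UNIV.
        cmod (\<Sum>j\<in>J. \<Sum>i\<in>I. b i * (fourier_kernel (m i) (\<nu> i - j) * coord f j)) \<le> ?B"
      by (auto intro: eventually_finite_subsets_at_top_weakI)
  qed simp
qed

text \<open>The output is tested against its own conjugate on a finite set. If \<open>S\<close> is
  its sum of squares there, the bilinear bound reads \<open>S \<le> M * norm f * sqrt S\<close>,
  which bounds \<open>S\<close> uniformly in the set.\<close>

lemma fourier_multiplier_bounded:
  assumes m: "continuous_on {-pi..pi} m" and M: "\<And>k. k \<in> {-pi..pi} \<Longrightarrow> \<bar>m k\<bar> \<le> M"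
  obtains g where "coord g = fourier_multiplier m (coord f)" "norm g \<le> M * norm f"
proof -
  have M0: "0 \<le> M" using M[of 0] by auto
  have "(\<Sum>n\<in>F. (cmod (fourier_multiplier m (coord f) n))\<^sup>2) \<le> (M * norm f)\<^sup>2" if F: "finite F" for F
  proof -
    define b where "b n = cnj (fourier_multiplier m (coord f) n)" for n
    define S where "S = (\<Sum>n\<in>F. (cmod (fourier_multiplier m (coord f) n))\<^sup>2)"
    have S0: "0 \<le> S" by (simp add: S_def sum_nonneg)
    have "complex_of_real S = (\<Sum>n\<in>F. b n * fourier_multiplier m (coord f) n)"
      unfolding S_def of_real_sum b_def by (intro sum.cong refl) (subst complex_norm_square, simp add: mult.commute)
    then have "S = cmod (\<Sum>n\<in>F. b n * fourier_multiplier m (coord f) n)"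
      using S0 by (metis abs_of_nonneg norm_of_real)
    also have "\<dots> \<le> norm f * L2_norm_period (\<lambda>k. \<Sum>n\<in>F. b n * of_real (m k) * plane_wave k n)"
      by (intro fourier_multiplier_sum_le F m)
    also have "\<dots> \<le> norm f * (M * L2_norm_period (\<lambda>k. \<Sum>n\<in>F. b n * plane_wave k n))"
    proof (intro mult_left_mono L2_norm_period_le continuous_intros m M0)
      fix k :: real assume "k \<in> {-pi..pi}"
      have "(\<Sum>n\<in>F. b n * of_real (m k) * plane_wave k n) = of_real (m k) * (\<Sum>n\<in>F. b n * plane_wave k n)"
        by (simp add: sum_distrib_left mult_ac)
      then show "cmod (\<Sum>n\<in>F. b n * of_real (m k) * plane_wave k n) \<le> M * cmod (\<Sum>n\<in>F. b n * plane_wave k n)"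
        using M[OF \<open>k \<in> _\<close>] by (simp add: norm_mult mult_right_mono)
    qed simp
    also have "L2_norm_period (\<lambda>k. \<Sum>n\<in>F. b n * plane_wave k n) = sqrt S"
      using L2_norm_period_trig_sum[OF F, of id b]
      by (intro real_sqrt_unique[symmetric]) (auto simp: S_def b_def)
    finally have "S \<le> (M * norm f) * sqrt S" by (simp add: mult_ac)
    then have "sqrt S * sqrt S \<le> (M * norm f) * sqrt S" using S0 by simp
    then have "sqrt S \<le> M * norm f"
      using M0 S0 mult_right_le_imp_le[of "sqrt S" "sqrt S" "M * norm f"] by (cases "S = 0") simp_all
    then have "(sqrt S)\<^sup>2 \<le> (M * norm f)\<^sup>2" using S0 by (intro power_mono) auto
    then show ?thesis using S0 by (simp add: S_def)
  qed
  then show ?thesis using M0 that ell2_of_bounded_sums[of "fourier_multiplier m (coord f)" "M * norm f"] by auto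
qed

text \<open>\<open>Abs_ell2\<close> says nothing outside the square-summable sequences, so the facts
  below ask for a continuous symbol, for which the output is square-summable.\<close>

definition multiplier :: "(real \<Rightarrow> real) \<Rightarrow> ell2 \<Rightarrow> ell2" where
  "multiplier m f = Abs_ell2 (fourier_multiplier m (coord f))"

lemma coord_multiplier:
  assumes "continuous_on {-pi..pi} m"
  shows "coord (multiplier m f) = fourier_multiplier m (coord f)"
proof -
  have "bounded (m ` {-pi..pi})"
    using assms by (intro compact_imp_bounded compact_continuous_image) auto
  then obtain M where "\<forall>k\<in>{-pi..pi}. \<bar>m k\<bar> \<le> M" by (auto simp: bounded_iff)
  then obtain g where "coord g = fourier_multiplier m (coord f)"
    using fourier_multiplier_bounded[OF assms, of M f] by blast
  then show ?thesis unfolding multiplier_def by (metis coord_inverse)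
qed

lemma norm_multiplier_le:
  assumes "continuous_on {-pi..pi} m" "\<And>k. k \<in> {-pi..pi} \<Longrightarrow> \<bar>m k\<bar> \<le> M"
  shows "norm (multiplier m f) \<le> M * norm f"
proof -
  obtain g where "coord g = fourier_multiplier m (coord f)" "norm g \<le> M * norm f"
    using fourier_multiplier_bounded[OF assms] by blast
  then show ?thesis unfolding multiplier_def by (metis coord_inverse)
qed

lemma multiplier_add:
  assumes "continuous_on {-pi..pi} m"
  shows "multiplier m (f + g) = multiplier m f + multiplier m g"
  by (rule ell2_eqI)
     (simp add: coord_multiplier[OF assms] fourier_multiplier_def distrib_left
       infsum_add fourier_multiplier_summable[OF assms])

lemma multiplier_scaleR:
  assumes "continuous_on {-pi..pi} m"
  shows "multiplier m (c *\<^sub>R f) = c *\<^sub>R multiplier m f"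
  by (rule ell2_eqI)
     (simp add: coord_multiplier[OF assms] fourier_multiplier_def infsum_scaleR_right)

lemma bounded_linear_multiplier:
  assumes m: "continuous_on {-pi..pi} m"
  shows "bounded_linear (multiplier m)"
proof -
  have "bounded (m ` {-pi..pi})"
    using m by (intro compact_imp_bounded compact_continuous_image) auto
  then obtain M where "\<forall>k\<in>{-pi..pi}. \<bar>m k\<bar> \<le> M" by (auto simp: bounded_iff)
  then show ?thesis
    by (intro bounded_linear_intro[where K = M] multiplier_add multiplier_scaleR m)
       (auto simp: mult.commute intro!: norm_multiplier_le[OF m])
qed

lemma fourier_kernel_diff:
  assumes "continuous_on {-pi..pi} m" "continuous_on {-pi..pi} m'"
  shows "fourier_kernel (\<lambda>k. m k - m' k) n = fourier_kernel m n - fourier_kernel m' n"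
proof -
  have "integral {-pi..pi} (\<lambda>k. of_real (m k) * plane_wave k n - of_real (m' k) * plane_wave k n) =
    integral {-pi..pi} (\<lambda>k. of_real (m k) * plane_wave k n) - integral {-pi..pi} (\<lambda>k. of_real (m' k) * plane_wave k n)"
    by (intro Henstock_Kurzweil_Integration.integral_diff integrable_continuous_real continuous_intros assms)
  then show ?thesis by (simp add: fourier_kernel_def left_diff_distrib right_diff_distrib diff_divide_distrib)
qed

lemma multiplier_diff_symbol:
  assumes "continuous_on {-pi..pi} m" "continuous_on {-pi..pi} m'"
  shows "multiplier m f - multiplier m' f = multiplier (\<lambda>k. m k - m' k) f"
proof (rule ell2_eqI)
  fix n
  have c: "continuous_on {-pi..pi} (\<lambda>k. m k - m' k)" by (intro continuous_intros assms)
  have "fourier_multiplier (\<lambda>k. m k - m' k) (coord f) n =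
    (\<Sum>\<^sub>\<infinity>j. fourier_kernel m (n - j) * coord f j - fourier_kernel m' (n - j) * coord f j)"
    unfolding fourier_multiplier_def fourier_kernel_diff[OF assms] by (simp add: left_diff_distrib)
  also have "\<dots> = (\<Sum>\<^sub>\<infinity>j. fourier_kernel m (n - j) * coord f j) + (\<Sum>\<^sub>\<infinity>j. - (fourier_kernel m' (n - j) * coord f j))"
    using infsum_add[OF fourier_multiplier_summable[OF assms(1), of n f]
      summable_on_uminus[THEN iffD2, OF fourier_multiplier_summable[OF assms(2), of n f]]]
    by simp
  also have "\<dots> = fourier_multiplier m (coord f) n - fourier_multiplier m' (coord f) n"
    unfolding fourier_multiplier_def infsum_uminus by simp
  finally show "coord (multiplier m f - multiplier m' f) n = coord (multiplier (\<lambda>k. m k - m' k) f) n"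
    by (simp add: coord_multiplier assms c)
qed

section \<open>The linear Klein-Gordon propagators\<close>

definition cos_symbol :: "real \<Rightarrow> real \<Rightarrow> real" where
  "cos_symbol t k = cos (t * kg_frequency k)"

definition sin_symbol :: "real \<Rightarrow> real \<Rightarrow> real" where
  "sin_symbol t k = sin (t * kg_frequency k) / kg_frequency k"

lemma continuous_on_symbols [continuous_intros]:
  "continuous_on S (cos_symbol t)" "continuous_on S (sin_symbol t)"
  unfolding cos_symbol_def sin_symbol_def
  by (intro continuous_intros; simp add: kg_frequency_bounds)+

lemma abs_symbol_le: "\<bar>cos_symbol t k\<bar> \<le> 1" "\<bar>sin_symbol t k\<bar> \<le> 1"
proof -
  show "\<bar>cos_symbol t k\<bar> \<le> 1" by (simp add: cos_symbol_def)
  have "\<bar>sin (t * kg_frequency k)\<bar> \<le> kg_frequency k"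
    using kg_frequency_ge_1[of k] abs_sin_le_one[of "t * kg_frequency k"] by linarith
  then show "\<bar>sin_symbol t k\<bar> \<le> 1"
    using kg_frequency_bounds(1)[of k] by (simp add: sin_symbol_def abs_divide)
qed

text \<open>The frequency is bounded by 3 on the lattice, so the propagators will be Lipschitz in
  time in operator norm. For the sine, division by the frequency cancels the factor produced by the
  time difference.\<close>

lemma symbol_lipschitz:
  "\<bar>cos_symbol t k - cos_symbol s k\<bar> \<le> 3 * \<bar>t - s\<bar>" "\<bar>sin_symbol t k - sin_symbol s k\<bar> \<le> \<bar>t - s\<bar>"
proof -
  have sin_le: "\<bar>sin x\<bar> \<le> \<bar>x\<bar>" for x :: real using abs_sin_x_le_abs_x .
  have w: "\<bar>(t * kg_frequency k - s * kg_frequency k) / 2\<bar> = \<bar>t - s\<bar> * kg_frequency k / 2"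
    using kg_frequency_bounds(1)[of k] by (simp add: left_diff_distrib[symmetric] abs_mult)
  have d: "\<bar>sin ((t * kg_frequency k - s * kg_frequency k) / 2)\<bar> \<le> \<bar>t - s\<bar> * kg_frequency k / 2"
    using sin_le[of "(t * kg_frequency k - s * kg_frequency k) / 2"] w by simp
  have "\<bar>cos_symbol t k - cos_symbol s k\<bar> =
    2 * (\<bar>sin ((t * kg_frequency k + s * kg_frequency k) / 2)\<bar> * \<bar>sin ((s * kg_frequency k - t * kg_frequency k) / 2)\<bar>)"
    by (simp add: cos_symbol_def cos_diff_cos abs_mult)
  also have "\<bar>sin ((s * kg_frequency k - t * kg_frequency k) / 2)\<bar> = \<bar>sin ((t * kg_frequency k - s * kg_frequency k) / 2)\<bar>"
  proof -
    have "(s * kg_frequency k - t * kg_frequency k) / 2 = - ((t * kg_frequency k - s * kg_frequency k) / 2)"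
      by (simp add: diff_divide_distrib)
    then show ?thesis by (simp only: sin_minus abs_minus_cancel)
  qed
  also have "2 * (\<bar>sin ((t * kg_frequency k + s * kg_frequency k) / 2)\<bar> * \<bar>sin ((t * kg_frequency k - s * kg_frequency k) / 2)\<bar>)
     \<le> 2 * (1 * (\<bar>t - s\<bar> * kg_frequency k / 2))"
    by (intro mult_left_mono mult_mono d) auto
  also have "\<dots> \<le> \<bar>t - s\<bar> * 3"
    using mult_left_mono[OF kg_frequency_bounds(3)[of k], of "\<bar>t - s\<bar>"] by simp
  finally show "\<bar>cos_symbol t k - cos_symbol s k\<bar> \<le> 3 * \<bar>t - s\<bar>" by simp
  have "\<bar>sin (t * kg_frequency k) - sin (s * kg_frequency k)\<bar> =
    2 * (\<bar>sin ((t * kg_frequency k - s * kg_frequency k) / 2)\<bar> * \<bar>cos ((t * kg_frequency k + s * kg_frequency k) / 2)\<bar>)"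
    by (simp add: sin_diff_sin abs_mult)
  also have "\<dots> \<le> 2 * ((\<bar>t - s\<bar> * kg_frequency k / 2) * 1)"
    using kg_frequency_bounds(1)[of k] by (intro mult_left_mono mult_mono d) auto
  finally have "\<bar>sin (t * kg_frequency k) - sin (s * kg_frequency k)\<bar> / kg_frequency k \<le> \<bar>t - s\<bar>"
    using kg_frequency_bounds(1)[of k] by (simp add: field_simps)
  then show "\<bar>sin_symbol t k - sin_symbol s k\<bar> \<le> \<bar>t - s\<bar>"
    using kg_frequency_bounds(1)[of k] by (simp add: sin_symbol_def diff_divide_distrib[symmetric] abs_divide)
qed

definition cos_propagator :: "real \<Rightarrow> ell2 \<Rightarrow> ell2" where
  "cos_propagator t = multiplier (cos_symbol t)"

definition sin_propagator :: "real \<Rightarrow> ell2 \<Rightarrow> ell2" where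
  "sin_propagator t = multiplier (sin_symbol t)"

lemma coord_propagators:
  "coord (cos_propagator t f) = kg_cos t (coord f)" "coord (sin_propagator t f) = kg_sin t (coord f)"
  unfolding cos_propagator_def sin_propagator_def kg_cos_def kg_sin_def
    coord_multiplier[OF continuous_on_symbols(1)] coord_multiplier[OF continuous_on_symbols(2)]
  unfolding cos_symbol_def[abs_def] sin_symbol_def[abs_def]
  by (rule refl)+

lemma bounded_linear_propagators:
  "bounded_linear (cos_propagator t)" "bounded_linear (sin_propagator t)"
  unfolding cos_propagator_def sin_propagator_def
  by (intro bounded_linear_multiplier continuous_intros)+

lemma norm_propagators_le: "norm (cos_propagator t f) \<le> norm f" "norm (sin_propagator t f) \<le> norm f"
  using norm_multiplier_le[of "cos_symbol t" 1 f] norm_multiplier_le[of "sin_symbol t" 1 f]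
  unfolding cos_propagator_def sin_propagator_def by (auto intro: continuous_intros abs_symbol_le)

lemma propagators_lipschitz:
  "norm (cos_propagator t f - cos_propagator s f) \<le> 3 * \<bar>t - s\<bar> * norm f"
  "norm (sin_propagator t f - sin_propagator s f) \<le> \<bar>t - s\<bar> * norm f"
  unfolding cos_propagator_def sin_propagator_def
  by (subst multiplier_diff_symbol; intro norm_multiplier_le continuous_intros symbol_lipschitz)+

section \<open>The discretised Strichartz estimate\<close>

text \<open>The \<open>l^(6/5)\<close> norm of the first \<open>N\<close> weights, dual to the
  \<open>l^6\<close> norm in discrete time.\<close>

definition weight_norm :: "nat \<Rightarrow> (nat \<Rightarrow> complex) \<Rightarrow> real" where
  "weight_norm N b = (\<Sum>j<N. cmod (b j) powr (6/5)) powr (5/6)"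

lemma weight_norm_nonneg [simp]: "0 \<le> weight_norm N b"
  by (simp add: weight_norm_def)

text \<open>T T* with the dispersive bound and Hardy-Littlewood-Sobolev. Only time differences
  matter, and the hypothesis on them covers both \<open>\<theta> + j\<close> and
  \<open>- (\<theta> + j)\<close>, hence both half-waves. The constant is settled by 400 * 120 =
  48000 \<le> 2 * pi * 100^2.\<close>

lemma L2_norm_period_wave_sum_le:
  assumes "\<And>i j. \<bar>t i - t j\<bar> = \<bar>real i - real j\<bar>"
  shows "L2_norm_period (\<lambda>k. \<Sum>j<N. b j * cis (t j * kg_frequency k + of_int (\<nu> j) * k)) \<le> 100 * weight_norm N b"
    (is "L2_norm_period ?H \<le> _")
proof -
  define K where "K i j = integral {-pi..pi} (\<lambda>k. cis ((t i * kg_frequency k + of_int (\<nu> i) * k) -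
      (t j * kg_frequency k + of_int (\<nu> j) * k)))" for i j
  have K: "cmod (K i j) \<le> 400 * (1 + \<bar>real i - real j\<bar>) powr (-1/3)" for i j
  proof -
    have "K i j = integral {-pi..pi} (\<lambda>k. cis ((t i - t j) * kg_frequency k + (of_int (\<nu> i) - of_int (\<nu> j)) * k))"
      unfolding K_def by (simp add: algebra_simps)
    then show ?thesis using kg_dispersive_decay[of "t i - t j"] assms by simp
  qed
  have "2 * pi * (L2_norm_period ?H)\<^sup>2 = cmod (of_real (2 * pi * (L2_norm_period ?H)\<^sup>2))"
    unfolding norm_of_real by simp
  also have "of_real (2 * pi * (L2_norm_period ?H)\<^sup>2) = (\<Sum>i<N. \<Sum>j<N. b i * cnj (b j) * K i j)"
    unfolding K_def by (intro L2_norm_period_cis_sum continuous_intros) simp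
  also have "cmod \<dots> \<le> (\<Sum>i<N. \<Sum>j<N. cmod (b i * cnj (b j) * K i j))"
    by (intro order_trans[OF norm_sum] sum_mono norm_sum)
  also have "\<dots> \<le> (\<Sum>i<N. \<Sum>j<N. 400 * (cmod (b i) * cmod (b j) * (1 + \<bar>real i - real j\<bar>) powr (-1/3)))"
  proof (intro sum_mono)
    fix i j
    have "cmod (b i) * cmod (b j) * cmod (K i j)
        \<le> cmod (b i) * cmod (b j) * (400 * (1 + \<bar>real i - real j\<bar>) powr (-1/3))"
      by (intro mult_left_mono K) auto
    then show "cmod (b i * cnj (b j) * K i j) \<le> 400 * (cmod (b i) * cmod (b j) * (1 + \<bar>real i - real j\<bar>) powr (-1/3))"
      by (simp add: norm_mult)
  qed
  also have "\<dots> = 400 * (\<Sum>i<N. \<Sum>j<N. cmod (b i) * cmod (b j) * (1 + \<bar>real i - real j\<bar>) powr (-1/3))"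
    by (simp add: sum_distrib_left)
  also have "\<dots> \<le> 400 * (120 * (weight_norm N b)\<^sup>2)"
    unfolding weight_norm_def
    by (intro mult_left_mono discrete_Hardy_Littlewood_Sobolev) auto
  also have "\<dots> \<le> 2 * pi * (100 * weight_norm N b)\<^sup>2"
  proof -
    have "48000 * (weight_norm N b)\<^sup>2 \<le> (20000 * pi) * (weight_norm N b)\<^sup>2"
      using pi_gt3 by (intro mult_right_mono) auto
    then show ?thesis by (simp add: power_mult_distrib)
  qed
  finally have "(L2_norm_period ?H)\<^sup>2 \<le> (100 * weight_norm N b)\<^sup>2" by simp
  then show ?thesis by (rule power2_le_imp_le) simp
qed

text \<open>Cosine and sine are split into half-waves; dividing by the frequency, which is at least
  1, costs nothing. The offset \<theta> ranges over all reals because the Duhamel integral will call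
  for \<open>\<theta> - s\<close>.\<close>

lemma strichartz_propagators:
  "cmod (\<Sum>j<N. b j * coord (cos_propagator (\<theta> + real j) f) (\<nu> j)) \<le> 100 * weight_norm N b * norm f"
  "cmod (\<Sum>j<N. b j * coord (sin_propagator (\<theta> + real j) f) (\<nu> j)) \<le> 100 * weight_norm N b * norm f"
proof -
  define G where "G t k = (\<Sum>j<N. b j * cis (t j * kg_frequency k + of_int (\<nu> j) * k))" for t k
  have contG: "continuous_on {-pi..pi} (G t)" for t unfolding G_def by (intro continuous_intros)
  have GP: "L2_norm_period (G (\<lambda>j. \<theta> + real j)) \<le> 100 * weight_norm N b"
    unfolding G_def by (rule L2_norm_period_wave_sum_le) simp
  have GM: "L2_norm_period (G (\<lambda>j. - (\<theta> + real j))) \<le> 100 * weight_norm N b"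
    unfolding G_def by (rule L2_norm_period_wave_sum_le) simp
  have cis_split: "cis (x + y) = cis x * cis y" for x y by (simp add: cis_mult)
  have cos_eq: "complex_of_real (cos x) = (cis x + cis (-x)) / 2" for x
    by (simp add: complex_eq_iff)
  have sin_eq: "complex_of_real (sin x) = (cis x - cis (-x)) / (2 * \<i>)" for x
    by (simp add: complex_eq_iff Re_divide Im_divide)
  have pw: "plane_wave k n = cis (of_int n * k)" for k n by (simp add: plane_wave_def mult.commute)
  have "L2_norm_period (\<lambda>k. \<Sum>j<N. b j * of_real (cos_symbol (\<theta> + real j) k) * plane_wave k (\<nu> j)) \<le> 100 * weight_norm N b"
  proof (rule L2_norm_period_average_le[OF _ contG contG _ GP GM])
    fix k
    have "(\<Sum>j<N. b j * of_real (cos_symbol (\<theta> + real j) k) * plane_wave k (\<nu> j)) =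
        (G (\<lambda>j. \<theta> + real j) k + G (\<lambda>j. - (\<theta> + real j)) k) / 2"
      unfolding G_def cos_symbol_def pw cis_split cos_eq sum.distrib[symmetric] sum_divide_distrib
      by (intro sum.cong refl) (simp add: field_simps)
    then show "cmod (\<Sum>j<N. b j * of_real (cos_symbol (\<theta> + real j) k) * plane_wave k (\<nu> j))
        \<le> (cmod (G (\<lambda>j. \<theta> + real j) k) + cmod (G (\<lambda>j. - (\<theta> + real j)) k)) / 2"
      by (simp only: norm_divide norm_numeral) (intro divide_right_mono norm_triangle_ineq; simp)
  qed (intro continuous_intros)
  then have "norm f * L2_norm_period (\<lambda>k. \<Sum>j<N. b j * of_real (cos_symbol (\<theta> + real j) k) * plane_wave k (\<nu> j))
      \<le> norm f * (100 * weight_norm N b)"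
    by (intro mult_left_mono) auto
  moreover have "cmod (\<Sum>j<N. b j * fourier_multiplier (cos_symbol (\<theta> + real j)) (coord f) (\<nu> j)) \<le>
     norm f * L2_norm_period (\<lambda>k. \<Sum>j<N. b j * of_real (cos_symbol (\<theta> + real j) k) * plane_wave k (\<nu> j))"
    by (intro fourier_multiplier_sum_le continuous_intros) simp
  ultimately show "cmod (\<Sum>j<N. b j * coord (cos_propagator (\<theta> + real j) f) (\<nu> j)) \<le> 100 * weight_norm N b * norm f"
    unfolding cos_propagator_def by (simp add: coord_multiplier continuous_on_symbols mult_ac)
  have "L2_norm_period (\<lambda>k. \<Sum>j<N. b j * of_real (sin_symbol (\<theta> + real j) k) * plane_wave k (\<nu> j)) \<le> 100 * weight_norm N b"
  proof (rule L2_norm_period_average_le[OF _ contG contG _ GP GM])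
    fix k
    have "(\<Sum>j<N. b j * of_real (sin_symbol (\<theta> + real j) k) * plane_wave k (\<nu> j)) =
        (G (\<lambda>j. \<theta> + real j) k - G (\<lambda>j. - (\<theta> + real j)) k) / (2 * \<i> * of_real (kg_frequency k))"
      unfolding G_def sin_symbol_def pw cis_split of_real_divide sin_eq sum_subtractf[symmetric] sum_divide_distrib
      by (intro sum.cong refl) (simp add: field_simps kg_frequency_bounds)
    then have "cmod (\<Sum>j<N. b j * of_real (sin_symbol (\<theta> + real j) k) * plane_wave k (\<nu> j)) =
        cmod (G (\<lambda>j. \<theta> + real j) k - G (\<lambda>j. - (\<theta> + real j)) k) / (2 * kg_frequency k)"
      using kg_frequency_bounds(1)[of k] by (simp add: norm_divide norm_mult)
    also have "\<dots> \<le> (cmod (G (\<lambda>j. \<theta> + real j) k) + cmod (G (\<lambda>j. - (\<theta> + real j)) k)) / 2"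
      using kg_frequency_ge_1[of k] by (intro frac_le norm_triangle_ineq4) auto
    finally show "cmod (\<Sum>j<N. b j * of_real (sin_symbol (\<theta> + real j) k) * plane_wave k (\<nu> j))
        \<le> (cmod (G (\<lambda>j. \<theta> + real j) k) + cmod (G (\<lambda>j. - (\<theta> + real j)) k)) / 2" .
  qed (intro continuous_intros)
  then have "norm f * L2_norm_period (\<lambda>k. \<Sum>j<N. b j * of_real (sin_symbol (\<theta> + real j) k) * plane_wave k (\<nu> j))
      \<le> norm f * (100 * weight_norm N b)"
    by (intro mult_left_mono) auto
  moreover have "cmod (\<Sum>j<N. b j * fourier_multiplier (sin_symbol (\<theta> + real j)) (coord f) (\<nu> j)) \<le>
     norm f * L2_norm_period (\<lambda>k. \<Sum>j<N. b j * of_real (sin_symbol (\<theta> + real j) k) * plane_wave k (\<nu> j))"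
    by (intro fourier_multiplier_sum_le continuous_intros) simp
  ultimately show "cmod (\<Sum>j<N. b j * coord (sin_propagator (\<theta> + real j) f) (\<nu> j)) \<le> 100 * weight_norm N b * norm f"
    unfolding sin_propagator_def by (simp add: coord_multiplier continuous_on_symbols mult_ac)
qed

section \<open>The nonlinearity\<close>

text \<open>The factor \<open>b\<close> lies below the intermediate point \<open>z\<close> and lifts
  \<open>z powr (p - 1)\<close> to \<open>z powr p\<close>, a power that is monotone for every
  \<open>p \<ge> 0\<close>.\<close>

lemma powr_diff_mult_le:
  fixes a b p :: real
  assumes "0 \<le> b" "b \<le> a" "0 \<le> p"
  shows "(a powr p - b powr p) * b \<le> p * a powr p * (a - b)"
proof (cases "b = 0 \<or> a = b")
  case False
  then have "\<exists>z>b. z < a \<and> a powr p - b powr p = (a - b) * (p * z powr (p - 1))"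
    using assms by (intro MVT2) (auto intro!: derivative_eq_intros simp: powr_diff field_simps)
  then obtain z where z: "b < z" "z < a" "a powr p - b powr p = (a - b) * (p * z powr (p - 1))"
    by auto
  have "z powr (p - 1) * b \<le> z powr (p - 1) * z" using z by (intro mult_left_mono) auto
  also have "\<dots> = z powr p" using z assms by (simp add: powr_diff)
  also have "\<dots> \<le> a powr p" using z assms by (intro powr_mono2) auto
  finally have "((a - b) * p) * (z powr (p - 1) * b) \<le> ((a - b) * p) * a powr p"
    using assms by (intro mult_left_mono) auto
  then show ?thesis unfolding z(3) by (simp add: mult_ac)
qed (use assms in auto)

text \<open>With \<open>y\<close> the smaller of the two, the difference is split as
  \<open>|x|^p (x - y) + (|x|^p - |y|^p) y\<close>. Only a power of moduli remains to be
  differentiated, so that a mean value estimate on the real line suffices.\<close>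

lemma powr_nonlinearity_diff_le:
  fixes x y :: complex
  assumes p: "0 \<le> p"
  shows "cmod (of_real (cmod x powr p) * x - of_real (cmod y powr p) * y)
    \<le> (p + 1) * max (cmod x) (cmod y) powr p * cmod (x - y)"
proof -
  have ordered: "cmod (of_real (cmod x powr p) * x - of_real (cmod y powr p) * y)
      \<le> (p + 1) * cmod x powr p * cmod (x - y)" if le: "cmod y \<le> cmod x" for x y
  proof -
    have mono: "cmod y powr p \<le> cmod x powr p" using le p by (intro powr_mono2) auto
    have "of_real (cmod x powr p) * x - of_real (cmod y powr p) * y =
        of_real (cmod x powr p) * (x - y) + of_real (cmod x powr p - cmod y powr p) * y"
      by (simp add: algebra_simps)
    also have "cmod \<dots> \<le> cmod x powr p * cmod (x - y) + (cmod x powr p - cmod y powr p) * cmod y"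
      using mono by (intro order_trans[OF norm_triangle_ineq]) (simp add: norm_mult del: of_real_diff)
    also have "(cmod x powr p - cmod y powr p) * cmod y \<le> p * cmod x powr p * (cmod x - cmod y)"
      using le p by (intro powr_diff_mult_le) auto
    also have "\<dots> \<le> p * cmod x powr p * cmod (x - y)"
      using p norm_triangle_ineq2[of x y] by (intro mult_left_mono) auto
    finally show ?thesis by (simp add: algebra_simps)
  qed
  show ?thesis
  proof (cases "cmod y \<le> cmod x")
    case True
    then show ?thesis using ordered[OF True] by (simp add: max_def)
  next
    case False
    then show ?thesis using ordered[of x y] by (simp add: max_def norm_minus_commute)
  qed
qed

lemma ell2_of_coord_le:
  assumes "\<And>n. cmod (f n) \<le> K * cmod (coord g n)" "0 \<le> K"
  obtains h where "coord h = f" "norm h \<le> K * norm g"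
proof (rule ell2_of_bounded_sums[where f = f and B = "K * norm g"])
  fix F :: "int set" assume F: "finite F"
  have "(\<Sum>n\<in>F. (cmod (f n))\<^sup>2) \<le> (\<Sum>n\<in>F. (K * cmod (coord g n))\<^sup>2)"
    by (intro sum_mono power_mono assms) auto
  also have "\<dots> = K\<^sup>2 * (\<Sum>n\<in>F. (cmod (coord g n))\<^sup>2)"
    by (simp add: power_mult_distrib sum_distrib_left)
  also have "\<dots> \<le> K\<^sup>2 * (norm g)\<^sup>2" by (intro mult_left_mono sum_coord_square_le F) auto
  finally show "(\<Sum>n\<in>F. (cmod (f n))\<^sup>2) \<le> (K * norm g)\<^sup>2" by (simp add: power_mult_distrib)
qed (use assms that in auto)

lemma norm_le_of_coord_le:
  assumes "\<And>n. cmod (coord f n) \<le> K * cmod (coord g n)" "0 \<le> K"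
  shows "norm f \<le> K * norm g"
proof -
  obtain h where "coord h = coord f" "norm h \<le> K * norm g"
    using ell2_of_coord_le[OF assms] by blast
  then show ?thesis by (simp add: coord_inject)
qed

definition nonlinearity :: "real \<Rightarrow> ell2 \<Rightarrow> ell2" where
  "nonlinearity \<sigma> f = Abs_ell2 (kg_nonlinearity \<sigma> (coord f))"

lemma coord_nonlinearity:
  assumes "0 \<le> \<sigma>"
  shows "coord (nonlinearity \<sigma> f) = kg_nonlinearity \<sigma> (coord f)"
proof -
  have "cmod (kg_nonlinearity \<sigma> (coord f) n) \<le> norm f powr (2 * \<sigma>) * cmod (coord f n)" for n
    using assms unfolding kg_nonlinearity_def norm_mult
    by (intro mult_right_mono) (auto intro!: powr_mono2 norm_coord_le)
  then obtain h where "coord h = kg_nonlinearity \<sigma> (coord f)"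
    using ell2_of_coord_le[of "kg_nonlinearity \<sigma> (coord f)" "norm f powr (2 * \<sigma>)" f] by auto
  then show ?thesis unfolding nonlinearity_def by (metis coord_inverse)
qed

lemma nonlinearity_zero [simp]: "0 \<le> \<sigma> \<Longrightarrow> nonlinearity \<sigma> 0 = 0"
  by (rule ell2_eqI) (simp add: coord_nonlinearity kg_nonlinearity_def)

lemma nonlinearity_diff_le:
  assumes "0 \<le> \<sigma>"
  shows "norm (nonlinearity \<sigma> f - nonlinearity \<sigma> g)
    \<le> (2 * \<sigma> + 1) * max (sup_norm f) (sup_norm g) powr (2 * \<sigma>) * norm (f - g)"
proof (rule norm_le_of_coord_le)
  fix n
  have "cmod (coord (nonlinearity \<sigma> f - nonlinearity \<sigma> g) n)
      \<le> (2 * \<sigma> + 1) * max (cmod (coord f n)) (cmod (coord g n)) powr (2 * \<sigma>) * cmod (coord f n - coord g n)"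
    using powr_nonlinearity_diff_le[of "2 * \<sigma>" "coord f n" "coord g n"] assms
    by (simp add: coord_nonlinearity kg_nonlinearity_def)
  also have "\<dots> \<le> (2 * \<sigma> + 1) * max (sup_norm f) (sup_norm g) powr (2 * \<sigma>) * cmod (coord f n - coord g n)"
    using assms norm_coord_le_sup_norm[of f n] norm_coord_le_sup_norm[of g n]
    by (intro mult_right_mono mult_left_mono powr_mono2) (auto simp: le_max_iff_disj)
  finally show "cmod (coord (nonlinearity \<sigma> f - nonlinearity \<sigma> g) n)
    \<le> (2 * \<sigma> + 1) * max (sup_norm f) (sup_norm g) powr (2 * \<sigma>) * cmod (coord (f - g) n)" by simp
qed (use assms in auto)

lemma sup_norm_zero [simp]: "sup_norm 0 = 0"
  using sup_norm_le_norm[of 0] sup_norm_nonneg[of 0] by simp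

lemma norm_nonlinearity_le:
  assumes "0 \<le> \<sigma>"
  shows "norm (nonlinearity \<sigma> f) \<le> (2 * \<sigma> + 1) * sup_norm f powr (2 * \<sigma>) * norm f"
  using nonlinearity_diff_le[OF assms, of f 0] assms by (simp add: max_absorb1)

lemma continuous_on_nonlinearity:
  assumes "0 \<le> \<sigma>" and u: "continuous_on S u"
  shows "continuous_on S (\<lambda>t. nonlinearity \<sigma> (u t))"
  unfolding continuous_on_def
proof
  fix x assume "x \<in> S"
  then have ux: "(u \<longlongrightarrow> u x) (at x within S)" using u by (simp add: continuous_on_def)
  \<comment> \<open>The summand 1 keeps the base of the real power away from 0 in the limit, so that
    the power converges.\<close>
  define B where "B s = (2 * \<sigma> + 1) * (norm (u s) + norm (u x) + 1) powr (2 * \<sigma>) * norm (u s - u x)" for s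
  have pos: "norm (u x) + norm (u x) + 1 \<noteq> 0"
    using norm_ge_zero[of "u x"] by linarith
  have "(B \<longlongrightarrow> (2 * \<sigma> + 1) * (norm (u x) + norm (u x) + 1) powr (2 * \<sigma>) * norm (u x - u x)) (at x within S)"
    unfolding B_def using pos by (intro tendsto_intros ux) auto
  then have B: "(B \<longlongrightarrow> 0) (at x within S)" by simp
  have "norm (nonlinearity \<sigma> (u s) - nonlinearity \<sigma> (u x)) \<le> B s" for s
  proof -
    have "max (sup_norm (u s)) (sup_norm (u x)) \<le> norm (u s) + norm (u x) + 1"
      using sup_norm_le_norm[of "u s"] sup_norm_le_norm[of "u x"] norm_ge_zero[of "u s"] norm_ge_zero[of "u x"]
      by (intro max.boundedI) linarith+
    then show ?thesis
      unfolding B_def using assms(1)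
      by (intro order_trans[OF nonlinearity_diff_le] mult_right_mono mult_left_mono powr_mono2)
         (auto simp: le_max_iff_disj)
  qed
  then have "((\<lambda>s. nonlinearity \<sigma> (u s) - nonlinearity \<sigma> (u x)) \<longlongrightarrow> 0) (at x within S)"
    by (intro Lim_null_comparison[OF _ B] always_eventually) auto
  then show "((\<lambda>s. nonlinearity \<sigma> (u s)) \<longlongrightarrow> nonlinearity \<sigma> (u x)) (at x within S)"
    by (rule LIM_zero_cancel)
qed

section \<open>The space-time norm\<close>

text \<open>The norm of \<open>L\<^sup>6\<close> in time, \<open>l\<^sup>\<infinity>\<close> in space, sampled at unit time steps and in its dual
  formulation; this form is stable under limits and integrals without any measure theory.\<close>

definition strichartz_bounded :: "(real \<Rightarrow> ell2) \<Rightarrow> real \<Rightarrow> bool" where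
  "strichartz_bounded u M \<longleftrightarrow> (\<forall>N \<theta> \<nu> b. 0 \<le> \<theta> \<longrightarrow>
     cmod (\<Sum>j<N. b j * coord (u (\<theta> + real j)) (\<nu> j)) \<le> M * weight_norm N b)"

lemma strichartz_boundedD:
  "strichartz_bounded u M \<Longrightarrow> 0 \<le> \<theta> \<Longrightarrow>
     cmod (\<Sum>j<N. b j * coord (u (\<theta> + real j)) (\<nu> j)) \<le> M * weight_norm N b"
  by (simp add: strichartz_bounded_def)

lemma strichartz_bounded_cong:
  "strichartz_bounded u M \<Longrightarrow> (\<And>t. 0 \<le> t \<Longrightarrow> u t = v t) \<Longrightarrow> strichartz_bounded v M"
  by (simp add: strichartz_bounded_def)

lemma strichartz_bounded_mono: "strichartz_bounded u A \<Longrightarrow> A \<le> B \<Longrightarrow> strichartz_bounded u B"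
  unfolding strichartz_bounded_def
  by (meson mult_right_mono order_trans weight_norm_nonneg)

lemma strichartz_bounded_add:
  assumes "strichartz_bounded u A" "strichartz_bounded v B"
  shows "strichartz_bounded (\<lambda>t. u t + v t) (A + B)"
  unfolding strichartz_bounded_def
proof (intro allI impI)
  fix N \<theta> \<nu> b assume "0 \<le> (\<theta>::real)"
  have "cmod (\<Sum>j<N. b j * coord (u (\<theta> + real j) + v (\<theta> + real j)) (\<nu> j)) \<le>
    cmod (\<Sum>j<N. b j * coord (u (\<theta> + real j)) (\<nu> j)) + cmod (\<Sum>j<N. b j * coord (v (\<theta> + real j)) (\<nu> j))"
    by (simp add: distrib_left sum.distrib norm_triangle_ineq)
  also have "\<dots> \<le> A * weight_norm N b + B * weight_norm N b"
    by (intro add_mono strichartz_boundedD assms \<open>0 \<le> \<theta>\<close>)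
  finally show "cmod (\<Sum>j<N. b j * coord (u (\<theta> + real j) + v (\<theta> + real j)) (\<nu> j)) \<le> (A + B) * weight_norm N b"
    by (simp add: distrib_right)
qed

lemma strichartz_bounded_scaleR:
  assumes "strichartz_bounded u A"
  shows "strichartz_bounded (\<lambda>t. c *\<^sub>R u t) (\<bar>c\<bar> * A)"
  unfolding strichartz_bounded_def
proof (intro allI impI)
  fix N \<theta> \<nu> b assume "0 \<le> (\<theta>::real)"
  have "(\<Sum>j<N. b j * coord (c *\<^sub>R u (\<theta> + real j)) (\<nu> j)) =
    of_real c * (\<Sum>j<N. b j * coord (u (\<theta> + real j)) (\<nu> j))"
    by (simp add: sum_distrib_left scaleR_conv_of_real mult_ac)
  also have "cmod \<dots> \<le> \<bar>c\<bar> * (A * weight_norm N b)"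
    unfolding norm_mult norm_of_real by (intro mult_left_mono strichartz_boundedD assms \<open>0 \<le> \<theta>\<close>) auto
  finally show "cmod (\<Sum>j<N. b j * coord (c *\<^sub>R u (\<theta> + real j)) (\<nu> j)) \<le> \<bar>c\<bar> * A * weight_norm N b"
    by (simp add: mult.assoc)
qed

lemma strichartz_bounded_lim:
  assumes "\<And>i. strichartz_bounded (u i) M" "\<And>t. (\<lambda>i. u i t) \<longlonglongrightarrow> v t"
  shows "strichartz_bounded v M"
  unfolding strichartz_bounded_def
proof (intro allI impI)
  fix N \<theta> \<nu> b assume "0 \<le> (\<theta>::real)"
  have "(\<lambda>i. cmod (\<Sum>j<N. b j * coord (u i (\<theta> + real j)) (\<nu> j))) \<longlonglongrightarrow>
      cmod (\<Sum>j<N. b j * coord (v (\<theta> + real j)) (\<nu> j))"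
    by (intro tendsto_intros bounded_linear.tendsto[OF bounded_linear_coord] assms)
  then show "cmod (\<Sum>j<N. b j * coord (v (\<theta> + real j)) (\<nu> j)) \<le> M * weight_norm N b"
    by (rule LIMSEQ_le_const2) (use assms(1) \<open>0 \<le> \<theta>\<close> in \<open>auto intro: strichartz_boundedD\<close>)
qed

lemma strichartz_bounded_propagators:
  "strichartz_bounded (\<lambda>t. cos_propagator t f) (100 * norm f)"
  "strichartz_bounded (\<lambda>t. sin_propagator t f) (100 * norm f)"
  using strichartz_propagators[where f = f] by (auto simp: strichartz_bounded_def mult_ac)

text \<open>Dual weights are chosen extremal: with \<open>cmod (b j) = cmod (z j) ^ 5\<close> and
  opposite phase, both \<open>b j * z j\<close> and \<open>cmod (b j) powr (6/5)\<close> are the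
  sixth power of \<open>cmod (z j)\<close>. So \<open>S \<le> M * S powr (5/6)\<close>, and dividing
  gives \<open>S \<le> M ^ 6\<close>.\<close>

lemma strichartz_bounded_sum_coord:
  assumes u: "strichartz_bounded u M" and "0 \<le> M" "0 \<le> \<theta>"
  shows "(\<Sum>j<N. cmod (coord (u (\<theta> + real j)) (\<nu> j)) ^ 6) \<le> M ^ 6"
proof -
  define z where "z j = coord (u (\<theta> + real j)) (\<nu> j)" for j
  define b where "b j = cnj (z j) * of_real (cmod (z j) ^ 4)" for j
  define S where "S = (\<Sum>j<N. cmod (z j) ^ 6)"
  have S0: "0 \<le> S" by (simp add: S_def sum_nonneg)
  have "b j * z j = of_real (cmod (z j) ^ 6)" for j
  proof -
    have "b j * z j = (z j * cnj (z j)) * of_real (cmod (z j) ^ 4)" by (simp add: b_def mult_ac)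
    also have "\<dots> = of_real (cmod (z j) ^ 2 * cmod (z j) ^ 4)"
      by (simp only: complex_norm_square[symmetric] of_real_mult)
    finally show ?thesis by (simp add: power_add[symmetric])
  qed
  then have "(\<Sum>j<N. b j * z j) = of_real S" by (simp add: S_def)
  then have "S = cmod (\<Sum>j<N. b j * z j)" using S0 by simp
  also have "\<dots> \<le> M * weight_norm N b" unfolding z_def by (intro strichartz_boundedD u \<open>0 \<le> \<theta>\<close>)
  also have "weight_norm N b = S powr (5/6)"
  proof -
    have "(x ^ 5) powr (6/5) = x ^ 6" if "0 \<le> x" for x :: real
    proof (cases "x = 0")
      case False
      then have "0 < x" using that by simp
      then have "x ^ 5 = x powr 5" "x ^ 6 = x powr 6" by simp_all
      then show ?thesis by (simp only: powr_powr) simp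
    qed simp
    moreover have "cmod (b j) = cmod (z j) ^ 5" for j
      by (simp add: b_def norm_mult norm_power eval_nat_numeral)
    ultimately show ?thesis by (simp add: weight_norm_def S_def)
  qed
  finally have le: "S \<le> M * S powr (5/6)" .
  show ?thesis
  proof (cases "S = 0")
    case False
    then have pos: "S > 0" using S0 by simp
    have "S powr (1/6) * S powr (5/6) = S" using pos by (simp add: powr_add[symmetric])
    then have "S powr (1/6) * S powr (5/6) \<le> M * S powr (5/6)" using le by simp
    then have "S powr (1/6) \<le> M" using pos by simp
    then have "(S powr (1/6)) ^ 6 \<le> M ^ 6" by (intro power_mono) auto
    also have "(S powr (1/6)) ^ 6 = S" using pos by (simp add: powr_power)
    finally show ?thesis by (simp add: S_def z_def)
  qed (simp add: S_def z_def \<open>0 \<le> M\<close>)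
qed

text \<open>At each time a site is taken whose modulus is at least \<open>c\<close> times the
  supremum. The bound at fixed sites then loses only \<open>z = c ^ 6\<close>, and
  \<open>z < 1\<close> is arbitrary.\<close>

lemma strichartz_bounded_sum_sup_norm:
  assumes u: "strichartz_bounded u M" and "0 \<le> M" "0 \<le> \<theta>"
  shows "(\<Sum>j<N. sup_norm (u (\<theta> + real j)) ^ 6) \<le> M ^ 6"
proof (rule field_le_mult_one_interval)
  fix z :: real assume z: "0 < z" "z < 1"
  define c where "c = root 6 z"
  have c: "0 < c" "c < 1" "c ^ 6 = z" using z by (auto simp: c_def)
  have "\<exists>n. c * sup_norm f \<le> cmod (coord f n)" for f
  proof (cases "sup_norm f = 0")
    case False
    then have "c * sup_norm f < sup_norm f" using c sup_norm_nonneg[of f] by (simp add: less_le)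
    then show ?thesis using sup_norm_approx by (meson less_imp_le)
  qed simp
  then obtain \<nu> where \<nu>: "\<And>f. c * sup_norm f \<le> cmod (coord f (\<nu> f))" by metis
  have "z * (\<Sum>j<N. sup_norm (u (\<theta> + real j)) ^ 6) = (\<Sum>j<N. (c * sup_norm (u (\<theta> + real j))) ^ 6)"
    by (simp add: sum_distrib_left power_mult_distrib c)
  also have "\<dots> \<le> (\<Sum>j<N. cmod (coord (u (\<theta> + real j)) (\<nu> (u (\<theta> + real j)))) ^ 6)"
    using c by (intro sum_mono power_mono \<nu>) auto
  also have "\<dots> \<le> M ^ 6" by (rule strichartz_bounded_sum_coord[OF assms])
  finally show "z * (\<Sum>j<N. sup_norm (u (\<theta> + real j)) ^ 6) \<le> M ^ 6" .
qed

section \<open>From time grids to time integrals\<close>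

lemma integral_unit_steps:
  fixes g :: "real \<Rightarrow> real"
  assumes g: "continuous_on {0..} g"
  shows "integral {0..real N} g = integral {0..1} (\<lambda>\<theta>. \<Sum>j<N. g (\<theta> + real j))"
proof (induction N)
  case (Suc N)
  have cont: "continuous_on {0..1} (\<lambda>\<theta>. g (\<theta> + real j))" for j
    by (intro continuous_on_compose2[OF g] continuous_intros) auto
  have "integral {0..real (Suc N)} g = integral {0..real N} g + integral {real N..real (Suc N)} g"
    by (intro Henstock_Kurzweil_Integration.integral_combine[symmetric] integrable_continuous_real
        continuous_on_subset[OF g]) auto
  also have "integral {real N..real (Suc N)} g = integral {0..1} (\<lambda>\<theta>. g (\<theta> + real N))"
    using integral_shift_real_ivl[of "real N" "real N" "real (Suc N)" g] by simp
  also have "integral {0..real N} g + \<dots> = integral {0..1} (\<lambda>\<theta>. (\<Sum>j<N. g (\<theta> + real j)) + g (\<theta> + real N))"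
    unfolding Suc
    by (intro Henstock_Kurzweil_Integration.integral_add[symmetric] integrable_continuous_real
        continuous_on_sum cont)
  finally show ?case by simp
qed simp

text \<open>Cutting the time axis into unit steps and stacking them gives an integral over \<theta>
  in [0, 1] of sums along the grid from \<theta>. Each sum is at most \<open>M ^ 6\<close>,
  uniformly in \<theta>, so nothing is lost.\<close>

lemma strichartz_bounded_integral:
  assumes u: "strichartz_bounded u M" and "0 \<le> M" and cont: "continuous_on {0..} u" and "0 \<le> T"
  shows "integral {0..T} (\<lambda>t. sup_norm (u t) ^ 6) \<le> M ^ 6"
proof -
  define g where "g t = sup_norm (u t) ^ 6" for t
  have g: "continuous_on {0..} g" unfolding g_def by (intro continuous_intros cont)
  obtain N where N: "T \<le> real N" using real_arch_simple by blast
  have "integral {0..T} g \<le> integral {0..real N} g"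
    using N by (intro integral_subset_le integrable_continuous_real continuous_on_subset[OF g])
      (auto simp: g_def)
  also have "\<dots> = integral {0..1} (\<lambda>\<theta>. \<Sum>j<N. g (\<theta> + real j))" by (rule integral_unit_steps[OF g])
  also have "\<dots> \<le> integral {0..1::real} (\<lambda>\<theta>. M ^ 6)"
  proof (rule integral_le)
    show "(\<lambda>\<theta>. \<Sum>j<N. g (\<theta> + real j)) integrable_on {0..1}"
      by (intro integrable_continuous_real continuous_on_sum continuous_on_compose2[OF g] continuous_intros) auto
  qed (use strichartz_bounded_sum_sup_norm[OF u \<open>0 \<le> M\<close>] in \<open>auto simp: g_def\<close>)
  finally show ?thesis by (simp add: g_def[abs_def])
qed

lemma continuous_on_powr_nonneg [continuous_intros]:
  fixes f :: "real \<Rightarrow> real"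
  assumes "continuous_on S f" "\<And>x. x \<in> S \<Longrightarrow> 0 \<le> f x" "0 < p"
  shows "continuous_on S (\<lambda>x. f x powr p)"
  by (rule continuous_on_powr') (use assms in \<open>auto intro: continuous_on_const\<close>)

text \<open>The sixth power is integrated and the excess \<open>p - 6\<close> is bounded by
  \<open>M\<close>, since the sup norm is at most the \<open>l\<^sup>2\<close> norm. With
  \<open>p = 2 * \<sigma>\<close> this is where \<open>\<sigma> \<ge> 3\<close> enters; admissible
  pairs will use it with other exponents.\<close>

lemma strichartz_bounded_integral_powr:
  assumes u: "strichartz_bounded u M" and M: "0 < M" and cont: "continuous_on {0..} u" and T: "0 \<le> T"
    and le: "\<And>t. 0 \<le> t \<Longrightarrow> norm (u t) \<le> M" and p: "6 \<le> p"
  shows "integral {0..T} (\<lambda>t. sup_norm (u t) powr p) \<le> M powr p"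
proof -
  have cont': "continuous_on {0..T} u" by (rule continuous_on_subset[OF cont]) auto
  have "integral {0..T} (\<lambda>t. sup_norm (u t) powr p) \<le> integral {0..T} (\<lambda>t. M powr (p - 6) * sup_norm (u t) ^ 6)"
  proof (rule integral_le)
    show "(\<lambda>t. sup_norm (u t) powr p) integrable_on {0..T}"
      using p by (intro integrable_continuous_real continuous_intros cont') auto
    show "(\<lambda>t. M powr (p - 6) * sup_norm (u t) ^ 6) integrable_on {0..T}"
      by (intro integrable_continuous_real continuous_intros cont')
    fix t assume t: "t \<in> {0..T}"
    show "sup_norm (u t) powr p \<le> M powr (p - 6) * sup_norm (u t) ^ 6"
    proof (cases "sup_norm (u t) = 0")
      case False
      then have pos: "0 < sup_norm (u t)" by (simp add: less_le)
      have "sup_norm (u t) powr p = sup_norm (u t) powr (p - 6) * sup_norm (u t) powr 6"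
        by (simp only: powr_add[symmetric]) simp
      also have "\<dots> \<le> M powr (p - 6) * sup_norm (u t) powr 6"
        using t p le[of t] sup_norm_le_norm[of "u t"] by (intro mult_right_mono powr_mono2) auto
      finally show ?thesis using pos by simp
    qed simp
  qed
  also have "\<dots> = M powr (p - 6) * integral {0..T} (\<lambda>t. sup_norm (u t) ^ 6)" by simp
  also have "\<dots> \<le> M powr (p - 6) * M ^ 6"
    using M by (intro mult_left_mono strichartz_bounded_integral u cont T) auto
  also have "\<dots> = M powr (p - 6) * M powr 6" using M by simp
  also have "\<dots> = M powr p" by (simp only: powr_add[symmetric]) simp
  finally show ?thesis .
qed

section \<open>The Duhamel integral\<close>

lemma continuous_on_propagator_family:
  fixes P :: "real \<Rightarrow> ell2 \<Rightarrow> ell2" and g :: "real \<Rightarrow> real"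
  assumes lin: "\<And>t. bounded_linear (P t)" and le: "\<And>t f. norm (P t f) \<le> norm f"
    and lip: "\<And>t s f. norm (P t f - P s f) \<le> c * \<bar>t - s\<bar> * norm f"
    and g: "continuous_on S g" and F: "continuous_on S F"
  shows "continuous_on S (\<lambda>s. P (g s) (F s))"
  unfolding continuous_on_def
proof
  fix x assume "x \<in> S"
  then have gx: "(g \<longlongrightarrow> g x) (at x within S)" and Fx: "(F \<longlongrightarrow> F x) (at x within S)"
    using g F by (auto simp: continuous_on_def)
  have "((\<lambda>s. norm (F s - F x) + c * \<bar>g s - g x\<bar> * norm (F x)) \<longlongrightarrow>
      norm (F x - F x) + c * \<bar>g x - g x\<bar> * norm (F x)) (at x within S)"
    by (intro tendsto_intros gx Fx)
  then have lim: "((\<lambda>s. norm (F s - F x) + c * \<bar>g s - g x\<bar> * norm (F x)) \<longlongrightarrow> 0) (at x within S)" by simp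
  have "norm (P (g s) (F s) - P (g x) (F x)) \<le> norm (F s - F x) + c * \<bar>g s - g x\<bar> * norm (F x)" for s
  proof -
    have eq: "P (g s) (F s) - P (g x) (F x) = P (g s) (F s - F x) + (P (g s) (F x) - P (g x) (F x))"
      by (simp add: linear_diff[OF bounded_linear.linear[OF lin]])
    show ?thesis unfolding eq
      using norm_triangle_ineq[of "P (g s) (F s - F x)" "P (g s) (F x) - P (g x) (F x)"]
        le[of "g s" "F s - F x"] lip[of "g s" "F x" "g x"] by linarith
  qed
  then have "((\<lambda>s. P (g s) (F s) - P (g x) (F x)) \<longlongrightarrow> 0) (at x within S)"
    by (intro Lim_null_comparison[OF _ lim] always_eventually) auto
  then show "((\<lambda>s. P (g s) (F s)) \<longlongrightarrow> P (g x) (F x)) (at x within S)"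
    by (rule LIM_zero_cancel)
qed

lemma continuous_on_propagators [continuous_intros]:
  fixes g :: "real \<Rightarrow> real"
  assumes "continuous_on S g" "continuous_on S F"
  shows "continuous_on S (\<lambda>s. cos_propagator (g s) (F s))" "continuous_on S (\<lambda>s. sin_propagator (g s) (F s))"
proof -
  show "continuous_on S (\<lambda>s. cos_propagator (g s) (F s))"
    by (rule continuous_on_propagator_family[OF bounded_linear_propagators(1) norm_propagators_le(1)
          propagators_lipschitz(1) assms])
  have "norm (sin_propagator t f - sin_propagator s f) \<le> 1 * \<bar>t - s\<bar> * norm f" for t s f
    using propagators_lipschitz(2) by simp
  from continuous_on_propagator_family[OF bounded_linear_propagators(2) norm_propagators_le(2) this assms]
  show "continuous_on S (\<lambda>s. sin_propagator (g s) (F s))" .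
qed

definition duhamel :: "(real \<Rightarrow> ell2) \<Rightarrow> real \<Rightarrow> ell2" where
  "duhamel F t = integral {0..t} (\<lambda>s. sin_propagator (t - s) (F s))"

lemma duhamel_has_integral:
  assumes "continuous_on {0..} F"
  shows "((\<lambda>s. sin_propagator (t - s) (F s)) has_integral duhamel F t) {0..t}"
proof -
  have "continuous_on {0..t} F" by (rule continuous_on_subset[OF assms]) auto
  then show ?thesis unfolding duhamel_def
    by (intro integrable_integral integrable_continuous_real continuous_intros)
qed

text \<open>Bridge to \<open>kg_solution\<close>, which asks for a scalar integral at each site: a
  coordinate is a bounded functional and passes under the integral in
  \<open>l\<^sup>2\<close>.\<close>

lemma duhamel_has_integral_coord:
  assumes "continuous_on {0..} F"
  shows "((\<lambda>s. coord (sin_propagator (t - s) (F s)) n) has_integral coord (duhamel F t) n) {0..t}"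
  using has_integral_linear[OF duhamel_has_integral[OF assms] bounded_linear_coord] by (simp add: o_def)

lemma norm_duhamel_le:
  assumes F: "continuous_on {0..} F"
  shows "norm (duhamel F t) \<le> integral {0..t} (\<lambda>s. norm (F s))"
proof -
  have F': "continuous_on {0..t} F" by (rule continuous_on_subset[OF assms]) auto
  show ?thesis unfolding duhamel_def
    by (intro Henstock_Kurzweil_Integration.integral_norm_bound_integral integrable_continuous_real
        continuous_intros F' norm_propagators_le)
qed

lemma duhamel_diff:
  assumes F: "continuous_on {0..} F" and G: "continuous_on {0..} G"
  shows "duhamel F t - duhamel G t = duhamel (\<lambda>s. F s - G s) t"
proof -
  have "((\<lambda>s. sin_propagator (t - s) (F s) - sin_propagator (t - s) (G s)) has_integral
      duhamel F t - duhamel G t) {0..t}"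
    by (intro has_integral_diff duhamel_has_integral F G)
  also have "(\<lambda>s. sin_propagator (t - s) (F s) - sin_propagator (t - s) (G s)) =
      (\<lambda>s. sin_propagator (t - s) (F s - G s))"
    by (simp add: linear_diff[OF bounded_linear.linear[OF bounded_linear_propagators(2)]])
  finally show ?thesis unfolding duhamel_def[of "\<lambda>s. F s - G s"] by (rule integral_unique[symmetric])
qed

lemma weight_norm_mono:
  "(\<And>j. cmod (b j) \<le> cmod (c j)) \<Longrightarrow> weight_norm N b \<le> weight_norm N c"
  unfolding weight_norm_def by (intro powr_mono2 sum_mono sum_nonneg) auto

text \<open>For fixed \<open>s\<close> the integrand is a free wave with data \<open>F s\<close>,
  sampled with offset \<open>\<theta> - s\<close>, so the homogeneous estimate applies under the
  integral. The causal cutoff \<open>s \<le> \<theta> + j\<close> is moved into the weights, where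
  it can only lower their norm.\<close>

lemma strichartz_bounded_duhamel:
  assumes F: "continuous_on {0..} F" and K: "\<And>T. 0 \<le> T \<Longrightarrow> integral {0..T} (\<lambda>s. norm (F s)) \<le> K"
  shows "strichartz_bounded (duhamel F) (100 * K)"
  unfolding strichartz_bounded_def
proof (intro allI impI)
  fix N \<theta> \<nu> b assume \<theta>: "0 \<le> (\<theta>::real)"
  define T where "T = \<theta> + real N"
  define h where "h j s = (if s \<in> {0..\<theta> + real j} then coord (sin_propagator (\<theta> + real j - s) (F s)) (\<nu> j) else 0)"
    for j s
  have "(h j has_integral coord (duhamel F (\<theta> + real j)) (\<nu> j)) {0..T}" if "j < N" for j
    using duhamel_has_integral_coord[OF F, of "\<theta> + real j" "\<nu> j"] that
    unfolding h_def by (subst has_integral_restrict) (auto simp: T_def)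
  then have int: "((\<lambda>s. \<Sum>j<N. b j * h j s) has_integral (\<Sum>j<N. b j * coord (duhamel F (\<theta> + real j)) (\<nu> j))) {0..T}"
    by (intro has_integral_sum has_integral_mult_right) auto
  have pointwise: "cmod (\<Sum>j<N. b j * h j s) \<le> 100 * weight_norm N b * norm (F s)" if "s \<in> {0..T}" for s
  proof -
    define c where "c j = (if s \<le> \<theta> + real j then b j else 0)" for j
    have "(\<Sum>j<N. b j * h j s) = (\<Sum>j<N. c j * coord (sin_propagator ((\<theta> - s) + real j) (F s)) (\<nu> j))"
      using that by (intro sum.cong) (auto simp: h_def c_def algebra_simps)
    also have "cmod \<dots> \<le> 100 * weight_norm N c * norm (F s)" by (rule strichartz_propagators)
    also have "\<dots> \<le> 100 * weight_norm N b * norm (F s)"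
      by (intro mult_right_mono mult_left_mono weight_norm_mono) (auto simp: c_def)
    finally show ?thesis .
  qed
  have F': "continuous_on {0..T} F" by (rule continuous_on_subset[OF F]) auto
  have "cmod (\<Sum>j<N. b j * coord (duhamel F (\<theta> + real j)) (\<nu> j)) = cmod (integral {0..T} (\<lambda>s. \<Sum>j<N. b j * h j s))"
    using int by (simp add: integral_unique)
  also have "\<dots> \<le> integral {0..T} (\<lambda>s. 100 * weight_norm N b * norm (F s))"
    using pointwise
    by (intro Henstock_Kurzweil_Integration.integral_norm_bound_integral[OF has_integral_integrable[OF int]]
        integrable_continuous_real continuous_intros F') auto
  also have "\<dots> = 100 * weight_norm N b * integral {0..T} (\<lambda>s. norm (F s))" by simp
  also have "\<dots> \<le> 100 * weight_norm N b * K"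
    using \<theta> by (intro mult_left_mono K) (auto simp: T_def)
  finally show "cmod (\<Sum>j<N. b j * coord (duhamel F (\<theta> + real j)) (\<nu> j)) \<le> 100 * K * weight_norm N b"
    by (simp add: mult_ac)
qed

text \<open>\<open>K\<close> pays for shifting the propagator over the past, \<open>B\<close> for
  the new piece of the time interval. The Lipschitz bound gives the continuity of the iterates and,
  for the solution, control between grid points.\<close>

lemma duhamel_lipschitz:
  assumes F: "continuous_on {0..} F" and K: "\<And>T. 0 \<le> T \<Longrightarrow> integral {0..T} (\<lambda>s. norm (F s)) \<le> K"
    and B: "\<And>t. 0 \<le> t \<Longrightarrow> norm (F t) \<le> B" and st: "0 \<le> s" "0 \<le> t"
  shows "norm (duhamel F t - duhamel F s) \<le> (K + B) * \<bar>t - s\<bar>"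
proof -
  have ordered: "norm (duhamel F t - duhamel F s) \<le> (K + B) * (t - s)" if st: "0 \<le> s" "s \<le> t" for s t
  proof -
    have Fs: "continuous_on {0..s} F" and Ft: "continuous_on {0..t} F" and Fst: "continuous_on {s..t} F"
      using st by (auto intro: continuous_on_subset[OF F])
    have int: "(\<lambda>r. sin_propagator (t - r) (F r)) integrable_on {0..s}"
      "(\<lambda>r. sin_propagator (s - r) (F r)) integrable_on {0..s}"
      "(\<lambda>r. sin_propagator (t - r) (F r)) integrable_on {0..t}"
      by (intro integrable_continuous_real continuous_intros Fs Ft)+
    have "duhamel F t = integral {0..s} (\<lambda>r. sin_propagator (t - r) (F r)) + integral {s..t} (\<lambda>r. sin_propagator (t - r) (F r))"
      unfolding duhamel_def using st
      by (intro Henstock_Kurzweil_Integration.integral_combine[symmetric] int) auto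
    then have "duhamel F t - duhamel F s =
        integral {0..s} (\<lambda>r. sin_propagator (t - r) (F r) - sin_propagator (s - r) (F r)) +
        integral {s..t} (\<lambda>r. sin_propagator (t - r) (F r))"
      unfolding duhamel_def[of F s] by (subst Henstock_Kurzweil_Integration.integral_diff[OF int(1,2)]) simp
    also have "norm \<dots> \<le> norm (integral {0..s} (\<lambda>r. sin_propagator (t - r) (F r) - sin_propagator (s - r) (F r))) +
        norm (integral {s..t} (\<lambda>r. sin_propagator (t - r) (F r)))" by (rule norm_triangle_ineq)
    also have "norm (integral {0..s} (\<lambda>r. sin_propagator (t - r) (F r) - sin_propagator (s - r) (F r)))
        \<le> integral {0..s} (\<lambda>r. (t - s) * norm (F r))"
    proof (intro Henstock_Kurzweil_Integration.integral_norm_bound_integral integrable_diff int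
        integrable_continuous_real continuous_intros Fs)
      fix r
      show "norm (sin_propagator (t - r) (F r) - sin_propagator (s - r) (F r)) \<le> (t - s) * norm (F r)"
        using propagators_lipschitz(2)[of "t - r" "F r" "s - r"] st by simp
    qed
    also have "\<dots> = (t - s) * integral {0..s} (\<lambda>r. norm (F r))" by simp
    also have "\<dots> \<le> (t - s) * K" using st by (intro mult_left_mono K) auto
    also have "norm (integral {s..t} (\<lambda>r. sin_propagator (t - r) (F r))) \<le> B * (t - s)"
      using st by (intro integral_bound continuous_intros Fst order_trans[OF norm_propagators_le(2)] B) auto
    finally show ?thesis by (simp add: algebra_simps)
  qed
  show ?thesis
    using ordered[of s t] ordered[of t s] st by (cases "s \<le> t") (simp_all add: norm_minus_commute)
qed

text \<open>At a maximum point of \<open>exp (- k * t) * d t\<close> the hypothesis bounds the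
  maximum by \<open>\<Lambda> / k\<close> times itself. As \<open>k = 2 * \<Lambda> + 1\<close>
  exceeds \<Lambda>, the maximum is 0.\<close>

lemma Gronwall_zero:
  fixes d :: "real \<Rightarrow> real"
  assumes d: "continuous_on {0..T} d" and nonneg: "\<And>t. t \<in> {0..T} \<Longrightarrow> 0 \<le> d t"
    and \<Lambda>: "0 \<le> \<Lambda>" and le: "\<And>t. t \<in> {0..T} \<Longrightarrow> d t \<le> \<Lambda> * integral {0..t} d"
    and t: "t \<in> {0..T}"
  shows "d t = 0"
proof -
  define k where "k = 2 * \<Lambda> + 1"
  have k: "k > 0" using \<Lambda> by (simp add: k_def)
  define \<phi> where "\<phi> t = exp (- k * t) * d t" for t
  have "continuous_on {0..T} \<phi>" unfolding \<phi>_def by (intro continuous_intros d)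
  moreover have "{0..T} \<noteq> {}" using t by auto
  ultimately obtain x where x: "x \<in> {0..T}" "\<And>y. y \<in> {0..T} \<Longrightarrow> \<phi> y \<le> \<phi> x"
    using continuous_attains_sup[of "{0..T}" \<phi>] by auto
  have \<phi>0: "0 \<le> \<phi> y" if "y \<in> {0..T}" for y using nonneg[OF that] by (simp add: \<phi>_def)
  have d_eq: "d s = exp (k * s) * \<phi> s" for s
    by (simp add: \<phi>_def exp_minus field_simps)
  have exp_int: "((\<lambda>s. exp (k * s) * \<phi> x) has_integral (exp (k * x) / k * \<phi> x - exp (k * 0) / k * \<phi> x)) {0..x}"
    using x k by (intro fundamental_theorem_of_calculus)
      (auto intro!: derivative_eq_intros simp flip: has_real_derivative_iff_has_vector_derivative)
  have "integral {0..x} d \<le> integral {0..x} (\<lambda>s. exp (k * s) * \<phi> x)"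
  proof (rule integral_le)
    show "d integrable_on {0..x}"
      using x by (intro integrable_continuous_real continuous_on_subset[OF d]) auto
    show "(\<lambda>s. exp (k * s) * \<phi> x) integrable_on {0..x}" using exp_int by blast
    show "d s \<le> exp (k * s) * \<phi> x" if "s \<in> {0..x}" for s
      unfolding d_eq[of s] using that x by (intro mult_left_mono) auto
  qed
  also have "\<dots> \<le> exp (k * x) / k * \<phi> x"
    unfolding integral_unique[OF exp_int] using k \<phi>0[OF x(1)] by simp
  finally have "\<Lambda> * integral {0..x} d \<le> \<Lambda> * (exp (k * x) / k * \<phi> x)"
    using \<Lambda> by (intro mult_left_mono) auto
  then have "exp (k * x) * \<phi> x \<le> \<Lambda> * (exp (k * x) / k * \<phi> x)" using le[OF x(1)] d_eq[of x] by linarith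
  then have "exp (k * x) * (k * \<phi> x) \<le> exp (k * x) * (\<Lambda> * \<phi> x)" using k by (simp add: field_simps)
  then have "k * \<phi> x \<le> \<Lambda> * \<phi> x" by simp
  then have "(\<Lambda> + 1) * \<phi> x \<le> 0" by (simp add: k_def algebra_simps)
  then have "\<phi> x \<le> 0" using \<Lambda> by (simp add: mult_le_0_iff)
  then have "\<phi> t = 0" using x(2)[OF t] \<phi>0[OF t] by linarith
  then show ?thesis by (simp add: \<phi>_def)
qed

section \<open>The contraction argument\<close>

definition kg_map :: "real \<Rightarrow> real \<Rightarrow> ell2 \<Rightarrow> ell2 \<Rightarrow> (real \<Rightarrow> ell2) \<Rightarrow> real \<Rightarrow> ell2" where
  "kg_map \<sigma> \<mu> f0 f1 u t = cos_propagator t f0 + sin_propagator t f1 - \<mu> *\<^sub>R duhamel (\<lambda>s. nonlinearity \<sigma> (u s)) t"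

definition in_ball :: "real \<Rightarrow> (real \<Rightarrow> ell2) \<Rightarrow> bool" where
  "in_ball M u \<longleftrightarrow> continuous_on {0..} u \<and> (\<forall>t\<ge>0. norm (u t) \<le> M) \<and> strichartz_bounded u M"

text \<open>Time integrability is drawn entirely from the two powers, so the difference enters only
  through its uniform \<open>l\<^sup>2\<close> norm; this is why that metric suffices for the
  contraction. The factor 2 comes from bounding the power of a maximum by the sum of the
  powers.\<close>

lemma integral_nonlinearity_diff_le:
  assumes \<sigma>: "3 \<le> \<sigma>" and M: "0 < M" and u: "in_ball M u" and v: "in_ball M v"
    and D: "\<And>t. 0 \<le> t \<Longrightarrow> norm (u t - v t) \<le> D" and T: "0 \<le> T"
  shows "integral {0..T} (\<lambda>s. norm (nonlinearity \<sigma> (u s) - nonlinearity \<sigma> (v s)))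
    \<le> 2 * (2 * \<sigma> + 1) * M powr (2 * \<sigma>) * D"
proof -
  have cont: "continuous_on {0..T} u" "continuous_on {0..T} v"
    using u v by (auto simp: in_ball_def intro: continuous_on_subset)
  have D0: "0 \<le> D" using D[of 0] norm_ge_zero[of "u 0 - v 0"] by linarith
  have int: "(\<lambda>s. sup_norm (u s) powr (2 * \<sigma>)) integrable_on {0..T}"
    "(\<lambda>s. sup_norm (v s) powr (2 * \<sigma>)) integrable_on {0..T}"
    using \<sigma> by (intro integrable_continuous_real continuous_intros cont; simp)+
  have "integral {0..T} (\<lambda>s. norm (nonlinearity \<sigma> (u s) - nonlinearity \<sigma> (v s)))
      \<le> integral {0..T} (\<lambda>s. (2 * \<sigma> + 1) * D * (sup_norm (u s) powr (2 * \<sigma>) + sup_norm (v s) powr (2 * \<sigma>)))"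
  proof (rule integral_le)
    show "(\<lambda>s. norm (nonlinearity \<sigma> (u s) - nonlinearity \<sigma> (v s))) integrable_on {0..T}"
      using \<sigma> by (intro integrable_continuous_real continuous_intros continuous_on_nonlinearity cont) auto
    show "(\<lambda>s. (2 * \<sigma> + 1) * D * (sup_norm (u s) powr (2 * \<sigma>) + sup_norm (v s) powr (2 * \<sigma>))) integrable_on {0..T}"
      by (intro integrable_on_mult_right integrable_add int)
    fix s assume s: "s \<in> {0..T}"
    have "norm (nonlinearity \<sigma> (u s) - nonlinearity \<sigma> (v s))
        \<le> (2 * \<sigma> + 1) * max (sup_norm (u s)) (sup_norm (v s)) powr (2 * \<sigma>) * norm (u s - v s)"
      using \<sigma> by (intro nonlinearity_diff_le) simp
    also have "\<dots> \<le> (2 * \<sigma> + 1) * (sup_norm (u s) powr (2 * \<sigma>) + sup_norm (v s) powr (2 * \<sigma>)) * D"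
      using \<sigma> s by (intro mult_mono D) (auto simp: max_def)
    finally show "norm (nonlinearity \<sigma> (u s) - nonlinearity \<sigma> (v s))
        \<le> (2 * \<sigma> + 1) * D * (sup_norm (u s) powr (2 * \<sigma>) + sup_norm (v s) powr (2 * \<sigma>))"
      by (simp add: mult_ac)
  qed
  also have "\<dots> = (2 * \<sigma> + 1) * D * (integral {0..T} (\<lambda>s. sup_norm (u s) powr (2 * \<sigma>)) +
      integral {0..T} (\<lambda>s. sup_norm (v s) powr (2 * \<sigma>)))"
    by (simp add: Henstock_Kurzweil_Integration.integral_add[OF int])
  also have "\<dots> \<le> (2 * \<sigma> + 1) * D * (M powr (2 * \<sigma>) + M powr (2 * \<sigma>))"
    using \<sigma> D0 M u v T
    by (intro mult_left_mono add_mono strichartz_bounded_integral_powr) (auto simp: in_ball_def)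
  finally show ?thesis by (simp add: algebra_simps)
qed

lemma in_ball_zero: "0 \<le> M \<Longrightarrow> in_ball M (\<lambda>_. 0)"
  by (simp add: in_ball_def strichartz_bounded_def)

lemma integral_nonlinearity_le:
  assumes \<sigma>: "3 \<le> \<sigma>" and M: "0 < M" and u: "in_ball M u" and T: "0 \<le> T"
  shows "integral {0..T} (\<lambda>s. norm (nonlinearity \<sigma> (u s))) \<le> 2 * (2 * \<sigma> + 1) * M powr (2 * \<sigma>) * M"
  using integral_nonlinearity_diff_le[OF \<sigma> M u in_ball_zero _ T, of M] M u \<sigma> by (simp add: in_ball_def)

text \<open>The constants make the ball invariant: with the Strichartz constant 100,
  \<open>f0\<close> and \<open>f1\<close> cost \<open>M / 4\<close> each. Smallness puts the
  nonlinearity below \<open>M / 200\<close> in \<open>L\<^sup>1 l\<^sup>2\<close>, which Duhamel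
  turns into \<open>M / 2\<close>. The contraction factor 1/2 is then met with a wide
  margin.\<close>

locale small_data =
  fixes \<sigma> \<mu> M :: real and f0 f1 :: ell2
  assumes \<sigma>: "3 \<le> \<sigma>" and \<mu>: "\<bar>\<mu>\<bar> \<le> 1" and M: "0 < M"
    and small: "400 * (2 * \<sigma> + 1) * M powr (2 * \<sigma>) \<le> 1"
    and f0: "norm f0 \<le> M / 400" and f1: "norm f1 \<le> M / 400"
begin

lemma \<sigma>_nonneg: "0 \<le> \<sigma>" using \<sigma> by simp

lemma small': "(2 * \<sigma> + 1) * M powr (2 * \<sigma>) \<le> 1 / 400"
  using small by (simp add: algebra_simps)

lemma continuous_nonlinearity:
  "in_ball M u \<Longrightarrow> continuous_on {0..} (\<lambda>s. nonlinearity \<sigma> (u s))"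
  by (intro continuous_on_nonlinearity \<sigma>_nonneg) (simp add: in_ball_def)

lemma integral_nonlinearity:
  assumes "in_ball M u" "0 \<le> T"
  shows "integral {0..T} (\<lambda>s. norm (nonlinearity \<sigma> (u s))) \<le> M / 200"
proof -
  have "2 * (2 * \<sigma> + 1) * M powr (2 * \<sigma>) \<le> 1 / 200"
    using small' by linarith
  then have "2 * (2 * \<sigma> + 1) * M powr (2 * \<sigma>) * M \<le> 1 / 200 * M"
    using M by (intro mult_right_mono) auto
  then show ?thesis using integral_nonlinearity_le[OF \<sigma> M assms] by simp
qed

lemma kg_map_lipschitz:
  assumes u: "in_ball M u" and "0 \<le> s" "0 \<le> t"
  shows "norm (kg_map \<sigma> \<mu> f0 f1 u t - kg_map \<sigma> \<mu> f0 f1 u s) \<le> 3 * M * \<bar>t - s\<bar>"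
proof -
  have "norm (nonlinearity \<sigma> (u r)) \<le> M" if "0 \<le> r" for r
  proof -
    have le: "norm (u r) \<le> M" using u that by (simp add: in_ball_def)
    have "norm (nonlinearity \<sigma> (u r)) \<le> (2 * \<sigma> + 1) * sup_norm (u r) powr (2 * \<sigma>) * norm (u r)"
      by (rule norm_nonlinearity_le[OF \<sigma>_nonneg])
    also have "\<dots> \<le> (2 * \<sigma> + 1) * M powr (2 * \<sigma>) * M"
      using \<sigma> le M order_trans[OF sup_norm_le_norm le]
      by (intro mult_mono powr_mono2) auto
    also have "\<dots> \<le> 1 * M" using small' M by (intro mult_right_mono) linarith+
    finally show ?thesis by simp
  qed
  then have D: "norm (duhamel (\<lambda>s. nonlinearity \<sigma> (u s)) t - duhamel (\<lambda>s. nonlinearity \<sigma> (u s)) s)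
      \<le> (M / 200 + M) * \<bar>t - s\<bar>"
    by (intro duhamel_lipschitz continuous_nonlinearity integral_nonlinearity assms)
  have eq: "kg_map \<sigma> \<mu> f0 f1 u t - kg_map \<sigma> \<mu> f0 f1 u s = (cos_propagator t f0 - cos_propagator s f0) +
      (sin_propagator t f1 - sin_propagator s f1) -
      \<mu> *\<^sub>R (duhamel (\<lambda>s. nonlinearity \<sigma> (u s)) t - duhamel (\<lambda>s. nonlinearity \<sigma> (u s)) s)"
    by (simp add: kg_map_def scaleR_diff_right)
  have "norm (kg_map \<sigma> \<mu> f0 f1 u t - kg_map \<sigma> \<mu> f0 f1 u s) \<le> norm (cos_propagator t f0 - cos_propagator s f0) +
      norm (sin_propagator t f1 - sin_propagator s f1) +
      \<bar>\<mu>\<bar> * norm (duhamel (\<lambda>s. nonlinearity \<sigma> (u s)) t - duhamel (\<lambda>s. nonlinearity \<sigma> (u s)) s)"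
    unfolding eq norm_scaleR[symmetric]
    by (intro order_trans[OF norm_triangle_ineq4] add_right_mono norm_triangle_ineq)
  also have "\<dots> \<le> 3 * \<bar>t - s\<bar> * (M / 400) + \<bar>t - s\<bar> * (M / 400) + 1 * ((M / 200 + M) * \<bar>t - s\<bar>)"
  proof (intro add_mono mult_mono \<mu> D)
    show "norm (cos_propagator t f0 - cos_propagator s f0) \<le> 3 * \<bar>t - s\<bar> * (M / 400)"
      by (rule order_trans[OF propagators_lipschitz(1)]) (intro mult_left_mono f0; simp)
    show "norm (sin_propagator t f1 - sin_propagator s f1) \<le> \<bar>t - s\<bar> * (M / 400)"
      by (rule order_trans[OF propagators_lipschitz(2)]) (intro mult_left_mono f1; simp)
  qed auto
  also have "\<dots> \<le> 3 * M * \<bar>t - s\<bar>"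
  proof -
    have "0 \<le> M * \<bar>t - s\<bar>" using M by simp
    then show ?thesis by (simp add: algebra_simps)
  qed
  finally show ?thesis .
qed

lemma kg_map_in_ball:
  assumes u: "in_ball M u"
  shows "in_ball M (kg_map \<sigma> \<mu> f0 f1 u)"
  unfolding in_ball_def
proof (intro conjI allI impI)
  define G where "G = duhamel (\<lambda>s. nonlinearity \<sigma> (u s))"
  show "continuous_on {0..} (kg_map \<sigma> \<mu> f0 f1 u)"
    by (rule lipschitz_on_continuous_on[of "3 * M"])
       (use kg_map_lipschitz[OF u] M in \<open>auto simp: lipschitz_on_def dist_norm\<close>)
  fix t :: real assume "0 \<le> t"
  have "norm (G t) \<le> M / 200"
    unfolding G_def
    by (rule order_trans[OF norm_duhamel_le[OF continuous_nonlinearity[OF u]] integral_nonlinearity[OF u \<open>0 \<le> t\<close>]])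
  then have "\<bar>\<mu>\<bar> * norm (G t) \<le> 1 * (M / 200)" using \<mu> by (intro mult_mono) auto
  then have "norm (cos_propagator t f0) + norm (sin_propagator t f1) + norm (\<mu> *\<^sub>R G t) \<le> M"
    using norm_propagators_le(1)[of t f0] norm_propagators_le(2)[of t f1] f0 f1 M by simp
  then show "norm (kg_map \<sigma> \<mu> f0 f1 u t) \<le> M"
    unfolding kg_map_def G_def[symmetric]
    using norm_triangle_ineq4[of "cos_propagator t f0 + sin_propagator t f1" "\<mu> *\<^sub>R G t"]
      norm_triangle_ineq[of "cos_propagator t f0" "sin_propagator t f1"] by linarith
next
  define G where "G = duhamel (\<lambda>s. nonlinearity \<sigma> (u s))"
  have "strichartz_bounded G (100 * (M / 200))"
    unfolding G_def by (intro strichartz_bounded_duhamel continuous_nonlinearity integral_nonlinearity u)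
  then have "strichartz_bounded (\<lambda>t. (cos_propagator t f0 + sin_propagator t f1) + (- \<mu>) *\<^sub>R G t)
      ((100 * norm f0 + 100 * norm f1) + \<bar>- \<mu>\<bar> * (100 * (M / 200)))"
    by (intro strichartz_bounded_add strichartz_bounded_propagators strichartz_bounded_scaleR)
  moreover have "\<bar>- \<mu>\<bar> * (100 * (M / 200)) \<le> 1 * (100 * (M / 200))"
    using \<mu> M by (intro mult_right_mono) auto
  then have "(100 * norm f0 + 100 * norm f1) + \<bar>- \<mu>\<bar> * (100 * (M / 200)) \<le> M"
    using f0 f1 by simp
  ultimately show "strichartz_bounded (kg_map \<sigma> \<mu> f0 f1 u) M"
    unfolding kg_map_def[abs_def] G_def[symmetric]
    using strichartz_bounded_mono by (auto simp: algebra_simps)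
qed

lemma kg_map_contraction:
  assumes u: "in_ball M u" and v: "in_ball M v" and D: "\<And>t. 0 \<le> t \<Longrightarrow> norm (u t - v t) \<le> D" and t: "0 \<le> t"
  shows "norm (kg_map \<sigma> \<mu> f0 f1 u t - kg_map \<sigma> \<mu> f0 f1 v t) \<le> 1/2 * D"
proof -
  have D0: "0 \<le> D" using D[of 0] norm_ge_zero[of "u 0 - v 0"] by linarith
  have "kg_map \<sigma> \<mu> f0 f1 u t - kg_map \<sigma> \<mu> f0 f1 v t =
     - (\<mu> *\<^sub>R (duhamel (\<lambda>s. nonlinearity \<sigma> (u s)) t - duhamel (\<lambda>s. nonlinearity \<sigma> (v s)) t))"
    by (simp add: kg_map_def scaleR_diff_right)
  also have "\<dots> = - (\<mu> *\<^sub>R duhamel (\<lambda>s. nonlinearity \<sigma> (u s) - nonlinearity \<sigma> (v s)) t)"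
    by (subst duhamel_diff) (use u v in \<open>auto intro: continuous_nonlinearity\<close>)
  also have "norm \<dots> \<le> 1 * norm (duhamel (\<lambda>s. nonlinearity \<sigma> (u s) - nonlinearity \<sigma> (v s)) t)"
    unfolding norm_minus_cancel norm_scaleR by (intro mult_right_mono \<mu>) auto
  also have "\<dots> \<le> integral {0..t} (\<lambda>s. norm (nonlinearity \<sigma> (u s) - nonlinearity \<sigma> (v s)))"
    unfolding mult_1 by (intro norm_duhamel_le continuous_intros continuous_nonlinearity u v)
  also have "\<dots> \<le> 2 * (2 * \<sigma> + 1) * M powr (2 * \<sigma>) * D"
    by (intro integral_nonlinearity_diff_le \<sigma> M u v D t)
  also have "\<dots> \<le> 1/2 * D" using small' D0 by (intro mult_right_mono) linarith+
  finally show ?thesis .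
qed

lemma ex_fixed_point: "\<exists>u. in_ball M u \<and> (\<forall>t\<ge>0. u t = kg_map \<sigma> \<mu> f0 f1 u t)"
proof -
  define X where "X = {w :: real \<Rightarrow>\<^sub>C ell2. (\<forall>t. norm (w t) \<le> M) \<and> strichartz_bounded w M}"
  \<comment> \<open>The curves live on the whole line; \<open>max t 0\<close> continues the image
    constantly to negative times, where \<open>kg_map\<close> is not under control.\<close>
  define \<Phi> where "\<Phi> w = Bcontfun (\<lambda>t. kg_map \<sigma> \<mu> f0 f1 (apply_bcontfun w) (max t 0))" for w :: "real \<Rightarrow>\<^sub>C ell2"
  have ball: "in_ball M (apply_bcontfun w)" if "w \<in> X" for w
    using that by (auto simp: X_def in_ball_def)
  have apply_\<Phi>: "apply_bcontfun (\<Phi> w) = (\<lambda>t. kg_map \<sigma> \<mu> f0 f1 (apply_bcontfun w) (max t 0))" if "w \<in> X" for w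
  proof -
    have b: "in_ball M (kg_map \<sigma> \<mu> f0 f1 (apply_bcontfun w))" by (rule kg_map_in_ball[OF ball[OF that]])
    have "(\<lambda>t. kg_map \<sigma> \<mu> f0 f1 (apply_bcontfun w) (max t 0)) \<in> bcontfun"
    proof (rule bcontfun_normI)
      show "continuous_on UNIV (\<lambda>t. kg_map \<sigma> \<mu> f0 f1 (apply_bcontfun w) (max t 0))"
        using b unfolding in_ball_def
        by (elim conjE, elim continuous_on_compose2) (auto intro: continuous_intros)
      show "norm (kg_map \<sigma> \<mu> f0 f1 (apply_bcontfun w) (max t 0)) \<le> M" for t
        using b by (simp add: in_ball_def)
    qed
    then show ?thesis unfolding \<Phi>_def by (rule Bcontfun_inverse)
  qed
  have closed: "closed X"
    unfolding closed_sequential_limits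
  proof (intro allI impI, elim conjE)
    fix w l assume w: "\<forall>n. w n \<in> X" and "w \<longlonglongrightarrow> l"
    then have "uniform_limit UNIV (\<lambda>n. apply_bcontfun (w n)) (apply_bcontfun l) sequentially"
      by (intro tendsto_bcontfun_uniform_limit)
    then have lim: "(\<lambda>n. w n t) \<longlonglongrightarrow> l t" for t
      by (rule tendsto_uniform_limitI) simp
    have "norm (l t) \<le> M" for t
      using tendsto_norm[OF lim[of t]] by (rule LIMSEQ_le_const2) (use w in \<open>auto simp: X_def\<close>)
    moreover have "strichartz_bounded l M"
      by (rule strichartz_bounded_lim[where u = "\<lambda>n. apply_bcontfun (w n)"]) (use w lim in \<open>auto simp: X_def\<close>)
    ultimately show "l \<in> X" by (simp add: X_def)
  qed
  have "\<exists>!w\<in>X. \<Phi> w = w"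
  proof (rule Banach_fix[where c = "1/2"])
    show "complete X" using closed by (simp add: complete_eq_closed)
    have "0 \<in> X" using in_ball_zero[of M] M by (simp add: X_def in_ball_def)
    then show "X \<noteq> {}" by blast
    show "\<Phi> ` X \<subseteq> X"
    proof (intro image_subsetI)
      fix w assume w: "w \<in> X"
      have b: "in_ball M (kg_map \<sigma> \<mu> f0 f1 (apply_bcontfun w))" by (rule kg_map_in_ball[OF ball[OF w]])
      then have "strichartz_bounded (apply_bcontfun (\<Phi> w)) M"
        unfolding apply_\<Phi>[OF w] in_ball_def by (auto elim: strichartz_bounded_cong)
      moreover have "norm (\<Phi> w t) \<le> M" for t using b unfolding apply_\<Phi>[OF w] by (simp add: in_ball_def)
      ultimately show "\<Phi> w \<in> X" by (simp add: X_def)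
    qed
    show "dist (\<Phi> v) (\<Phi> w) \<le> 1/2 * dist v w" if v: "v \<in> X" and w: "w \<in> X" for v w
    proof (rule dist_bound)
      fix t
      show "dist (\<Phi> v t) (\<Phi> w t) \<le> 1/2 * dist v w"
        unfolding apply_\<Phi>[OF v] apply_\<Phi>[OF w] dist_norm[of "kg_map _ _ _ _ _ _"]
        by (intro kg_map_contraction ball v w) (auto simp: dist_norm[symmetric] dist_bounded)
    qed
  qed auto
  then obtain w where w: "w \<in> X" "\<Phi> w = w" by blast
  then have "w t = kg_map \<sigma> \<mu> f0 f1 (apply_bcontfun w) t" if "0 \<le> t" for t
    using apply_\<Phi>[OF w(1)] that by (metis max_absorb1)
  then show ?thesis using ball[OF w(1)] by blast
qed

lemma fixed_point_tendsto_0: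
  assumes u: "in_ball M u" and fp: "\<And>t. 0 \<le> t \<Longrightarrow> u t = kg_map \<sigma> \<mu> f0 f1 u t"
  shows "((\<lambda>t. sup_norm (u t)) \<longlongrightarrow> 0) at_top"
proof (rule tendstoI)
  fix e :: real assume e: "e > 0"
  have lip: "\<bar>sup_norm (u t) - sup_norm (u s)\<bar> \<le> 3 * M * \<bar>t - s\<bar>" if "0 \<le> s" "0 \<le> t" for s t
    using order_trans[OF sup_norm_lipschitz kg_map_lipschitz[OF u that, folded fp[OF that(1)] fp[OF that(2)]]] .
  have grid: "(\<lambda>j. sup_norm (u (\<theta> + real j))) \<longlonglongrightarrow> 0" if "0 \<le> \<theta>" for \<theta>
  proof -
    have "summable (\<lambda>j. sup_norm (u (\<theta> + real j)) ^ 6)"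
      using strichartz_bounded_sum_sup_norm[of u M \<theta>] u M that
      by (intro bounded_imp_summable[where B = "M ^ 6"]) (auto simp: in_ball_def lessThan_Suc_atMost[symmetric] simp del: sum.lessThan_Suc)
    then have "(\<lambda>j. root 6 (sup_norm (u (\<theta> + real j)) ^ 6)) \<longlonglongrightarrow> root 6 0"
      by (intro tendsto_real_root summable_LIMSEQ_zero)
    then show ?thesis by (simp add: real_root_power_cancel)
  qed
  \<comment> \<open>With mesh \<open>1 / m\<close> the sup norm varies by at most
    \<open>3 * M / m\<close> between a time and the mesh point before it; this choice puts the
    variation below \<open>e / 2\<close>.\<close>
  obtain m :: nat where m: "6 * M / e < real m" using reals_Archimedean2 by blast
  then have m0: "0 < real m" using e M by (smt (verit) divide_pos_pos mult_pos_pos)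
  have mesh: "3 * M * (1 / real m) < e / 2" using m m0 e by (simp add: field_simps)
  \<comment> \<open>The mesh points split into \<open>m\<close> grids of unit step with offsets
    \<open>i / m\<close>; as these are finitely many, one threshold \<open>J\<close> serves all of
    them.\<close>
  have "\<forall>\<^sub>F j in sequentially. \<forall>i\<in>{..<m}. sup_norm (u (real i / real m + real j)) < e / 2"
    using e by (intro eventually_ball_finite ballI order_tendstoD(2)[OF grid]) auto
  then obtain J where J: "\<And>j i. J \<le> j \<Longrightarrow> i < m \<Longrightarrow> sup_norm (u (real i / real m + real j)) < e / 2"
    unfolding eventually_sequentially by auto
  have "sup_norm (u t) < e" if t: "real J + 1 \<le> t" for t
  proof -
    define j where "j = nat \<lfloor>t\<rfloor>"
    have j: "real j \<le> t" "t < real j + 1" using t by (auto simp: j_def)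
    define i where "i = nat \<lfloor>real m * (t - real j)\<rfloor>"
    have "0 \<le> real m * (t - real j)" using j m0 by simp
    then have i: "real i \<le> real m * (t - real j)" "real m * (t - real j) < real i + 1" by (auto simp: i_def)
    have "real m * (t - real j) < real m * 1" using j m0 by (intro mult_strict_left_mono) auto
    then have "i < m" using i by linarith
    moreover have "J \<le> j" using j t by linarith
    ultimately have "sup_norm (u (real i / real m + real j)) < e / 2" by (rule J[rotated])
    moreover have "\<bar>t - (real i / real m + real j)\<bar> \<le> 1 / real m"
    proof -
      have "real i / real m \<le> t - real j" "t - real j \<le> real i / real m + 1 / real m"
        using i m0 by (auto simp: field_simps)
      then show ?thesis by linarith
    qed
    then have "3 * M * \<bar>t - (real i / real m + real j)\<bar> \<le> 3 * M * (1 / real m)"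
      using M by (intro mult_left_mono) auto
    moreover have "\<bar>sup_norm (u t) - sup_norm (u (real i / real m + real j))\<bar> \<le> 3 * M * \<bar>t - (real i / real m + real j)\<bar>"
      using j by (intro lip) auto
    ultimately show ?thesis using mesh by linarith
  qed
  then show "\<forall>\<^sub>F t in at_top. dist (sup_norm (u t)) 0 < e"
    by (intro eventually_at_top_linorderI[of "real J + 1"]) auto
qed

end

text \<open>Uniqueness holds among all continuous curves, small or not: on \<open>[0, T]\<close>
  both solutions are bounded by compactness, the nonlinearity is Lipschitz on bounded sets, and
  Gronwall applies to the norm of the difference.\<close>

lemma kg_map_fixed_point_unique:
  assumes \<sigma>: "0 \<le> \<sigma>" and u: "continuous_on {0..} u" and v: "continuous_on {0..} v"
    and fu: "\<And>t. 0 \<le> t \<Longrightarrow> u t = kg_map \<sigma> \<mu> f0 f1 u t" and fv: "\<And>t. 0 \<le> t \<Longrightarrow> v t = kg_map \<sigma> \<mu> f0 f1 v t"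
    and T: "0 \<le> T"
  shows "u T = v T"
proof -
  have cont: "continuous_on {0..T} u" "continuous_on {0..T} v"
    using u v by (auto intro: continuous_on_subset)
  then have "bounded (u ` {0..T} \<union> v ` {0..T})"
    by (intro bounded_Un[THEN iffD2] conjI compact_imp_bounded compact_continuous_image) auto
  then obtain R where "\<forall>x\<in>u ` {0..T} \<union> v ` {0..T}. norm x \<le> R"
    unfolding bounded_iff by blast
  then have R: "\<And>t. t \<in> {0..T} \<Longrightarrow> norm (u t) \<le> R" "\<And>t. t \<in> {0..T} \<Longrightarrow> norm (v t) \<le> R"
    by auto
  define \<Lambda> where "\<Lambda> = \<bar>\<mu>\<bar> * ((2 * \<sigma> + 1) * R powr (2 * \<sigma>))"
  have "norm (u T - v T) = 0"
  proof (rule Gronwall_zero[where T = T and \<Lambda> = \<Lambda> and d = "\<lambda>t. norm (u t - v t)"])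
    show "continuous_on {0..T} (\<lambda>t. norm (u t - v t))" by (intro continuous_intros cont)
    show "0 \<le> \<Lambda>" using \<sigma> by (simp add: \<Lambda>_def)
    fix t assume t: "t \<in> {0..T}"
    have cont': "continuous_on {0..t} u" "continuous_on {0..t} v"
      using u v by (auto intro: continuous_on_subset)
    have NL: "continuous_on {0..} (\<lambda>s. nonlinearity \<sigma> (u s))" "continuous_on {0..} (\<lambda>s. nonlinearity \<sigma> (v s))"
      using u v \<sigma> by (auto intro: continuous_on_nonlinearity)
    have "u t - v t = kg_map \<sigma> \<mu> f0 f1 u t - kg_map \<sigma> \<mu> f0 f1 v t" using fu[of t] fv[of t] t by simp
    also have "\<dots> = - (\<mu> *\<^sub>R (duhamel (\<lambda>s. nonlinearity \<sigma> (u s)) t - duhamel (\<lambda>s. nonlinearity \<sigma> (v s)) t))"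
      by (simp add: kg_map_def scaleR_diff_right)
    also have "\<dots> = - (\<mu> *\<^sub>R duhamel (\<lambda>s. nonlinearity \<sigma> (u s) - nonlinearity \<sigma> (v s)) t)"
      by (simp only: duhamel_diff[OF NL])
    finally have "norm (u t - v t) = \<bar>\<mu>\<bar> * norm (duhamel (\<lambda>s. nonlinearity \<sigma> (u s) - nonlinearity \<sigma> (v s)) t)"
      by simp
    also have "\<dots> \<le> \<bar>\<mu>\<bar> * integral {0..t} (\<lambda>s. norm (nonlinearity \<sigma> (u s) - nonlinearity \<sigma> (v s)))"
      by (intro mult_left_mono norm_duhamel_le continuous_intros NL) auto
    also have "\<dots> \<le> \<bar>\<mu>\<bar> * integral {0..t} (\<lambda>s. ((2 * \<sigma> + 1) * R powr (2 * \<sigma>)) * norm (u s - v s))"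
    proof (intro mult_left_mono integral_le integrable_continuous_real continuous_intros cont'
        continuous_on_nonlinearity \<sigma>)
      fix s assume "s \<in> {0..t}"
      then have s: "norm (u s) \<le> R" "norm (v s) \<le> R" using R t by auto
      show "norm (nonlinearity \<sigma> (u s) - nonlinearity \<sigma> (v s)) \<le> ((2 * \<sigma> + 1) * R powr (2 * \<sigma>)) * norm (u s - v s)"
        using \<sigma> s sup_norm_le_norm[of "u s"] sup_norm_le_norm[of "v s"]
        by (intro order_trans[OF nonlinearity_diff_le] mult_right_mono mult_left_mono powr_mono2)
           (auto simp: le_max_iff_disj)
    qed auto
    also have "\<dots> = \<Lambda> * integral {0..t} (\<lambda>s. norm (u s - v s))" by (simp add: \<Lambda>_def)
    finally show "norm (u t - v t) \<le> \<Lambda> * integral {0..t} (\<lambda>s. norm (u s - v s))" .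
  qed (use T in auto)
  then show ?thesis by simp
qed

section \<open>Transfer to the extended-real-valued norms\<close>

lemma epowr_ennreal: "0 \<le> x \<Longrightarrow> epowr (ennreal x) p = ennreal (x powr p)"
  by (simp add: epowr_def)

lemma epowr_le_ennreal: "y \<le> ennreal x \<Longrightarrow> 0 \<le> x \<Longrightarrow> 0 \<le> p \<Longrightarrow> epowr y p \<le> ennreal (x powr p)"
  by (cases y) (auto simp: epowr_def top_unique intro!: ennreal_leI powr_mono2)

lemma nn_integral_coord_square:
  "(\<integral>\<^sup>+n. ennreal ((cmod (coord f n))\<^sup>2) \<partial>count_space UNIV) = ennreal ((norm f)\<^sup>2)"
proof -
  have s: "((\<lambda>n. (cmod (coord f n))\<^sup>2) has_sum (norm f)\<^sup>2) UNIV" by (rule coord_square_has_sum)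
  then have "Infinite_Sum.abs_summable_on (\<lambda>n. (cmod (coord f n))\<^sup>2) UNIV"
    by (simp add: has_sum_imp_summable)
  then have a: "Infinite_Set_Sum.abs_summable_on (\<lambda>n. (cmod (coord f n))\<^sup>2) UNIV"
    by (simp only: abs_summable_equivalent)
  then have "(\<integral>\<^sup>+n. ennreal ((cmod (coord f n))\<^sup>2) \<partial>count_space UNIV) = ennreal (infsetsum (\<lambda>n. (cmod (coord f n))\<^sup>2) UNIV)"
    by (intro nn_integral_conv_infsetsum) auto
  also have "infsetsum (\<lambda>n. (cmod (coord f n))\<^sup>2) UNIV = (norm f)\<^sup>2"
    using infsetsum_infsum[OF a] s by (simp add: infsumI)
  finally show ?thesis .
qed

lemma lp_norm_2_coord: "lp_norm 2 (coord f) = ennreal (norm f)"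
proof -
  have "(\<lambda>n. epowr (ennreal (cmod (coord f n))) 2) = (\<lambda>n. ennreal ((cmod (coord f n))\<^sup>2))"
    by (simp add: epowr_ennreal)
  then show ?thesis
    by (simp add: lp_norm_def Lp_norm_def nn_integral_coord_square epowr_ennreal powr_half_sqrt)
qed

lemma ell2_of_lp_norm_le:
  assumes "lp_norm 2 g \<le> ennreal B" "0 \<le> B"
  obtains f where "coord f = g" "norm f \<le> B"
proof (rule ell2_of_bounded_sums[where f = g and B = B])
  fix F :: "int set" assume F: "finite F"
  define I where "I = (\<integral>\<^sup>+n. ennreal ((cmod (g n))\<^sup>2) \<partial>count_space UNIV)"
  have "(\<lambda>n. epowr (ennreal (cmod (g n))) 2) = (\<lambda>n. ennreal ((cmod (g n))\<^sup>2))"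
    by (simp add: epowr_ennreal)
  then have le: "epowr I (1/2) \<le> ennreal B" using assms(1) by (simp add: lp_norm_def Lp_norm_def I_def)
  then obtain i where i: "I = ennreal i" "0 \<le> i" by (cases I) (auto simp: epowr_def top_unique)
  then have "sqrt i \<le> B" using le assms(2) by (simp add: epowr_ennreal powr_half_sqrt)
  then have "i \<le> B\<^sup>2" using i(2) assms(2) by (simp add: sqrt_le_D)
  have "ennreal (\<Sum>n\<in>F. (cmod (g n))\<^sup>2) = (\<Sum>n\<in>F. if n \<in> F then ennreal ((cmod (g n))\<^sup>2) else 0)"
    by (simp add: sum_ennreal)
  also have "\<dots> = (\<integral>\<^sup>+n. (if n \<in> F then ennreal ((cmod (g n))\<^sup>2) else 0) \<partial>count_space UNIV)"
    by (rule nn_integral_count_space'[symmetric]) (use F in auto)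
  also have "\<dots> \<le> I" unfolding I_def by (intro nn_integral_mono) auto
  finally have "(\<Sum>n\<in>F. (cmod (g n))\<^sup>2) \<le> i" using i by simp
  then show "(\<Sum>n\<in>F. (cmod (g n))\<^sup>2) \<le> B\<^sup>2" using \<open>i \<le> B\<^sup>2\<close> by simp
qed (use assms that in auto)

text \<open>The weight of the sup norm in the interpolation of \<open>l\<^sup>r\<close> between \<open>l\<^sup>2\<close> and \<open>l\<^sup>\<infinity>\<close>.\<close>

definition interpolation_weight :: "ennreal \<Rightarrow> real" where
  "interpolation_weight r = (if r = \<infinity> then 1 else 1 - 2 / enn2real r)"

text \<open>For finite exponent \<rho> this is the pointwise inequality
  \<open>|f n|^\<rho> \<le> sup_norm f powr (\<rho> - 2) * |f n|^2\<close>, summed over the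
  sites.\<close>

lemma lp_norm_coord_le:
  assumes r: "2 \<le> r"
  shows "lp_norm r (coord f) \<le>
    ennreal (norm f powr (1 - interpolation_weight r) * sup_norm f powr interpolation_weight r)"
proof (cases r)
  case top
  have "ennreal (cmod (coord f n)) \<le> ennreal (norm f powr 0 * sup_norm f powr 1)" for n
  \<comment> \<open>As \<open>0 powr 0 = 0\<close>, the factor \<open>norm f powr 0\<close> is 1
    only for nonzero \<open>f\<close>; for \<open>f = 0\<close> both sides vanish.\<close>
  proof (cases "norm f = 0")
    case False
    then show ?thesis by (simp add: norm_coord_le_sup_norm ennreal_leI)
  qed simp
  then show ?thesis using top
    by (auto simp: lp_norm_def Lp_norm_def interpolation_weight_def intro!: SUP_least)
next
  case (real \<rho>)
  then have \<rho>: "2 \<le> \<rho>" using r by simp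
  have w: "interpolation_weight r = 1 - 2 / \<rho>" using real by (simp add: interpolation_weight_def)
  have "(\<integral>\<^sup>+n. epowr (ennreal (cmod (coord f n))) \<rho> \<partial>count_space UNIV)
      \<le> (\<integral>\<^sup>+n. ennreal (sup_norm f powr (\<rho> - 2)) * ennreal ((cmod (coord f n))\<^sup>2) \<partial>count_space UNIV)"
  proof (intro nn_integral_mono)
    fix n
    have "cmod (coord f n) powr \<rho> \<le> sup_norm f powr (\<rho> - 2) * (cmod (coord f n))\<^sup>2"
    proof (cases "coord f n = 0")
      case False
      then have "cmod (coord f n) powr \<rho> = cmod (coord f n) powr (\<rho> - 2) * cmod (coord f n) powr 2"
        by (simp only: powr_add[symmetric]) simp
      also have "\<dots> \<le> sup_norm f powr (\<rho> - 2) * cmod (coord f n) powr 2"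
        using \<rho> norm_coord_le_sup_norm[of f n] by (intro mult_right_mono powr_mono2) auto
      finally show ?thesis using False by simp
    qed simp
    then show "epowr (ennreal (cmod (coord f n))) \<rho> \<le> ennreal (sup_norm f powr (\<rho> - 2)) * ennreal ((cmod (coord f n))\<^sup>2)"
      by (simp add: epowr_ennreal ennreal_mult[symmetric] ennreal_leI)
  qed
  also have "\<dots> = ennreal (sup_norm f powr (\<rho> - 2)) * ennreal ((norm f)\<^sup>2)"
    by (simp add: nn_integral_cmult nn_integral_coord_square)
  also have "\<dots> = ennreal (sup_norm f powr (\<rho> - 2) * (norm f)\<^sup>2)" by (simp add: ennreal_mult)
  finally have "epowr (\<integral>\<^sup>+n. epowr (ennreal (cmod (coord f n))) \<rho> \<partial>count_space UNIV) (1 / \<rho>)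
      \<le> ennreal ((sup_norm f powr (\<rho> - 2) * (norm f)\<^sup>2) powr (1 / \<rho>))"
    using \<rho> by (intro epowr_le_ennreal) auto
  also have "(sup_norm f powr (\<rho> - 2) * (norm f)\<^sup>2) powr (1 / \<rho>) = norm f powr (2 / \<rho>) * sup_norm f powr (1 - 2 / \<rho>)"
  proof (cases "norm f = 0")
    case False
    then have "(norm f)\<^sup>2 = norm f powr 2" by simp
    then have "(sup_norm f powr (\<rho> - 2) * (norm f)\<^sup>2) powr (1 / \<rho>) =
        sup_norm f powr ((\<rho> - 2) * (1 / \<rho>)) * norm f powr (2 * (1 / \<rho>))"
      by (simp only: powr_mult powr_powr)
    also have "(\<rho> - 2) * (1 / \<rho>) = 1 - 2 / \<rho>" using \<rho> by (simp add: field_simps)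
    finally show ?thesis by simp
  qed simp
  finally show ?thesis using real \<rho> w by (simp add: lp_norm_def Lp_norm_def)
qed

lemma nn_integral_le_of_integral_le:
  fixes g :: "real \<Rightarrow> real"
  assumes g: "continuous_on {0..} g" and nonneg: "\<And>t. 0 \<le> t \<Longrightarrow> 0 \<le> g t"
    and le: "\<And>T. 0 \<le> T \<Longrightarrow> integral {0..T} g \<le> B"
  shows "(\<integral>\<^sup>+t. ennreal (g t) \<partial>restrict_space lborel {0..}) \<le> ennreal B"
proof -
  \<comment> \<open>\<open>max t 0\<close> continues \<open>g\<close> to the whole line, which
    yields measurability; the cutoffs at \<open>N\<close> then exhaust the half-line
    monotonically.\<close>
  define h where "h N t = ennreal (g (max t 0)) * indicator {0..real N} t" for N :: nat and t
  have "continuous_on UNIV (\<lambda>t. g (max t 0))"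
    by (intro continuous_on_compose2[OF g] continuous_intros) auto
  then have "(\<lambda>t. g (max t 0)) \<in> borel_measurable borel" by (rule borel_measurable_continuous_onI)
  then have meas: "h N \<in> borel_measurable lborel" for N
    unfolding h_def by (auto intro!: borel_measurable_times_ennreal measurable_compose[OF _ measurable_ennreal])
  have "incseq h"
    by (auto simp: incseq_def le_fun_def h_def intro!: mult_left_mono split: split_indicator)
  have "(\<integral>\<^sup>+t. ennreal (g t) \<partial>restrict_space lborel {0..}) = (\<integral>\<^sup>+t. ennreal (g t) * indicator {0..} t \<partial>lborel)"
    by (rule nn_integral_restrict_space) simp
  also have "\<dots> \<le> (\<integral>\<^sup>+t. (SUP N. h N t) \<partial>lborel)"
  proof (intro nn_integral_mono)
    fix t :: real
    obtain N where "t \<le> real N" using real_arch_simple by blast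
    then have "ennreal (g t) * indicator {0..} t \<le> h N t" by (auto simp: h_def split: split_indicator)
    also have "\<dots> \<le> (SUP N. h N t)" by (intro SUP_upper) auto
    finally show "ennreal (g t) * indicator {0..} t \<le> (SUP N. h N t)" .
  qed
  also have "\<dots> = (SUP N. \<integral>\<^sup>+t. h N t \<partial>lborel)"
    by (rule nn_integral_monotone_convergence_SUP[OF \<open>incseq h\<close> meas])
  also have "\<dots> \<le> ennreal B"
  proof (rule SUP_least)
    fix N
    have "(g has_integral integral {0..real N} g) {0..real N}"
      by (intro integrable_integral integrable_continuous_real continuous_on_subset[OF g]) auto
    then have "(\<integral>\<^sup>+t. ennreal (g t) * indicator {0..real N} t \<partial>lborel) = ennreal (integral {0..real N} g)"
      by (intro nn_integral_has_integral_lebesgue') (auto intro: nonneg)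
    moreover have "(\<integral>\<^sup>+t. h N t \<partial>lborel) = (\<integral>\<^sup>+t. ennreal (g t) * indicator {0..real N} t \<partial>lborel)"
      by (intro nn_integral_cong) (auto simp: h_def split: split_indicator)
    ultimately show "(\<integral>\<^sup>+t. h N t \<partial>lborel) \<le> ennreal B" using le[of "real N"] by (simp add: ennreal_leI)
  qed
  finally show ?thesis .
qed

lemma interpolation_weight_bounds:
  assumes "2 \<le> r"
  shows "0 \<le> interpolation_weight r" "interpolation_weight r \<le> 1"
  using assms by (cases r; auto simp: interpolation_weight_def)+

text \<open>Multiplied by \<open>6 * \<kappa>\<close>, admissibility reads
  \<open>6 + 2 * \<kappa> / \<rho> \<le> \<kappa>\<close> for finite \<rho>. So in the \<kappa>-th
  power of the interpolated norm the sup norm carries an exponent of at least 6, which is what the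
  endpoint estimate controls.\<close>

lemma admissible_interpolation_weight:
  assumes adm: "strichartz_admissible (ennreal \<kappa>) r" and \<kappa>: "0 \<le> \<kappa>"
  shows "6 \<le> interpolation_weight r * \<kappa>"
proof -
  have r: "2 \<le> r" and \<kappa>2: "2 \<le> \<kappa>" and le: "1 / ennreal \<kappa> + 1 / (3 * r) \<le> 1 / 6"
    using adm by (auto simp: strichartz_admissible_def)
  have one: "1 / ennreal \<kappa> = ennreal (1 / \<kappa>)" using \<kappa>2 divide_ennreal[of 1 \<kappa>] by simp
  have six: "1 / 6 = ennreal (1 / 6)" using divide_ennreal[of 1 6] by simp
  show ?thesis
  proof (cases r)
    case top
    then have "ennreal (1 / \<kappa>) \<le> ennreal (1 / 6)" using le unfolding one six by (simp add: ennreal_mult_top)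
    then have "1 / \<kappa> \<le> 1 / 6" by (subst (asm) ennreal_le_iff) auto
    then show ?thesis using top \<kappa>2 by (simp add: interpolation_weight_def field_simps)
  next
    case (real \<rho>)
    then have \<rho>: "2 \<le> \<rho>" using r by simp
    have "1 / (3 * r) = ennreal (1 / (3 * \<rho>))"
      using \<rho> real divide_ennreal[of 1 "3 * \<rho>"] by (simp add: ennreal_mult)
    then have "ennreal (1 / \<kappa> + 1 / (3 * \<rho>)) \<le> ennreal (1 / 6)"
      using le \<kappa>2 \<rho> unfolding one six by (simp add: ennreal_plus)
    then have "1 / \<kappa> + 1 / (3 * \<rho>) \<le> 1 / 6" by (subst (asm) ennreal_le_iff) auto
    then have "(1 / \<kappa> + 1 / (3 * \<rho>)) * (6 * \<kappa>) \<le> 1 / 6 * (6 * \<kappa>)" using \<kappa>2 by (intro mult_right_mono) auto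
    moreover have "(1 / \<kappa> + 1 / (3 * \<rho>)) * (6 * \<kappa>) = 6 + 2 / \<rho> * \<kappa>" using \<kappa>2 \<rho> by (simp add: field_simps)
    ultimately show ?thesis using real \<kappa>2 by (simp add: interpolation_weight_def algebra_simps)
  qed
qed

text \<open>The interpolated bound at each time is raised to the power \<kappa>; the
  \<open>l\<^sup>2\<close> part is replaced by \<open>M\<close> and the sup norm is integrated with
  an exponent of at least 6. The powers of \<open>M\<close> recombine to
  \<open>M powr \<kappa>\<close>, so one constant serves all pairs.\<close>

lemma mixed_norm_le:
  assumes u: "in_ball M u" and M: "0 < M" and adm: "strichartz_admissible q r"
  shows "mixed_norm q r (\<lambda>t. coord (u t)) \<le> ennreal M"
proof -
  define \<alpha> where "\<alpha> = interpolation_weight r"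
  have r: "2 \<le> r" and q: "2 \<le> q" using adm by (auto simp: strichartz_admissible_def)
  have \<alpha>: "0 \<le> \<alpha>" "\<alpha> \<le> 1" unfolding \<alpha>_def using interpolation_weight_bounds[OF r] by auto
  have cont: "continuous_on {0..} u" and bd: "\<And>t. 0 \<le> t \<Longrightarrow> norm (u t) \<le> M" and sb: "strichartz_bounded u M"
    using u by (auto simp: in_ball_def)
  have sup_le: "sup_norm (u t) \<le> M" if "0 \<le> t" for t
    using sup_norm_le_norm[of "u t"] bd[OF that] by linarith
  have pointwise: "lp_norm r (coord (u t)) \<le> ennreal (M powr (1 - \<alpha>) * sup_norm (u t) powr \<alpha>)" if "0 \<le> t" for t
    unfolding \<alpha>_def
    using bd[OF that] \<alpha> by (intro order_trans[OF lp_norm_coord_le[OF r]] ennreal_leI mult_right_mono powr_mono2)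
      (auto simp: \<alpha>_def)
  show ?thesis
  proof (cases q)
    case top
    have "lp_norm r (coord (u t)) \<le> ennreal M" if "0 \<le> t" for t
    proof -
      have "M powr (1 - \<alpha>) * sup_norm (u t) powr \<alpha> \<le> M powr (1 - \<alpha>) * M powr \<alpha>"
        using sup_le[OF that] \<alpha> by (intro mult_left_mono powr_mono2) auto
      also have "\<dots> = M" using M by (simp add: powr_add[symmetric])
      finally show ?thesis using pointwise[OF that] ennreal_leI order_trans by blast
    qed
    then show ?thesis using top
      by (auto simp: mixed_norm_def Lp_norm_def space_restrict_space intro!: SUP_least)
  next
    case (real \<kappa>)
    then have \<kappa>: "2 \<le> \<kappa>" using q by simp
    have six: "6 \<le> \<alpha> * \<kappa>" unfolding \<alpha>_def using adm real by (intro admissible_interpolation_weight) auto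
    have "(\<integral>\<^sup>+t. epowr (lp_norm r (coord (u t))) \<kappa> \<partial>restrict_space lborel {0..})
        \<le> (\<integral>\<^sup>+t. ennreal (M powr ((1 - \<alpha>) * \<kappa>) * sup_norm (u t) powr (\<alpha> * \<kappa>)) \<partial>restrict_space lborel {0..})"
    proof (intro nn_integral_mono)
      fix t :: real assume "t \<in> space (restrict_space lborel {0..})"
      then have t: "0 \<le> t" by (simp add: space_restrict_space)
      have "epowr (lp_norm r (coord (u t))) \<kappa> \<le> ennreal ((M powr (1 - \<alpha>) * sup_norm (u t) powr \<alpha>) powr \<kappa>)"
        using \<kappa> by (intro epowr_le_ennreal pointwise t) auto
      also have "(M powr (1 - \<alpha>) * sup_norm (u t) powr \<alpha>) powr \<kappa> = M powr ((1 - \<alpha>) * \<kappa>) * sup_norm (u t) powr (\<alpha> * \<kappa>)"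
        by (simp only: powr_mult powr_powr)
      finally show "epowr (lp_norm r (coord (u t))) \<kappa>
          \<le> ennreal (M powr ((1 - \<alpha>) * \<kappa>) * sup_norm (u t) powr (\<alpha> * \<kappa>))" .
    qed
    also have "\<dots> \<le> ennreal (M powr \<kappa>)"
    proof (rule nn_integral_le_of_integral_le)
      show "continuous_on {0..} (\<lambda>t. M powr ((1 - \<alpha>) * \<kappa>) * sup_norm (u t) powr (\<alpha> * \<kappa>))"
        using six by (intro continuous_intros cont) auto
      fix T :: real assume T: "0 \<le> T"
      have "integral {0..T} (\<lambda>t. M powr ((1 - \<alpha>) * \<kappa>) * sup_norm (u t) powr (\<alpha> * \<kappa>)) =
          M powr ((1 - \<alpha>) * \<kappa>) * integral {0..T} (\<lambda>t. sup_norm (u t) powr (\<alpha> * \<kappa>))" by simp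
      also have "\<dots> \<le> M powr ((1 - \<alpha>) * \<kappa>) * M powr (\<alpha> * \<kappa>)"
        by (intro mult_left_mono strichartz_bounded_integral_powr sb M cont T bd six) auto
      also have "\<dots> = M powr \<kappa>" by (simp add: powr_add[symmetric] algebra_simps)
      finally show "integral {0..T} (\<lambda>t. M powr ((1 - \<alpha>) * \<kappa>) * sup_norm (u t) powr (\<alpha> * \<kappa>)) \<le> M powr \<kappa>" .
    qed auto
    finally have "epowr (\<integral>\<^sup>+t. epowr (lp_norm r (coord (u t))) \<kappa> \<partial>restrict_space lborel {0..}) (1 / \<kappa>)
        \<le> ennreal ((M powr \<kappa>) powr (1 / \<kappa>))"
      using \<kappa> by (intro epowr_le_ennreal) auto
    then show ?thesis using real \<kappa> M by (simp add: mixed_norm_def Lp_norm_def powr_powr)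
  qed
qed

text \<open>For \<open>r > 2\<close> the sup norm has a positive weight in the interpolation, so its
  decay prevails over the merely bounded \<open>l\<^sup>2\<close> norm.\<close>

lemma lp_norm_tendsto_0:
  assumes u: "in_ball M u" and M: "0 < M" and lim: "((\<lambda>t. sup_norm (u t)) \<longlongrightarrow> 0) at_top" and r: "2 < r"
  shows "((\<lambda>t. lp_norm r (coord (u t))) \<longlongrightarrow> 0) at_top"
proof -
  define \<alpha> where "\<alpha> = interpolation_weight r"
  have \<alpha>: "0 < \<alpha>" "\<alpha> \<le> 1"
    using r by (cases r; auto simp: \<alpha>_def interpolation_weight_def)+
  have "((\<lambda>t. M powr (1 - \<alpha>) * sup_norm (u t) powr \<alpha>) \<longlongrightarrow> M powr (1 - \<alpha>) * 0 powr \<alpha>) at_top"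
    using \<alpha> by (intro tendsto_intros tendsto_powr' lim) auto
  then have upper: "((\<lambda>t. ennreal (M powr (1 - \<alpha>) * sup_norm (u t) powr \<alpha>)) \<longlongrightarrow> 0) at_top"
    using tendsto_ennrealI by fastforce
  show ?thesis
  proof (rule tendsto_sandwich[OF _ _ tendsto_const upper])
    show "\<forall>\<^sub>F t in at_top. lp_norm r (coord (u t)) \<le> ennreal (M powr (1 - \<alpha>) * sup_norm (u t) powr \<alpha>)"
    proof (rule eventually_at_top_linorderI[of 0])
      fix t :: real assume "0 \<le> t"
      then have "norm (u t) \<le> M" using u by (simp add: in_ball_def)
      then show "lp_norm r (coord (u t)) \<le> ennreal (M powr (1 - \<alpha>) * sup_norm (u t) powr \<alpha>)"
        using \<alpha> r unfolding \<alpha>_def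
        by (intro order_trans[OF lp_norm_coord_le] ennreal_leI mult_right_mono powr_mono2) auto
    qed
  qed auto
qed

section \<open>Sitewise solutions and fixed points in \<open>l\<^sup>2\<close>\<close>

lemma kg_sin_nonlinearity:
  assumes "0 \<le> \<sigma>"
  shows "kg_sin t (kg_nonlinearity \<sigma> (coord f)) = coord (sin_propagator t (nonlinearity \<sigma> f))"
  by (simp add: coord_propagators coord_nonlinearity[OF assms])

lemma coord_kg_map:
  "coord (kg_map \<sigma> \<mu> f0 f1 u t) n =
    kg_cos t (coord f0) n + kg_sin t (coord f1) n - of_real \<mu> * coord (duhamel (\<lambda>s. nonlinearity \<sigma> (u s)) t) n"
  by (simp add: kg_map_def coord_propagators scaleR_conv_of_real)

lemma lp_norm_2_diff: "lp_norm 2 (\<lambda>n. coord f n - coord g n) = ennreal (norm (f - g))"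
proof -
  have "(\<lambda>n. coord f n - coord g n) = coord (f - g)" by (simp add: fun_eq_iff)
  then show ?thesis by (simp only: lp_norm_2_coord)
qed

lemma kg_solution_of_fixed_point:
  assumes \<sigma>: "0 \<le> \<sigma>" and u: "continuous_on {0..} u" and fp: "\<And>t. 0 \<le> t \<Longrightarrow> u t = kg_map \<sigma> \<mu> f0 f1 u t"
  shows "kg_solution \<sigma> \<mu> (coord f0) (coord f1) (\<lambda>t. coord (u t))"
  unfolding kg_solution_def
proof (intro conjI allI impI)
  have "((\<lambda>s. norm (u s - u t)) \<longlongrightarrow> 0) (at t within {0..})" if "0 \<le> t" for t
    using u that unfolding continuous_on_def by (intro tendsto_norm_zero LIM_zero) simp
  then show "l2_continuous (\<lambda>t. coord (u t))"
    unfolding l2_continuous_def lp_norm_2_diff lp_norm_2_coord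
    by (auto simp flip: ennreal_0 simp del: ennreal_0)
  fix t :: real and n assume t: "0 \<le> t"
  have NL: "continuous_on {0..} (\<lambda>s. nonlinearity \<sigma> (u s))" by (rule continuous_on_nonlinearity[OF \<sigma> u])
  show "\<exists>I. ((\<lambda>s. kg_sin (t - s) (kg_nonlinearity \<sigma> (coord (u s))) n) has_integral I) {0..t} \<and>
      coord (u t) n = kg_cos t (coord f0) n + kg_sin t (coord f1) n - of_real \<mu> * I"
    unfolding kg_sin_nonlinearity[OF \<sigma>]
    using duhamel_has_integral_coord[OF NL, of t n] arg_cong[OF fp[OF t], of "\<lambda>f. coord f n"]
    unfolding coord_kg_map by blast
qed

text \<open>Serves uniqueness: an arbitrary solution is only known through scalar integrals at each
  site. Finite \<open>lp_norm\<close> lifts it to a continuous curve in \<open>ell2\<close>, and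
  uniqueness of the integral identifies those scalars with the coordinates of the Duhamel
  term.\<close>

lemma fixed_point_of_kg_solution:
  assumes \<sigma>: "0 \<le> \<sigma>" and v: "kg_solution \<sigma> \<mu> (coord f0) (coord f1) v"
  obtains w where "continuous_on {0..} w" "\<And>t. 0 \<le> t \<Longrightarrow> coord (w t) = v t"
    "\<And>t. 0 \<le> t \<Longrightarrow> w t = kg_map \<sigma> \<mu> f0 f1 w t"
proof -
  have l2: "l2_continuous v" and duh: "\<And>t n. 0 \<le> t \<Longrightarrow>
      \<exists>I. ((\<lambda>s. kg_sin (t - s) (kg_nonlinearity \<sigma> (v s)) n) has_integral I) {0..t} \<and>
      v t n = kg_cos t (coord f0) n + kg_sin t (coord f1) n - of_real \<mu> * I"
    using v by (auto simp: kg_solution_def)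
  have "\<exists>f. coord f = v t" if "0 \<le> t" for t
  proof -
    have "lp_norm 2 (v t) < \<infinity>" using l2 that by (simp add: l2_continuous_def)
    then obtain B where "lp_norm 2 (v t) = ennreal B" "0 \<le> B" by (cases "lp_norm 2 (v t)") auto
    then show ?thesis using ell2_of_lp_norm_le[of "v t" B] by auto
  qed
  then obtain w where w: "\<And>t. 0 \<le> t \<Longrightarrow> coord (w t) = v t" by metis
  have cont: "continuous_on {0..} w"
    unfolding continuous_on_def
  proof
    fix t :: real assume "t \<in> {0..}"
    then have t: "0 \<le> t" by simp
    have "((\<lambda>s. lp_norm 2 (\<lambda>n. v s n - v t n)) \<longlongrightarrow> 0) (at t within {0..})"
      using l2 t by (simp add: l2_continuous_def)
    moreover have "\<forall>\<^sub>F s in at t within {0..}. lp_norm 2 (\<lambda>n. v s n - v t n) = ennreal (norm (w s - w t))"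
      unfolding eventually_at_filter
      by (intro always_eventually) (auto simp: w[symmetric] t lp_norm_2_diff)
    ultimately have "((\<lambda>s. ennreal (norm (w s - w t))) \<longlongrightarrow> ennreal 0) (at t within {0..})"
      by (simp add: tendsto_cong)
    then have "((\<lambda>s. norm (w s - w t)) \<longlongrightarrow> 0) (at t within {0..})"
      by (rule tendsto_ennrealD) auto
    then show "(w \<longlongrightarrow> w t) (at t within {0..})"
      by (intro LIM_zero_cancel[of w]) (rule tendsto_norm_zero_cancel)
  qed
  have "w t = kg_map \<sigma> \<mu> f0 f1 w t" if t: "0 \<le> t" for t
  proof (rule ell2_eqI)
    fix n
    obtain I where I: "((\<lambda>s. kg_sin (t - s) (kg_nonlinearity \<sigma> (v s)) n) has_integral I) {0..t}"
      "v t n = kg_cos t (coord f0) n + kg_sin t (coord f1) n - of_real \<mu> * I"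
      using duh[OF t] by blast
    have "((\<lambda>s. coord (sin_propagator (t - s) (nonlinearity \<sigma> (w s))) n) has_integral I) {0..t}"
      using I(1) by (rule has_integral_eq[rotated]) (simp add: w[symmetric] kg_sin_nonlinearity[OF \<sigma>])
    then have "I = coord (duhamel (\<lambda>s. nonlinearity \<sigma> (w s)) t) n"
      using duhamel_has_integral_coord[OF continuous_on_nonlinearity[OF \<sigma> cont]] has_integral_unique by blast
    then show "coord (w t) n = coord (kg_map \<sigma> \<mu> f0 f1 w t) n"
      unfolding coord_kg_map w[OF t] I(2) by simp
  qed
  then show ?thesis using that cont w by blast
qed

theorem theorem5:
  fixes \<sigma> :: real
  assumes "\<sigma> \<ge> 3"
  shows "\<exists>\<epsilon> C :: real. \<epsilon> > 0 \<and>
    (\<forall>\<mu> \<in> {1, -1 :: real}. \<forall>u0 u1 :: int \<Rightarrow> complex.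
       lp_norm 2 u0 \<le> ennreal \<epsilon> \<and> lp_norm 2 u1 \<le> ennreal \<epsilon> \<longrightarrow>
       (\<exists>u. kg_solution \<sigma> \<mu> u0 u1 u \<and>
            (\<forall>v. kg_solution \<sigma> \<mu> u0 u1 v \<longrightarrow> (\<forall>t\<ge>0. v t = u t)) \<and>
            (\<forall>q r. strichartz_admissible q r \<longrightarrow> mixed_norm q r u \<le> ennreal (C * \<epsilon>)) \<and>
            (\<forall>r>2. ((\<lambda>t. lp_norm r (u t)) \<longlongrightarrow> 0) at_top)))"
proof -
  \<comment> \<open>The value for which
    \<open>400 * (2 * \<sigma> + 1) * M powr (2 * \<sigma>)\<close> equals 1. Data of size
    \<open>\<epsilon> = M / 400\<close> fit the ball of radius \<open>M\<close>, whence
    \<open>C = 400\<close>.\<close>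
  define M where "M = (1 / (400 * (2 * \<sigma> + 1))) powr (1 / (2 * \<sigma>))"
  have M: "0 < M" using assms by (simp add: M_def)
  have "M powr (2 * \<sigma>) = 1 / (400 * (2 * \<sigma> + 1))" using assms by (simp add: M_def powr_powr)
  then have small: "400 * (2 * \<sigma> + 1) * M powr (2 * \<sigma>) \<le> 1" using assms by simp
  have main: "\<exists>u. kg_solution \<sigma> \<mu> u0 u1 u \<and>
            (\<forall>v. kg_solution \<sigma> \<mu> u0 u1 v \<longrightarrow> (\<forall>t\<ge>0. v t = u t)) \<and>
            (\<forall>q r. strichartz_admissible q r \<longrightarrow> mixed_norm q r u \<le> ennreal (400 * (M / 400))) \<and>
            (\<forall>r>2. ((\<lambda>t. lp_norm r (u t)) \<longlongrightarrow> 0) at_top)"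
    if \<mu>: "\<mu> \<in> {1, -1}" and u0: "lp_norm 2 u0 \<le> ennreal (M / 400)" and u1: "lp_norm 2 u1 \<le> ennreal (M / 400)"
    for \<mu> u0 u1
  proof -
    obtain f0 where g0: "coord f0 = u0" "norm f0 \<le> M / 400" using ell2_of_lp_norm_le[OF u0] M by auto
    obtain f1 where g1: "coord f1 = u1" "norm f1 \<le> M / 400" using ell2_of_lp_norm_le[OF u1] M by auto
    interpret small_data \<sigma> \<mu> M f0 f1
      by standard (use assms \<mu> M small g0 g1 in auto)
    obtain u where u: "in_ball M u" and fp: "\<And>t. 0 \<le> t \<Longrightarrow> u t = kg_map \<sigma> \<mu> f0 f1 u t"
      using ex_fixed_point by blast
    have cont: "continuous_on {0..} u" using u by (simp add: in_ball_def)
    show ?thesis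
    proof (intro exI[of _ "\<lambda>t. coord (u t)"] conjI allI impI)
      show "kg_solution \<sigma> \<mu> u0 u1 (\<lambda>t. coord (u t))"
        using kg_solution_of_fixed_point[OF \<sigma>_nonneg cont fp] by (simp add: g0 g1)
      show "v t = coord (u t)" if v: "kg_solution \<sigma> \<mu> u0 u1 v" and t: "0 \<le> t" for v and t :: real
      proof -
        obtain w where w: "continuous_on {0..} w" "\<And>t. 0 \<le> t \<Longrightarrow> coord (w t) = v t"
          "\<And>t. 0 \<le> t \<Longrightarrow> w t = kg_map \<sigma> \<mu> f0 f1 w t"
          using fixed_point_of_kg_solution[OF \<sigma>_nonneg, of \<mu> f0 f1 v] v by (auto simp: g0 g1)
        have "u t = w t" by (rule kg_map_fixed_point_unique[OF \<sigma>_nonneg cont w(1) fp w(3) t])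
        then show ?thesis using w(2)[OF t] by simp
      qed
      show "mixed_norm q r (\<lambda>t. coord (u t)) \<le> ennreal (400 * (M / 400))" if "strichartz_admissible q r" for q r
        using mixed_norm_le[OF u M that] by simp
      show "((\<lambda>t. lp_norm r (coord (u t))) \<longlongrightarrow> 0) at_top" if "2 < r" for r
        by (rule lp_norm_tendsto_0[OF u M fixed_point_tendsto_0[OF u fp] that])
    qed
  qed
  show ?thesis
    by (rule exI[of _ "M / 400"], rule exI[of _ 400]) (use main M in auto)
qed

end
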